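(* Let $\mathcal{Z}$ be a pointed matched circle, let $(M,d)$ be the chain complex over $\mathbb{F}_2$ and $H:M\to M$ the linear map defined in the context, and let $N\subset M$ be the subcomplex (with zero differential) spanned by the idempotent generators. Let $f:N\to M$ be the inclusion and $g:M\to N$ the map sending each idempotent generator to itself and all other generators to zero. Then $$d\circ H+H\circ d=\mathbb{I}_M+f\circ g.$$
   Context: **Strands algebra.** A pointed matched circle $\mathcal{Z}$ is an oriented circle $Z$ with a basepoint $z$, $4k$ points of $Z\setminus z$ labelled $1,\dots,4k$ from bottom to top, and a partition of these points into $2k$ matched pairs, such that attaching handles (oriented surgery) along the matched pairs yields a single circle. The dg-algebra $\mathcal{A}=\mathcal{A}(\mathcal{Z})$ over $\mathbb{F}_2$: a generator $a$ consists of a set of moving strands $s\to t$ with $s<t$ in $\{1,\dots,4k\}$ and a set $h$ of matched pairs (double horizontals), such that the starting points lie in distinct matched pairs, the end points lie in distinct matched pairs, and no pair in $h$ contains a starting or end point. Its left (right) idempotent is the set of pairs in $h$ together with the pairs containing starting (end) points. Let $A(4k)$ have $\mathbb{F}_2$-basis the bijections $\phi:S\to T$, $S,T\subset\{1,\dots,4k\}$, $\phi(s)\ge s$; let $\mathrm{inv}(\phi)$ be the number of pairs $s<s'$ with $\phi(s)>\phi(s')$ (crossings). The product $\phi\cdot\psi$ is $\psi\circ\phi$ if the image of $\phi$ is the domain of $\psi$ and $\mathrm{inv}(\psi\circ\phi)=\mathrm{inv}(\phi)+\mathrm{inv}(\psi)$, and $0$ otherwise; $d\phi$ is the sum, over crossings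 of $\phi$, of the map with the two values swapped, provided $\mathrm{inv}$ drops by exactly $1$. A generator of $\mathcal{A}$ is identified with the sum over all choices of one point $c$ from each pair in $h$ of the bijection formed by the moving strands and the constant strands $c\to c$; these span the dg-subalgebra $\mathcal{A}$ (all numbers of strands allowed). Indecomposable idempotents are the generators without moving strands (i.e. sets of matched pairs). A chord $\xi$ is a pair $p<q$ of points; $a(\xi)\in\mathcal{A}$ is the sum of all generators whose only moving strand is $p\to q$. **The complex $M$.** $M$ is the $\mathbb{F}_2$-vector space generated by pairs $[a_1,a_2]$ of generators of $\mathcal{A}$ such that the left idempotents of $a_1$ and $a_2$ are complementary ($a_1$ is "on the left", $a_2$ "on the right"). The differential $d$ is the sum of the following arrows ($\mathbf{x}\to\mathbf{y}$ means that $\mathbf{y}$ contributes to $d\mathbf{x}$): $[a_1,a_2]\to[a_1,b]$ for each generator $b$ in $da_2$; $[b,a_2]\to[a_1,a_2]$ for each generator $b$ in $da_1$; $[a(\xi)c,a]\to[c,a(\xi)a]$ for each chord $\xi$ and generators $a,c$ of $\mathcal{A}$ with $a(\xi)c\ne0$, $a(\xi)a\ne0$ (both sides being generators of $M$). A generator $[a_1,a_2]$ is called idempotent if both $a_1,a_2$ are idempotents. The multiplicity of $[a_1,a_2]$ at a segment $[p,p+1]$, $1\le p<4k$, is the number of moving strands of $a_1$ and $a_2$ covering it. **The map $H$.** In each case below only the changes of moving strands are listed, all other moving strands are kept, and the double horizontals are determined by the requirement that the right idempotents of $a_1$ and of $a_2$ are unchanged. On idempotent generators $H=0$. *(Multiplicity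 one: all multiplicities $\le1$, non-idempotent.)* Order the segments $[p,p+1]$, $1\le p<4k$, by $<_{\mathcal{Z}}$: with $q$ the point matched to $p+1$, $[p,p+1]$ is the first segment if $q=4k$, and otherwise its immediate predecessor is $[q,q+1]$. The key segment of $[a_1,a_2]$ is the $<_{\mathcal{Z}}$-first segment $[p,p+1]$ of multiplicity one; the key pair is $\{p+1,q\}$, $q$ matched to $p+1$. The key segment is on the left (right) if covered by $a_1$ ($a_2$); the key pair is on the left (right) if it lies in the left idempotent of $a_1$ ($a_2$), either as a double horizontal or as the start of a moving strand (which then starts at $p+1$). $H$ is the sum of the following terms and is zero for all other types: 1. Key segment left, key pair left as a double horizontal: there is a strand $a\to b$ in $a_1$ with $a<p+1<b$; replace it in $a_1$ (together with the double horizontal) by $a\to p+1$ and $p+1\to b$. 2. Key segment right, key pair right, moving: $a_2$ has strands $i\to p+1$, $p+1\to j$; replace them by $i\to j$ and the double horizontal $\{p+1,q\}$. If moreover $a_1$ has a strand $r\to q$, there is an additional term: move $r\to q$ from $a_1$ to $a_2$ and $i\to p+1$ from $a_2$ to $a_1$. 3. Key segment right, covered by $i\to j$ in $a_2$, key pair left as a double horizontal: in $a_2$ replace $i\to j$ by $p+1\to j$ (by a double horizontal $\{p+1,q\}$ if $j=p+1$), and add $i\to p+1$ to $a_1$. 4. Key segment right, key pair left, moving: $a_1$ has $p+1\to j$ and $a_2$ has $i\to p+1$; replace $p+1\to j$ by $i\to j$ in $a_1$ and $i\to p+1$ by the double horizontal $\{p+1,q\}$ in $a_2$. If moreover $a_1$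 has a strand $r\to q$ with $r\ne p+1$, there is an additional term: move $r\to q$ to $a_2$ and $i\to p+1$ to $a_1$ (keeping $p+1\to j$ in $a_1$). If instead $a_1$ has the strand $p+1\to q$ (so $j=q$), there is an additional term: move $p+1\to q$ to $a_2$ and $i\to p+1$ to $a_1$. *(Other generators: some multiplicity $>1$.)* Let $[i,i+1]$ be the bottom-most segment of multiplicity $>1$ (it is then 2, and $[i-1,i]$ has multiplicity 1). The $i$ strand is the unique strand starting at $i$; the $j$ strand is the unique strand covering $[i-1,i]$, starting at $j<i$. (1) Both on the left and crossing: $H$ uncrosses them (swaps end points). (2) Both on the right and not crossing: $H$ crosses them (swaps end points). (3) $i$ strand $i\to t$ on the left, $j$ strand $j\to s$ on the right: $H$ replaces $i\to t$ by $j\to t$ in $a_1$ and $j\to s$ by $i\to s$ in $a_2$. Otherwise $H=0$. *)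

theory Defs
  imports "HOL-Library.Poly_Mapping" "HOL-Library.Z2" "HOL-Library.FuncSet"
begin

section \<open>Linear algebra over the field with two elements\<close>

type_synonym 'a f2span = "'a \<Rightarrow>\<^sub>0 bit"

abbreviation basis :: "'a \<Rightarrow> 'a f2span" where
  "basis a \<equiv> Poly_Mapping.single a 1"

text \<open>Linear extension of a map on basis elements; over the field with two elements every
  nonzero coefficient is 1, so a vector is the sum of the basis elements in its support.\<close>
definition lin :: "('a \<Rightarrow> 'b f2span) \<Rightarrow> 'a f2span \<Rightarrow> 'b f2span" where
  "lin F x = (\<Sum>a\<in>Poly_Mapping.keys x. F a)"


section \<open>The strands algebra on n points\<close>

text \<open>A basis element, i.e. a bijection \<open>S \<rightarrow> T\<close> with \<open>\<phi>(s) \<ge> s\<close>, is represented by its graph.\<close>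
type_synonym strands = "(nat \<times> nat) set"

definition strand_bijections :: "nat \<Rightarrow> strands set" where
  "strand_bijections n = {\<phi>. single_valued \<phi> \<and> single_valued (\<phi>\<inverse>) \<and>
     \<phi> \<subseteq> {(s, t). s \<in> {1..n} \<and> t \<in> {1..n} \<and> s \<le> t}}"

definition crossings :: "strands \<Rightarrow> ((nat \<times> nat) \<times> (nat \<times> nat)) set" where
  "crossings \<phi> = {((s, t), (s', t')). (s, t) \<in> \<phi> \<and> (s', t') \<in> \<phi> \<and> s < s' \<and> t > t'}"

definition inv_count :: "strands \<Rightarrow> nat" where
  "inv_count \<phi> = card (crossings \<phi>)"

text \<open>On graphs, \<open>\<phi> O \<psi>\<close> is the composite \<open>\<psi> \<circ> \<phi>\<close>.\<close>
definition strands_mult_basis :: "strands \<Rightarrow> strands \<Rightarrow> strands f2span" where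
  "strands_mult_basis \<phi> \<psi> =
     (if Range \<phi> = Domain \<psi> \<and> inv_count (\<phi> O \<psi>) = inv_count \<phi> + inv_count \<psi>
      then basis (\<phi> O \<psi>) else 0)"

definition strands_mult :: "strands f2span \<Rightarrow> strands f2span \<Rightarrow> strands f2span" where
  "strands_mult x y = lin (\<lambda>\<phi>. lin (\<lambda>\<psi>. strands_mult_basis \<phi> \<psi>) y) x"

fun swap_ends :: "strands \<Rightarrow> (nat \<times> nat) \<times> (nat \<times> nat) \<Rightarrow> strands" where
  "swap_ends \<phi> ((s, t), (s', t')) = \<phi> - {(s, t), (s', t')} \<union> {(s, t'), (s', t)}"

definition strands_diff_basis :: "strands \<Rightarrow> strands f2span" where
  "strands_diff_basis \<phi> =
     (\<Sum>c | c \<in> crossings \<phi> \<and> inv_count (swap_ends \<phi> c) + 1 = inv_count \<phi>.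
        basis (swap_ends \<phi> c))"

definition strands_diff :: "strands f2span \<Rightarrow> strands f2span" where
  "strands_diff = lin strands_diff_basis"


section \<open>Pointed matched circles\<close>

text \<open>Label each of the \<open>4k\<close> arcs into which the points cut the circle by its initial point (arc
  \<open>4k\<close> contains the basepoint and ends at point 1). Oriented surgery along all matched pairs
  joins the arc arriving at a point to the arc leaving the point matched to it, so the
  components of the surgered manifold are the orbits of the following map on arcs.\<close>
definition surgery_next :: "nat \<Rightarrow> (nat \<Rightarrow> nat) \<Rightarrow> nat \<Rightarrow> nat" where
  "surgery_next k mate i = mate (if i = 4 * k then 1 else i + 1)"

text \<open>A generator is given by its moving strands and its double horizontals.\<close>
datatype gen = Gen (mov: "(nat \<times> nat) set") (dh: "nat set set")

locale pmc =
  fixes k :: nat and mate :: "nat \<Rightarrow> nat"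
  assumes mate_range: "i \<in> {1..4 * k} \<Longrightarrow> mate i \<in> {1..4 * k}"
    and mate_neq: "i \<in> {1..4 * k} \<Longrightarrow> mate i \<noteq> i"
    and mate_mate: "i \<in> {1..4 * k} \<Longrightarrow> mate (mate i) = i"
    and single_circle: "i \<in> {1..4 * k} \<Longrightarrow> j \<in> {1..4 * k} \<Longrightarrow>
          \<exists>n. (surgery_next k mate ^^ n) i = j"
begin

definition points :: "nat set" where
  "points = {1..4 * k}"

definition pair :: "nat \<Rightarrow> nat set" where
  "pair i = {i, mate i}"

definition pairs :: "nat set set" where
  "pairs = pair ` points"

definition chords :: "(nat \<times> nat) set" where
  "chords = {(p, q). p \<in> points \<and> q \<in> points \<and> p < q}"


subsection \<open>The algebra of the pointed matched circle\<close>

definition gens :: "gen set" where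
  "gens = {a. mov a \<subseteq> chords \<and>
              inj_on (\<lambda>(s, t). pair s) (mov a) \<and>
              inj_on (\<lambda>(s, t). pair t) (mov a) \<and>
              dh a \<subseteq> pairs \<and>
              (\<forall>P\<in>dh a. \<forall>(s, t)\<in>mov a. s \<notin> P \<and> t \<notin> P)}"

definition left_idem :: "gen \<Rightarrow> nat set set" where
  "left_idem a = dh a \<union> (\<lambda>(s, t). pair s) ` mov a"

definition right_idem :: "gen \<Rightarrow> nat set set" where
  "right_idem a = dh a \<union> (\<lambda>(s, t). pair t) ` mov a"

definition idempotent :: "gen \<Rightarrow> bool" where
  "idempotent a \<longleftrightarrow> mov a = {}"

definition choices :: "nat set set \<Rightarrow> nat set set" where
  "choices h = {C. C \<subseteq> \<Union>h \<and> (\<forall>P\<in>h. \<exists>!c. c \<in> P \<and> c \<in> C)}"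

text \<open>The element of the strands algebra on \<open>4k\<close> points with which a generator is identified.\<close>
definition emb :: "gen \<Rightarrow> strands f2span" where
  "emb a = (\<Sum>C\<in>choices (dh a). basis (mov a \<union> Id_on C))"

lemma emb_strand_bijections:
  assumes "a \<in> gens"
  shows "Poly_Mapping.keys (emb a) \<subseteq> strand_bijections (4 * k)"
proof -
  have mv: "mov a \<subseteq> chords" and dp: "dh a \<subseteq> pairs"
    and ist: "inj_on (\<lambda>(s, t). pair s) (mov a)" and it: "inj_on (\<lambda>(s, t). pair t) (mov a)"
    and no: "\<And>P s t. P \<in> dh a \<Longrightarrow> (s, t) \<in> mov a \<Longrightarrow> s \<notin> P \<and> t \<notin> P"
    using assms by (auto simp: gens_def)
  have pp: "\<Union>pairs \<subseteq> points"
    using mate_range by (auto simp: pairs_def pair_def points_def)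
  have key: "mov a \<union> Id_on C \<in> strand_bijections (4 * k)" if C: "C \<in> choices (dh a)" for C
  proof -
    have Ch: "C \<subseteq> \<Union>(dh a)" using C by (auto simp: choices_def)
    have Cp: "C \<subseteq> points" using Ch dp pp by blast
    have dis: "(s, t) \<in> mov a \<Longrightarrow> s \<notin> C \<and> t \<notin> C" for s t using Ch no by blast
    have u1: "t = t'" if "(s, t) \<in> mov a" "(s, t') \<in> mov a" for s t t'
      using inj_onD[OF ist _ that] by simp
    have u2: "s = s'" if "(s, t) \<in> mov a" "(s', t) \<in> mov a" for s s' t
      using inj_onD[OF it _ that] by simp
    have "single_valued (mov a \<union> Id_on C)"
      by (rule single_valuedI) (use dis u1 in blast)
    moreover have "single_valued ((mov a \<union> Id_on C)\<inverse>)"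
      by (rule single_valuedI) (use dis u2 in blast)
    moreover have "mov a \<union> Id_on C \<subseteq> {(s, t). s \<in> {1..4 * k} \<and> t \<in> {1..4 * k} \<and> s \<le> t}"
      using mv Cp unfolding chords_def points_def by auto
    ultimately show ?thesis
      by (simp add: strand_bijections_def)
  qed
  have "Poly_Mapping.keys (emb a) \<subseteq>
      (\<Union>C\<in>choices (dh a). Poly_Mapping.keys (basis (mov a \<union> Id_on C)))"
    unfolding emb_def by (rule Poly_Mapping.keys_sum)
  then show ?thesis using key by auto
qed

text \<open>The generator \<open>b\<close> occurs in the expansion of the element \<open>y\<close> of the algebra. The elements
  \<open>emb b\<close> have pairwise disjoint nonempty supports, so the expansion is unique.\<close>
definition occurs_in :: "gen \<Rightarrow> strands f2span \<Rightarrow> bool" where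
  "occurs_in b y \<longleftrightarrow> (\<exists>B\<subseteq>gens. y = (\<Sum>a\<in>B. emb a) \<and> b \<in> B)"

definition chord_elt :: "nat \<times> nat \<Rightarrow> strands f2span" where
  "chord_elt \<xi> = (\<Sum>a | a \<in> gens \<and> mov a = {\<xi>}. emb a)"


subsection \<open>The complex\<close>

definition M_gens :: "(gen \<times> gen) set" where
  "M_gens = {(a1, a2). a1 \<in> gens \<and> a2 \<in> gens \<and>
     left_idem a1 \<inter> left_idem a2 = {} \<and> left_idem a1 \<union> left_idem a2 = pairs}"

text \<open>Linear maps with domain \<open>M\<close> or \<open>N\<close> are rendered as extensional functions on that set.\<close>
definition M :: "(gen \<times> gen) f2span set" where
  "M = {x. Poly_Mapping.keys x \<subseteq> M_gens}"

text \<open>In the third sum the generator \<open>[a1, a2]\<close> is written as \<open>[a(\<xi>)c, a2]\<close> in all possible ways,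
  and \<open>b = a(\<xi>)a2\<close>; the two equations force these products to be nonzero.\<close>
fun d_gen :: "gen \<times> gen \<Rightarrow> (gen \<times> gen) f2span" where
  "d_gen (a1, a2) =
     (\<Sum>b | b \<in> gens \<and> occurs_in b (strands_diff (emb a2)). basis (a1, b)) +
     (\<Sum>b | b \<in> gens \<and> occurs_in a1 (strands_diff (emb b)). basis (b, a2)) +
     (\<Sum>(\<xi>, c, b) | \<xi> \<in> chords \<and> (c, b) \<in> M_gens \<and>
          strands_mult (chord_elt \<xi>) (emb c) = emb a1 \<and>
          strands_mult (chord_elt \<xi>) (emb a2) = emb b.
        basis (c, b))"

definition d :: "(gen \<times> gen) f2span \<Rightarrow> (gen \<times> gen) f2span" where
  "d = restrict (lin d_gen) M"

fun idempotent_gen :: "gen \<times> gen \<Rightarrow> bool" where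
  "idempotent_gen (a1, a2) \<longleftrightarrow> idempotent a1 \<and> idempotent a2"

definition N :: "(gen \<times> gen) f2span set" where
  "N = {x. Poly_Mapping.keys x \<subseteq> {y \<in> M_gens. idempotent_gen y}}"

text \<open>The inclusion of \<open>N\<close> in \<open>M\<close>, and the projection of \<open>M\<close> onto \<open>N\<close>.\<close>
definition f :: "(gen \<times> gen) f2span \<Rightarrow> (gen \<times> gen) f2span" where
  "f = (\<lambda>x\<in>N. x)"

definition g :: "(gen \<times> gen) f2span \<Rightarrow> (gen \<times> gen) f2span" where
  "g = restrict (lin (\<lambda>y. if idempotent_gen y then basis y else 0)) M"


subsection \<open>The homotopy\<close>

text \<open>The segment \<open>[p, p+1]\<close> is represented by \<open>p\<close>.\<close>
definition segments :: "nat set" where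
  "segments = {1..<4 * k}"

definition covering :: "gen \<Rightarrow> nat \<Rightarrow> (nat \<times> nat) set" where
  "covering a p = {(s, t). (s, t) \<in> mov a \<and> s \<le> p \<and> p < t}"

fun multiplicity :: "gen \<times> gen \<Rightarrow> nat \<Rightarrow> nat" where
  "multiplicity (a1, a2) p = card (covering a1 p) + card (covering a2 p)"

text \<open>The order \<open><\<^sub>Z\<close> is generated by its immediate predecessor relation: for \<open>q\<close> matched to \<open>p+1\<close>
  and \<open>q \<noteq> 4k\<close>, the segment \<open>[q, q+1]\<close> immediately precedes \<open>[p, p+1]\<close>.\<close>
definition less_Z :: "nat \<Rightarrow> nat \<Rightarrow> bool" where
  "less_Z p p' \<longleftrightarrow> (p, p') \<in> {(q, r). r \<in> segments \<and> q = mate (r + 1) \<and> q \<noteq> 4 * k}\<^sup>+"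

definition key_segment :: "gen \<times> gen \<Rightarrow> nat" where
  "key_segment x = (THE p. p \<in> segments \<and> multiplicity x p = 1 \<and>
     (\<forall>p'\<in>segments. multiplicity x p' = 1 \<and> p' \<noteq> p \<longrightarrow> less_Z p p'))"

text \<open>The generator with moving strands \<open>V\<close> and with the same right idempotent as \<open>a\<close>.\<close>
definition set_mov :: "gen \<Rightarrow> (nat \<times> nat) set \<Rightarrow> gen" where
  "set_mov a V = Gen V {P \<in> right_idem a. \<forall>(s, t)\<in>V. t \<notin> P}"

text \<open>Move the strand \<open>\<sigma>\<close> of \<open>a1\<close> to \<open>a2\<close> and the strand \<open>\<tau>\<close> of \<open>a2\<close> to \<open>a1\<close>.\<close>
definition exchange :: "gen \<Rightarrow> gen \<Rightarrow> nat \<times> nat \<Rightarrow> nat \<times> nat \<Rightarrow> gen \<times> gen" where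
  "exchange a1 a2 \<sigma> \<tau> =
     (set_mov a1 (mov a1 - {\<sigma>} \<union> {\<tau>}), set_mov a2 (mov a2 - {\<tau>} \<union> {\<sigma>}))"

text \<open>In the following definitions, a sum over strands of a prescribed form adds the terms for
  all such strands; on generators of multiplicity one (respectively, for the bottom-most segment
  of higher multiplicity) there is at most one choice of each of them.

  In \<open>H_one\<close>, \<open>e = p + 1\<close> is the upper end of the key segment. A pair lies in the left
  idempotent as the start of a moving strand iff it lies there and is not a double horizontal.\<close>
fun H_one :: "gen \<times> gen \<Rightarrow> (gen \<times> gen) f2span" where
  "H_one (a1, a2) =
    (let p = key_segment (a1, a2); e = p + 1; q = mate e; K = pair e;
         V1 = mov a1; V2 = mov a2;
         segL = (covering a1 p \<noteq> {}); segR = (covering a2 p \<noteq> {})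
     in
      if segL \<and> K \<in> dh a1 then
        (\<Sum>(a, b) | (a, b) \<in> V1 \<and> a < e \<and> e < b.
           basis (set_mov a1 (V1 - {(a, b)} \<union> {(a, e), (e, b)}), a2))
      else if segR \<and> K \<in> left_idem a2 - dh a2 then
        (\<Sum>(i, j) | (i, e) \<in> V2 \<and> (e, j) \<in> V2.
           basis (a1, set_mov a2 (V2 - {(i, e), (e, j)} \<union> {(i, j)})) +
           (\<Sum>r | (r, q) \<in> V1. basis (exchange a1 a2 (r, q) (i, e))))
      else if segR \<and> K \<in> dh a1 then
        (\<Sum>(i, j) | (i, j) \<in> covering a2 p.
           basis (set_mov a1 (V1 \<union> {(i, e)}),
                  set_mov a2 (V2 - {(i, j)} \<union> (if j = e then {} else {(e, j)}))))
      else if segR \<and> K \<in> left_idem a1 - dh a1 then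
        (\<Sum>(i, j) | (i, e) \<in> V2 \<and> (e, j) \<in> V1.
           basis (set_mov a1 (V1 - {(e, j)} \<union> {(i, j)}), set_mov a2 (V2 - {(i, e)})) +
           (\<Sum>r | (r, q) \<in> V1 \<and> r \<noteq> e. basis (exchange a1 a2 (r, q) (i, e))) +
           (if j = q then basis (exchange a1 a2 (e, q) (i, e)) else 0))
      else 0)"

text \<open>The strand \<open>j \<rightarrow> s\<close> covers \<open>[i-1, i]\<close> iff \<open>j < i\<close> and \<open>i \<le> s\<close>; it crosses \<open>i \<rightarrow> t\<close> iff
  \<open>t < s\<close>.\<close>
fun H_many :: "gen \<times> gen \<Rightarrow> (gen \<times> gen) f2span" where
  "H_many (a1, a2) =
    (let i = (LEAST i. i \<in> segments \<and> multiplicity (a1, a2) i > 1);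
         V1 = mov a1; V2 = mov a2
     in
      (\<Sum>(t, j, s) | (i, t) \<in> V1 \<and> (j, s) \<in> V1 \<and> j < i \<and> i \<le> s \<and> t < s.
         basis (set_mov a1 (V1 - {(i, t), (j, s)} \<union> {(i, s), (j, t)}), a2)) +
      (\<Sum>(t, j, s) | (i, t) \<in> V2 \<and> (j, s) \<in> V2 \<and> j < i \<and> i \<le> s \<and> \<not> t < s.
         basis (a1, set_mov a2 (V2 - {(i, t), (j, s)} \<union> {(i, s), (j, t)}))) +
      (\<Sum>(t, j, s) | (i, t) \<in> V1 \<and> (j, s) \<in> V2 \<and> j < i \<and> i \<le> s.
         basis (set_mov a1 (V1 - {(i, t)} \<union> {(j, t)}), set_mov a2 (V2 - {(j, s)} \<union> {(i, s)}))))"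

definition H_gen :: "gen \<times> gen \<Rightarrow> (gen \<times> gen) f2span" where
  "H_gen x = (if idempotent_gen x then 0
              else if \<forall>p\<in>segments. multiplicity x p \<le> 1 then H_one x
              else H_many x)"

definition H :: "(gen \<times> gen) f2span \<Rightarrow> (gen \<times> gen) f2span" where
  "H = restrict (lin H_gen) M"

end

end

theory Submission
  imports Defs
begin

text \<open>
  The idea is to read a generator \<open>[a1, a2]\<close> as a single strand diagram. Give a right end point \<open>t\<close> the
  label \<open>t\<close> and a left end point \<open>t\<close> the label \<open>8k+1-t\<close>, so that the labels run up the right end
  points and then down the left ones. Since the left idempotents are complementary, every matched
  pair starts either one moving strand or a double horizontal, and the generator becomes a function
  (\<open>state\<close>) from starting points to labels. All three kinds of arrows of the differential now have the
  same form (\<open>edges\<close>, \<open>d_gen_decode\<close>): two strands whose labels are in the wrong order exchange their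
  labels, provided that no strand lies between them. Up to the condition that strands go up, this is
  the sum over the lower covers in the Bruhat order.

  From this description the square of the differential vanishes (\<open>boundary_boundary\<close>): two
  successive exchanges at disjoint pairs of strands commute, and two that share a strand have exactly
  one other factorization, as in the symmetric group on three letters.

  The map \<open>H\<close> also becomes uniform. There is a point \<open>e\<close>, determined by the multiplicities alone
  (\<open>pivot_point\<close>: the top of the key segment, or the bottom of the first segment of multiplicity two),
  such that exactly one strand, starting at \<open>w\<close> say, covers the segment below \<open>e\<close>, and a strand
  starts at \<open>e\<close>. Call a state crossed if the label at \<open>w\<close> exceeds the label at \<open>e\<close>. Then \<open>H\<close> vanishes
  on crossed states and crosses the two strands in the others, with one correction term
  (\<open>homotopy_at\<close>, \<open>H_gen_decode\<close>). An exchange other than the one at \<open>(w, e)\<close> leads from crossed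
  states to crossed states (\<open>edge_keeps_crossed\<close>), with one exception that the correction term
  cancels; hence \<open>H d x = x\<close> for crossed \<open>x\<close> (\<open>homotopy_boundary\<close>).

  This suffices. Let \<open>D = d H + H d + 1\<close>. On crossed states \<open>D\<close> is zero because \<open>H\<close> is, and
  \<open>D (d x) = d x + H (d (d x)) + d x = 0\<close> for crossed \<open>x\<close>. Every uncrossed state is the only term of some
  \<open>d x\<close>, \<open>x\<close> crossed, on which \<open>D\<close> is not already known to vanish, so \<open>D\<close> is zero there too
  (\<open>defect_zero\<close>). What remains is to translate the definitions: the algebra elements are sums over
  the choices of a point from each double horizontal, and the conditions on inversion numbers have to
  be turned into conditions on strands in between (\<open>strands_diff_emb\<close>, \<open>strands_mult_chord_eq_iff\<close>).
\<close>

section \<open>Linear extension over the field with two elements\<close>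

lemma f2_add_self [simp]: "x + x = (0 :: 'a f2span)"
  by (rule poly_mapping_eqI) (simp add: lookup_add)

lemma f2_add_eq_0_iff: "x + y = 0 \<longleftrightarrow> x = (y :: 'a f2span)"
  by (metis add.assoc add.left_neutral add.right_neutral f2_add_self)

text \<open>The support of \<open>x + y\<close> is in general smaller than the union of the supports. Summing over a common
  finite superset instead makes the additivity of linear extension visible.\<close>
lemma lin_superset:
  assumes "finite A" "Poly_Mapping.keys x \<subseteq> A"
  shows "lin F x = (\<Sum>a\<in>A. if Poly_Mapping.lookup x a = 1 then F a else 0)"
proof -
  have "lin F x = (\<Sum>a\<in>Poly_Mapping.keys x. if Poly_Mapping.lookup x a = 1 then F a else 0)"
    unfolding lin_def by (rule sum.cong) (auto simp: in_keys_iff)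
  also have "\<dots> = (\<Sum>a\<in>A. if Poly_Mapping.lookup x a = 1 then F a else 0)"
    by (rule sum.mono_neutral_left) (use assms in \<open>auto simp: in_keys_iff\<close>)
  finally show ?thesis .
qed

lemma lin_zero [simp]: "lin F 0 = 0"
  by (simp add: lin_def)

lemma lin_basis [simp]: "lin F (basis a) = F a"
  by (simp add: lin_def)

lemma lin_add: "lin F (x + y) = lin F x + lin F y"
proof -
  let ?A = "Poly_Mapping.keys x \<union> Poly_Mapping.keys y"
  have "lin F (x + y) = (\<Sum>a\<in>?A. if Poly_Mapping.lookup (x + y) a = 1 then F a else 0)"
    by (rule lin_superset) (auto dest: set_mp[OF Poly_Mapping.keys_add])
  also have "\<dots> = (\<Sum>a\<in>?A. (if Poly_Mapping.lookup x a = 1 then F a else 0) +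
      (if Poly_Mapping.lookup y a = 1 then F a else 0))"
    by (rule sum.cong) (auto simp: lookup_add)
  also have "\<dots> = lin F x + lin F y"
    by (simp add: sum.distrib lin_superset[of ?A x] lin_superset[of ?A y])
  finally show ?thesis .
qed

lemma lin_sum: "lin F (\<Sum>a\<in>A. x a) = (\<Sum>a\<in>A. lin F (x a))"
  by (induction A rule: infinite_finite_induct) (auto simp: lin_add)

lemma lin_plus_map: "lin (\<lambda>a. F a + G a) x = lin F x + lin G x"
  by (simp add: lin_def sum.distrib)

lemma lin_lin: "lin F (lin G x) = lin (\<lambda>a. lin F (G a)) x"
  unfolding lin_def[of G] lin_def[of "\<lambda>a. lin F (G a)"] by (rule lin_sum)

lemma lin_basis_id: "lin basis x = x"
proof (rule poly_mapping_eqI)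
  fix a
  have "Poly_Mapping.lookup (lin basis x) a =
      (\<Sum>b\<in>Poly_Mapping.keys x. if b = a then 1 else 0)"
    by (simp add: lin_def lookup_sum lookup_single when_def)
  also have "\<dots> = Poly_Mapping.lookup x a"
    by (simp add: sum.delta in_keys_iff)
  finally show "Poly_Mapping.lookup (lin basis x) a = Poly_Mapping.lookup x a" .
qed

lemma lin_cong: "(\<And>a. a \<in> Poly_Mapping.keys x \<Longrightarrow> F a = G a) \<Longrightarrow> lin F x = lin G x"
  by (simp add: lin_def)

lemma keys_lin: "Poly_Mapping.keys (lin F x) \<subseteq> (\<Union>a\<in>Poly_Mapping.keys x. Poly_Mapping.keys (F a))"
  unfolding lin_def by (rule Poly_Mapping.keys_sum)

text \<open>In characteristic two the two terms of every orbit cancel.\<close>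
lemma sum_involution_zero:
  fixes F :: "'b \<Rightarrow> 'a f2span"
  assumes "finite A" "\<And>a. a \<in> A \<Longrightarrow> \<tau> a \<in> A" "\<And>a. a \<in> A \<Longrightarrow> \<tau> (\<tau> a) = a"
    "\<And>a. a \<in> A \<Longrightarrow> \<tau> a \<noteq> a" "\<And>a. a \<in> A \<Longrightarrow> F (\<tau> a) = F a"
  shows "sum F A = 0"
  using assms
proof (induction A rule: finite_psubset_induct)
  case (psubset A)
  show ?case
  proof (cases "A = {}")
    case False
    then obtain a where a: "a \<in> A" by blast
    let ?B = "A - {a, \<tau> a}"
    have "sum F ?B = 0"
    proof (rule psubset.IH)
      show "?B \<subset> A" using a by blast
      fix b assume b: "b \<in> ?B"
      then show "\<tau> b \<in> ?B" using psubset.prems(1,2) a by (metis DiffD1 DiffD2 DiffI insert_iff empty_iff)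
    qed (use psubset.prems in auto)
    moreover have "sum F A = sum F ?B + sum F {a, \<tau> a}"
      using psubset.hyps psubset.prems(1) a by (intro sum.subset_diff) auto
    moreover have "sum F {a, \<tau> a} = 0"
      using psubset.prems(4)[OF a] psubset.prems(3)[OF a, THEN not_sym] by simp
    ultimately show ?thesis by simp
  qed simp
qed

text \<open>The planar fact behind the commutation of disjoint uncrossings, with \<open>p, q, p', q'\<close> as starts and
  \<open>u, v, u', v'\<close> as labels. The hypotheses say that the first rectangle is clear of the other two
  strands and, after the first exchange, the second one as well; the conclusions say this with the
  order reversed. If one of the conclusions failed, the hypotheses on the second rectangle would push a
  corner of it into the first.\<close>
lemma crossing_exchange:
  fixes p q p' q' u v u' v' :: nat
  assumes "p < q" "p' < q'" "v < u" "v' < u'"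
    and "p \<noteq> p'" "p \<noteq> q'" "q \<noteq> p'" "q \<noteq> q'" "u \<noteq> u'" "u \<noteq> v'" "v \<noteq> u'" "v \<noteq> v'"
    and "\<not> (p < p' \<and> p' < q \<and> v < u' \<and> u' < u)" "\<not> (p < q' \<and> q' < q \<and> v < v' \<and> v' < u)"
    and "\<not> (p' < p \<and> p < q' \<and> v' < v \<and> v < u')" "\<not> (p' < q \<and> q < q' \<and> v' < u \<and> u < u')"
  shows "\<not> (p' < p \<and> p < q' \<and> v' < u \<and> u < u')" "\<not> (p' < q \<and> q < q' \<and> v' < v \<and> v < u')"
    "\<not> (p < p' \<and> p' < q \<and> v < v' \<and> v' < u)" "\<not> (p < q' \<and> q' < q \<and> v < u' \<and> u' < u)"
proof -
  note h = assms(13-16)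
  show "\<not> (p' < p \<and> p < q' \<and> v' < u \<and> u < u')"
  proof (intro notI, elim conjE)
    assume a: "p' < p" "p < q'" "v' < u" "u < u'"
    have "v < v'" using h(3) a assms(3,12) by simp
    moreover have "q' < q" using h(4) a assms(1,8) by simp
    ultimately show False using h(2) a by simp
  qed
  show "\<not> (p' < q \<and> q < q' \<and> v' < v \<and> v < u')"
  proof (intro notI, elim conjE)
    assume a: "p' < q" "q < q'" "v' < v" "v < u'"
    have "u' < u" using h(4) a assms(3,9) by simp
    moreover have "p < p'" using h(3) a assms(1,5) by simp
    ultimately show False using h(1) a by simp
  qed
  show "\<not> (p < p' \<and> p' < q \<and> v < v' \<and> v' < u)"
  proof (intro notI, elim conjE)
    assume a: "p < p'" "p' < q" "v < v'" "v' < u"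
    have "u < u'" using h(1) a assms(4,9) by simp
    moreover from this have "q' < q" using h(4) a assms(8) by simp
    ultimately show False using h(2) a assms(2) by simp
  qed
  show "\<not> (p < q' \<and> q' < q \<and> v < u' \<and> u' < u)"
  proof (intro notI, elim conjE)
    assume a: "p < q'" "q' < q" "v < u'" "u' < u"
    have "v' < v" using h(2) a assms(4,12) by simp
    moreover from this have "p < p'" using h(3) a assms(5) by simp
    ultimately show False using h(1) a assms(2) by simp
  qed
qed

section \<open>Inversions of strand diagrams\<close>

definition cross_at :: "nat \<Rightarrow> nat \<Rightarrow> strands \<Rightarrow> strands" where
  "cross_at s t \<phi> = {(x, y) \<in> \<phi>. (x < s \<and> t < y) \<or> (s < x \<and> y < t)}"

lemma finite_cross_at: "finite \<phi> \<Longrightarrow> finite (cross_at s t \<phi>)"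
  by (rule finite_subset[of _ \<phi>]) (auto simp: cross_at_def)

lemma finite_crossings: "finite \<phi> \<Longrightarrow> finite (crossings \<phi>)"
  by (rule finite_subset[of _ "\<phi> \<times> \<phi>"]) (auto simp: crossings_def)

lemma inv_count_insert:
  assumes fin: "finite \<phi>" and new: "(s, t) \<notin> \<phi>"
  shows "inv_count (insert (s, t) \<phi>) = inv_count \<phi> + card (cross_at s t \<phi>)"
proof -
  define h where "h z = (if fst z < s then (z, (s, t)) else ((s, t), z))" for z :: "nat \<times> nat"
  have eq: "crossings (insert (s, t) \<phi>) = crossings \<phi> \<union> h ` cross_at s t \<phi>"
  proof (rule set_eqI, rule iffI)
    fix z assume "z \<in> crossings (insert (s, t) \<phi>)"
    then obtain a b a' b' where z: "z = ((a, b), (a', b'))" "(a, b) \<in> insert (s, t) \<phi>" "(a', b') \<in> insert (s, t) \<phi>"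
      "a < a'" "b > b'" by (auto simp: crossings_def)
    consider "(a, b) \<in> \<phi>" "(a', b') \<in> \<phi>" | "(a, b) = (s, t)" "(a', b') \<in> \<phi>" | "(a, b) \<in> \<phi>" "(a', b') = (s, t)"
      using z by auto
    then show "z \<in> crossings \<phi> \<union> h ` cross_at s t \<phi>"
    proof cases
      case 1
      then show ?thesis using z by (simp add: crossings_def)
    next
      case 2
      then have "(a', b') \<in> cross_at s t \<phi>" "z = h (a', b')" using z by (auto simp: cross_at_def h_def)
      then show ?thesis by blast
    next
      case 3
      then have "(a, b) \<in> cross_at s t \<phi>" "z = h (a, b)" using z by (auto simp: cross_at_def h_def)
      then show ?thesis by blast
    qed
  next
    fix z assume "z \<in> crossings \<phi> \<union> h ` cross_at s t \<phi>"
    then show "z \<in> crossings (insert (s, t) \<phi>)"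
      by (auto simp: crossings_def cross_at_def h_def)
  qed
  have "inj_on h (cross_at s t \<phi>)"
    using new by (auto simp: inj_on_def h_def cross_at_def split: if_splits)
  moreover have "crossings \<phi> \<inter> h ` cross_at s t \<phi> = {}"
    using new by (auto simp: crossings_def h_def split: if_splits)
  ultimately show ?thesis
    unfolding inv_count_def eq using finite_crossings[OF fin] finite_cross_at[OF fin]
    by (simp add: card_Un_disjoint card_image)
qed

lemma card_filter_sum: "finite A \<Longrightarrow> card {z \<in> A. P z} = (\<Sum>z\<in>A. of_bool (P z))"
  by (simp add: sum.If_cases of_bool_def Int_def)

text \<open>A strand that starts and ends strictly between the two crosses both of them before the exchange and
  neither afterwards; every other strand keeps its number of crossings with the two. So the inversion
  number drops by exactly one iff no strand lies between, and the counting condition in the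
  differential becomes a condition on the diagram.\<close>
lemma inv_count_swap:
  assumes fin: "finite \<phi>" and c: "s < s'" "t' < t"
    and new: "\<And>x y. (x, y) \<in> \<phi> \<Longrightarrow> x \<noteq> s \<and> x \<noteq> s' \<and> y \<noteq> t \<and> y \<noteq> t'"
  shows "inv_count (insert (s, t) (insert (s', t') \<phi>)) =
    inv_count (insert (s, t') (insert (s', t) \<phi>)) + 1 +
    2 * card {(x, y) \<in> \<phi>. s < x \<and> x < s' \<and> t' < y \<and> y < t}"
proof -
  have i: "inv_count (insert (s, u) (insert (s', u') \<phi>)) =
      inv_count \<phi> + card (cross_at s u \<phi>) + card (cross_at s' u' \<phi>) + (if u' < u then 1 else 0)"
    if "u \<noteq> u'" "u \<in> {t, t'}" "u' \<in> {t, t'}" for u u'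
  proof -
    have n: "(s', u') \<notin> \<phi>" "(s, u) \<notin> insert (s', u') \<phi>" using new c that by auto
    have "cross_at s u (insert (s', u') \<phi>) = (if u' < u then insert (s', u') (cross_at s u \<phi>) else cross_at s u \<phi>)"
      using c by (auto simp: cross_at_def)
    moreover have "(s', u') \<notin> cross_at s u \<phi>" using n by (simp add: cross_at_def)
    ultimately show ?thesis
      using inv_count_insert[OF _ n(2)] inv_count_insert[OF fin n(1)] fin finite_cross_at[OF fin] by simp
  qed
  have "card (cross_at s t \<phi>) + card (cross_at s' t' \<phi>) = card (cross_at s t' \<phi>) + card (cross_at s' t \<phi>) +
      2 * card {(x, y) \<in> \<phi>. s < x \<and> x < s' \<and> t' < y \<and> y < t}"
  proof -
    have f: "card {z \<in> \<phi>. case z of (x, y) \<Rightarrow> P x y} = (\<Sum>(x, y)\<in>\<phi>. of_bool (P x y))" for P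
      using card_filter_sum[OF fin, of "\<lambda>z. case z of (x, y) \<Rightarrow> P x y"] by (simp add: case_prod_beta)
    have p: "{(x, y) \<in> \<phi>. P x y} = {z \<in> \<phi>. case z of (x, y) \<Rightarrow> P x y}" for P by auto
    show ?thesis
      unfolding cross_at_def p f sum_distrib_left sum.distrib[symmetric]
    proof (rule sum.cong[OF refl])
      fix z assume z: "z \<in> \<phi>"
      obtain x y where xy: "z = (x, y)" by (cases z)
      have "x \<noteq> s" "x \<noteq> s'" "y \<noteq> t" "y \<noteq> t'" using new z xy by auto
      then consider "x < s" | "s < x" "x < s'" | "s' < x" by linarith
      then show "(case z of (x, y) \<Rightarrow> (of_bool (x < s \<and> t < y \<or> s < x \<and> y < t) :: nat)) +
          (case z of (x, y) \<Rightarrow> of_bool (x < s' \<and> t' < y \<or> s' < x \<and> y < t')) =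
          (case z of (x, y) \<Rightarrow> of_bool (x < s \<and> t' < y \<or> s < x \<and> y < t')) +
          (case z of (x, y) \<Rightarrow> of_bool (x < s' \<and> t < y \<or> s' < x \<and> y < t)) +
          2 * (case z of (x, y) \<Rightarrow> of_bool (s < x \<and> x < s' \<and> t' < y \<and> y < t))"
        using c \<open>y \<noteq> t\<close> \<open>y \<noteq> t'\<close> unfolding xy by cases (auto simp: of_bool_def)
    qed
  qed
  then show ?thesis using i[of t t'] i[of t' t] c by simp
qed

text \<open>When the start of the strand ending at \<open>r\<close> moves down from \<open>q\<close> to \<open>p\<close>, it passes the starts in between.
  A strand ending below \<open>r\<close> gains a crossing with it, one ending above \<open>r\<close> loses one. The latter are the
  double crossings that make a product with a chord zero.\<close>
lemma inv_count_lower_start: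
  assumes fin: "finite \<phi>" and c: "p < q"
    and new: "\<And>x y. (x, y) \<in> \<phi> \<Longrightarrow> x \<noteq> p \<and> x \<noteq> q \<and> y \<noteq> r"
  shows "inv_count (insert (p, r) \<phi>) + 2 * card {(x, y) \<in> \<phi>. p < x \<and> x < q \<and> r < y} =
    inv_count (insert (q, r) \<phi>) + card {(x, y) \<in> \<phi>. p < x \<and> x < q}"
proof -
  have n: "(p, r) \<notin> \<phi>" "(q, r) \<notin> \<phi>" using new by auto
  have f: "card {z \<in> \<phi>. case z of (x, y) \<Rightarrow> P x y} = (\<Sum>(x, y)\<in>\<phi>. of_bool (P x y))" for P
    using card_filter_sum[OF fin, of "\<lambda>z. case z of (x, y) \<Rightarrow> P x y"] by (simp add: case_prod_beta)
  have p: "{(x, y) \<in> \<phi>. P x y} = {z \<in> \<phi>. case z of (x, y) \<Rightarrow> P x y}" for P by auto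
  have "card (cross_at p r \<phi>) + 2 * card {(x, y) \<in> \<phi>. p < x \<and> x < q \<and> r < y} =
      card (cross_at q r \<phi>) + card {(x, y) \<in> \<phi>. p < x \<and> x < q}"
    unfolding cross_at_def p f sum_distrib_left sum.distrib[symmetric]
  proof (rule sum.cong[OF refl])
    fix z assume z: "z \<in> \<phi>"
    obtain x y where xy: "z = (x, y)" by (cases z)
    have "x \<noteq> p" "x \<noteq> q" "y \<noteq> r" using new z xy by auto
    then consider "x < p" | "p < x" "x < q" | "q < x" by linarith
    then show "(case z of (x, y) \<Rightarrow> (of_bool (x < p \<and> r < y \<or> p < x \<and> y < r) :: nat)) +
        2 * (case z of (x, y) \<Rightarrow> of_bool (p < x \<and> x < q \<and> r < y)) =
        (case z of (x, y) \<Rightarrow> of_bool (x < q \<and> r < y \<or> q < x \<and> y < r)) +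
        (case z of (x, y) \<Rightarrow> of_bool (p < x \<and> x < q))"
      using c \<open>y \<noteq> r\<close> unfolding xy by cases (auto simp: of_bool_def)
  qed
  then show ?thesis using inv_count_insert[OF fin n(1)] inv_count_insert[OF fin n(2)] by simp
qed

lemma inv_count_chord_Id:
  assumes "finite C" "p < q" "q \<notin> C"
  shows "inv_count (insert (p, q) (Id_on C)) = card {c \<in> C. p < c \<and> c < q}"
proof -
  have "crossings (Id_on C) = {}" by (auto simp: crossings_def)
  then have z: "inv_count (Id_on C) = 0" by (simp add: inv_count_def)
  have "cross_at p q (Id_on C) = (\<lambda>c. (c, c)) ` {c \<in> C. p < c \<and> c < q}"
    using assms(2) by (auto simp: cross_at_def)
  then have "card (cross_at p q (Id_on C)) = card {c \<in> C. p < c \<and> c < q}"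
    by (simp add: card_image inj_on_def)
  moreover have "finite (Id_on C)" "(p, q) \<notin> Id_on C" using assms by (auto simp: Id_on_def)
  ultimately show ?thesis using inv_count_insert[of "Id_on C" p q] z by simp
qed

context pmc
begin

section \<open>States: strand diagrams with ordered labels\<close>

text \<open>The end point that a label stands for: a label up to \<open>4k\<close> is a right end point, and
  \<open>8k+1-t\<close> is the left end point \<open>t\<close>.\<close>
definition height :: "nat \<Rightarrow> nat" where
  "height u = (if u \<le> 4 * k then u else 8 * k + 1 - u)"

text \<open>The label of the matched end point on the same side.\<close>
definition mate_label :: "nat \<Rightarrow> nat" where
  "mate_label u = (if u \<le> 4 * k then mate u else 8 * k + 1 - mate (8 * k + 1 - u))"

text \<open>The value at \<open>s\<close> is the label of the strand starting at \<open>s\<close>, and 0 if there is none. A double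
  horizontal is recorded by constant strands at both of its points. In this order, the conditions are:
  strands do not go down; each label is used once; matched points are both starts iff they carry a
  double horizontal; each pair occurs, because the left idempotents are complementary; on each side,
  two strands end in the same pair only if they form a double horizontal.\<close>
definition state :: "(nat \<Rightarrow> nat) \<Rightarrow> bool" where
  "state \<phi> \<longleftrightarrow>
     (\<forall>s. \<phi> s \<noteq> 0 \<longrightarrow> 1 \<le> s \<and> s \<le> height (\<phi> s) \<and> \<phi> s \<le> 8 * k) \<and>
     (\<forall>s s'. \<phi> s \<noteq> 0 \<longrightarrow> \<phi> s = \<phi> s' \<longrightarrow> s = s') \<and>
     (\<forall>s. \<phi> s \<noteq> 0 \<longrightarrow> \<phi> (mate s) = (if height (\<phi> s) = s then mate_label (\<phi> s) else 0)) \<and>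
     (\<forall>s\<in>points. \<phi> s \<noteq> 0 \<or> \<phi> (mate s) \<noteq> 0) \<and>
     (\<forall>s s'. \<phi> s \<noteq> 0 \<longrightarrow> \<phi> s' = mate_label (\<phi> s) \<longrightarrow> s = height (\<phi> s))"

text \<open>The labels at \<open>p < q\<close> are exchanged. If the strand at \<open>q\<close> was or becomes constant, the constant strand
  at the matched point has to go or to come with it.\<close>
definition switch :: "(nat \<Rightarrow> nat) \<Rightarrow> nat \<Rightarrow> nat \<Rightarrow> nat \<Rightarrow> nat" where
  "switch \<phi> p q = \<phi>(p := \<phi> q, q := \<phi> p,
     mate q := (if height (\<phi> p) = q then mate_label (\<phi> p) else 0))"

text \<open>An uncrossing on the right, the reverse of an uncrossing on the left (whose labels run downwards), and
  the passage of a chord from the left to the right are all of this form. That the strand from \<open>p\<close> to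
  the label of \<open>q\<close> goes up is automatic; the strand from \<open>q\<close> has to be asked to.\<close>
definition edges :: "(nat \<Rightarrow> nat) \<Rightarrow> (nat \<times> nat) set" where
  "edges \<phi> = {(p, q). p < q \<and> \<phi> q \<noteq> 0 \<and> \<phi> q < \<phi> p \<and> q \<le> height (\<phi> p) \<and>
     (\<forall>s. p < s \<longrightarrow> s < q \<longrightarrow> \<not> (\<phi> q < \<phi> s \<and> \<phi> s < \<phi> p))}"

lemma height_le: "height u \<le> 4 * k"
  by (auto simp: height_def)

lemma height_0 [simp]: "height 0 = 0"
  by (simp add: height_def)

lemma mate_pt: "1 \<le> s \<Longrightarrow> s \<le> 4 * k \<Longrightarrow> 1 \<le> mate s \<and> mate s \<le> 4 * k \<and> mate s \<noteq> s \<and> mate (mate s) = s"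
  using mate_range[of s] mate_neq[of s] mate_mate[of s] by auto

lemma mate_label_range:
  assumes "u \<noteq> 0" "u \<le> 8 * k"
  shows "mate_label u \<noteq> 0" "mate_label u \<le> 8 * k" "mate_label u \<noteq> u"
    "mate_label (mate_label u) = u" "height (mate_label u) = mate (height u)"
    "mate_label u \<le> 4 * k \<longleftrightarrow> u \<le> 4 * k"
proof -
  have u: "(u \<le> 4 * k \<and> 1 \<le> mate u \<and> mate u \<le> 4 * k \<and> mate u \<noteq> u \<and> mate (mate u) = u) \<or>
      (\<not> u \<le> 4 * k \<and> (\<exists>t. u = 8 * k + 1 - t \<and> 1 \<le> t \<and> t \<le> 4 * k \<and> 8 * k + 1 - u = t \<and>
         1 \<le> mate t \<and> mate t \<le> 4 * k \<and> mate t \<noteq> t \<and> mate (mate t) = t \<and>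
         8 * k + 1 - (8 * k + 1 - mate t) = mate t \<and> \<not> 8 * k + 1 - mate t \<le> 4 * k))"
  proof (cases "u \<le> 4 * k")
    case True
    then show ?thesis using assms mate_pt[of u] by simp
  next
    case False
    then have "8 * k + 1 - u \<ge> 1" "8 * k + 1 - u \<le> 4 * k" "u = 8 * k + 1 - (8 * k + 1 - u)" using assms by auto
    moreover from this have "8 * k + 1 - (8 * k + 1 - mate (8 * k + 1 - u)) = mate (8 * k + 1 - u)"
      "\<not> 8 * k + 1 - mate (8 * k + 1 - u) \<le> 4 * k"
      using mate_pt[of "8 * k + 1 - u"] by linarith+
    ultimately show ?thesis using False mate_pt[of "8 * k + 1 - u"] by blast
  qed
  show "mate_label u \<noteq> 0" "mate_label u \<le> 8 * k" "mate_label u \<noteq> u"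
    "mate_label (mate_label u) = u" "height (mate_label u) = mate (height u)"
    "mate_label u \<le> 4 * k \<longleftrightarrow> u \<le> 4 * k"
    using u unfolding mate_label_def height_def by (elim disjE exE conjE; simp; linarith?)+
qed

context
  fixes \<phi> assumes st: "state \<phi>"
begin

lemma state_bounds: "\<phi> s \<noteq> 0 \<Longrightarrow> 1 \<le> s \<and> s \<le> 4 * k \<and> s \<le> height (\<phi> s) \<and> \<phi> s \<le> 8 * k"
  using st height_le[of "\<phi> s"] unfolding state_def by (meson order_trans)

lemma state_inj: "\<phi> s \<noteq> 0 \<Longrightarrow> \<phi> s = \<phi> s' \<Longrightarrow> s = s'"
  using st unfolding state_def by blast

lemma state_mate: "\<phi> s \<noteq> 0 \<Longrightarrow> \<phi> (mate s) = (if height (\<phi> s) = s then mate_label (\<phi> s) else 0)"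
  using st unfolding state_def by blast

lemma state_start: "1 \<le> s \<Longrightarrow> s \<le> 4 * k \<Longrightarrow> \<phi> s \<noteq> 0 \<or> \<phi> (mate s) \<noteq> 0"
  using st unfolding state_def points_def by auto

lemma state_end: "\<phi> s \<noteq> 0 \<Longrightarrow> \<phi> s' = mate_label (\<phi> s) \<Longrightarrow> s = height (\<phi> s)"
  using st unfolding state_def by blast

lemma state_mate_pt: "\<phi> s \<noteq> 0 \<Longrightarrow> 1 \<le> mate s \<and> mate s \<le> 4 * k \<and> mate s \<noteq> s \<and> mate (mate s) = s"
  using state_bounds[of s] mate_pt[of s] by auto

lemma state_label: "\<phi> s \<noteq> 0 \<Longrightarrow> mate_label (\<phi> s) \<noteq> 0 \<and> mate_label (\<phi> s) \<le> 8 * k \<and> mate_label (\<phi> s) \<noteq> \<phi> s \<and>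
    mate_label (mate_label (\<phi> s)) = \<phi> s \<and> height (mate_label (\<phi> s)) = mate (height (\<phi> s))"
  using state_bounds[of s] mate_label_range[of "\<phi> s"] by auto

lemma state_moving_mate: "\<phi> p \<noteq> 0 \<Longrightarrow> p < height (\<phi> p) \<Longrightarrow> \<phi> q \<noteq> 0 \<Longrightarrow> p \<noteq> mate q"
  using state_mate[of p] state_mate_pt[of q] by auto

text \<open>The two labels play symmetric roles, so the same operation reverses a step; the main term of the
  homotopy is such a reversal.\<close>
lemma switch_switch:
  assumes "\<phi> q \<noteq> 0" "\<phi> p \<noteq> 0" "p < q" "q \<le> height (\<phi> p)"
  shows "switch (switch \<phi> p q) p q = \<phi>"
  using state_mate[of q] state_moving_mate[of p q] state_mate_pt[of q] assms by (auto simp: switch_def fun_eq_iff)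

text \<open>The order of the two labels is left open, to cover steps as well as their reversals.\<close>
lemma state_switch:
  assumes q: "\<phi> q \<noteq> 0" and p: "\<phi> p \<noteq> 0" and pq: "p < q" and qh: "q \<le> height (\<phi> p)"
  shows "state (switch \<phi> p q)"
proof -
  define \<psi> where "\<psi> = switch \<phi> p q"
  have bp: "1 \<le> p" "p \<le> 4 * k" "\<phi> p \<le> 8 * k" and bq: "1 \<le> q" "q \<le> 4 * k" "q \<le> height (\<phi> q)" "\<phi> q \<le> 8 * k"
    using state_bounds[OF p] state_bounds[OF q] by auto
  have mq: "1 \<le> mate q" "mate q \<le> 4 * k" "mate q \<noteq> q" "mate (mate q) = q"
    using state_mate_pt[OF q] by auto
  have pm: "p \<noteq> mate q" using state_moving_mate[OF p _ q] pq qh by auto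
  have mp: "mate p \<noteq> p" "mate (mate p) = p" "mate p \<noteq> q" using state_mate_pt[OF p] pm by auto
  have v: "\<psi> p = \<phi> q" "\<psi> q = \<phi> p" "\<psi> (mate q) = (if height (\<phi> p) = q then mate_label (\<phi> p) else 0)"
    "\<And>s. s \<noteq> p \<Longrightarrow> s \<noteq> q \<Longrightarrow> s \<noteq> mate q \<Longrightarrow> \<psi> s = \<phi> s"
    using pm mq pq by (auto simp: \<psi>_def switch_def)
  have mqv: "\<phi> (mate q) = (if height (\<phi> q) = q then mate_label (\<phi> q) else 0)" by (rule state_mate[OF q])
  have lp: "mate_label (\<phi> p) \<noteq> 0" "mate_label (\<phi> p) \<le> 8 * k" "mate_label (\<phi> p) \<noteq> \<phi> p"
    "mate_label (mate_label (\<phi> p)) = \<phi> p" "height (mate_label (\<phi> p)) = mate (height (\<phi> p))"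
    using state_label[OF p] by auto
  have np: "\<phi> s \<noteq> mate_label (\<phi> p)" for s
    using state_end[OF p, of s] pq qh by auto
  define \<sigma> where "\<sigma> s = (if s = p then q else if s = q then p else s)" for s
  have \<sigma>: "\<sigma> (\<sigma> s) = s" for s
    using pq by (simp add: \<sigma>_def)
  have vs: "\<psi> s = \<phi> (\<sigma> s)" if "s \<noteq> mate q" for s
    using that v(1,2) v(4)[of s] by (auto simp: \<sigma>_def)
  have F1: "1 \<le> s \<and> s \<le> height (\<psi> s) \<and> \<psi> s \<le> 8 * k" if s: "\<psi> s \<noteq> 0" for s
  proof -
    consider "s = p" | "s = q" | "s = mate q" | "s \<noteq> p" "s \<noteq> q" "s \<noteq> mate q" by blast
    then show ?thesis
    proof cases
      case 3
      then show ?thesis using v(3) s lp(2,5) mq(1) by (simp split: if_splits)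
    next
      case 4
      then show ?thesis using v(4)[OF 4] s state_bounds[of s] by simp
    qed (use v(1,2) bp bq pq qh in auto)
  qed
  have F2: "s = s'" if "\<psi> s \<noteq> 0" "\<psi> s = \<psi> s'" for s s'
  proof (cases "s = mate q \<or> s' = mate q")
    case True
    then have "\<psi> s = mate_label (\<phi> p)" "\<psi> s' = mate_label (\<phi> p)"
      using that v(3) by (auto split: if_splits)
    then show ?thesis using np vs True by metis
  next
    case False
    then have "\<sigma> s = \<sigma> s'" using that vs state_inj by metis
    then show ?thesis using \<sigma> by metis
  qed
  have F3: "\<psi> (mate s) = (if height (\<psi> s) = s then mate_label (\<psi> s) else 0)" if "\<psi> s \<noteq> 0" for s
  proof -
    consider "s = p" | "s = q" | "s = mate q" | "s \<noteq> p" "s \<noteq> q" "s \<noteq> mate q" by blast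
    then show ?thesis
    proof cases
      case 1
      have "\<phi> (mate p) = 0" using state_mate[OF p] pq qh by auto
      moreover have "mate p \<noteq> mate q" using mp(2) mq(4) pq by (metis nat_neq_iff)
      ultimately show ?thesis using 1 v mp pq bq by auto
    next
      case 2
      then show ?thesis using v by simp
    next
      case 3
      then show ?thesis using v that lp mq by (auto split: if_splits)
    next
      case 4
      then have s: "\<phi> s \<noteq> 0" using v that by simp
      have sm: "mate (mate s) = s" using state_mate_pt[OF s] by simp
      have "mate s \<noteq> q" using sm 4 by auto
      moreover have "mate s \<noteq> p" using state_moving_mate[OF p _ s] pq qh by auto
      moreover have "mate s \<noteq> mate q" using sm mq(4) 4(2) by metis
      ultimately have "\<psi> (mate s) = \<phi> (mate s)" using v(4) by blast
      then show ?thesis using 4 v state_mate[OF s] by simp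
    qed
  qed
  have F4: "\<psi> s \<noteq> 0 \<or> \<psi> (mate s) \<noteq> 0" if s: "s \<in> points" for s
  proof (rule ccontr)
    assume c: "\<not> ?thesis"
    have sm: "mate (mate s) = s" using s mate_pt[of s] by (auto simp: points_def)
    have "s \<noteq> p" "s \<noteq> q" "mate s \<noteq> p" "mate s \<noteq> q" using c v(1,2) p q by auto
    moreover from this have "s \<noteq> mate q" "mate s \<noteq> mate q" using sm mq(4) by auto
    ultimately have "\<phi> s = 0" "\<phi> (mate s) = 0" using c v(4) by auto
    then show False using s state_start[of s] by (auto simp: points_def)
  qed
  have F7: "s = height (\<psi> s)" if "\<psi> s \<noteq> 0" "\<psi> s' = mate_label (\<psi> s)" for s s'
  proof (cases "s = mate q")
    case True
    then show ?thesis using that(1) v(3) lp(5) by (auto split: if_splits)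
  next
    case False
    then have s: "\<psi> s = \<phi> (\<sigma> s)" "\<phi> (\<sigma> s) \<noteq> 0" using vs that by auto
    show ?thesis
    proof (cases "s' = mate q")
      case True
      then have "mate_label (\<phi> (\<sigma> s)) = mate_label (\<phi> p)" "height (\<phi> p) = q"
        using s that(2) v(3) state_label[OF s(2)] by (auto split: if_splits)
      then have "\<phi> (\<sigma> s) = \<phi> p" using state_label[OF s(2)] lp by metis
      then have "\<sigma> s = p" by (rule state_inj[OF s(2)])
      then have "s = q" using \<sigma>[of s] by (auto simp: \<sigma>_def)
      then show ?thesis using \<open>height (\<phi> p) = q\<close> v by simp
    next
      case s': False
      then have e: "\<phi> (\<sigma> s') = mate_label (\<phi> (\<sigma> s))" using s that vs by auto
      then have h: "\<sigma> s = height (\<phi> (\<sigma> s))" using state_end s(2) by blast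
      then have "\<sigma> s \<noteq> p" using pq qh by auto
      show ?thesis
      proof (cases "\<sigma> s = q")
        case True
        have "\<phi> (mate q) = \<phi> (\<sigma> s')" using mqv h e True by simp
        then have "\<sigma> s' = mate q" using state_inj e state_label[OF s(2)] by metis
        then show ?thesis using s' pm mq by (auto simp: \<sigma>_def split: if_splits)
      next
        case False
        then have "\<sigma> s = s" using \<open>\<sigma> s \<noteq> p\<close> by (auto simp: \<sigma>_def split: if_splits)
        then show ?thesis using h s by simp
      qed
    qed
  qed
  show ?thesis unfolding \<psi>_def[symmetric] state_def using F1 F2 F3 F4 F7 by blast
qed

end

section \<open>Steps, and pairs of steps that share a strand\<close>

definition boundary :: "(nat \<Rightarrow> nat) \<Rightarrow> (nat \<Rightarrow> nat) f2span" where
  "boundary \<phi> = (\<Sum>(p, q)\<in>edges \<phi>. basis (switch \<phi> p q))"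

text \<open>Heights rise along the right labels and fall along the left ones. Therefore a start that fits below
  two labels fits below all labels between them, and the intermediate state of the second
  factorization of a path exists.\<close>
lemma height_quasiconcave: "x < y \<Longrightarrow> y < z \<Longrightarrow> c \<le> height x \<Longrightarrow> c \<le> height z \<Longrightarrow> c \<le> height y"
  by (auto simp: height_def split: if_splits)

text \<open>Constant strands do not obstruct steps. Hence it is harmless that a double horizontal is drawn at
  both of its points.\<close>
lemma constant_not_between:
  assumes "l < m" "m < r" "r \<le> height (\<chi> l)" "height (\<chi> m) = m" "r \<le> height (\<chi> r)"
    "\<chi> r < \<chi> m" "\<chi> m < \<chi> l"
  shows False
  using assms by (auto simp: height_def split: if_splits)

lemma edge_iff:
  assumes st: "state \<chi>" and Z: "\<And>s. s \<in> Z \<Longrightarrow> height (\<chi> s) = s \<or> \<chi> s = 0"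
  shows "(l, r) \<in> edges \<chi> \<longleftrightarrow> l < r \<and> \<chi> r \<noteq> 0 \<and> \<chi> r < \<chi> l \<and> r \<le> height (\<chi> l) \<and>
     (\<forall>s. s \<notin> Z \<longrightarrow> l < s \<longrightarrow> s < r \<longrightarrow> \<not> (\<chi> r < \<chi> s \<and> \<chi> s < \<chi> l))" (is "_ \<longleftrightarrow> ?R")
proof
  assume ?R
  moreover have "\<not> (\<chi> r < \<chi> s \<and> \<chi> s < \<chi> l)" if "l < s" "s < r" "s \<in> Z" for s
    using Z[OF that(3)] constant_not_between[OF that(1,2), of \<chi>] \<open>?R\<close> state_bounds[OF st, of r] by auto
  ultimately show "(l, r) \<in> edges \<chi>" unfolding edges_def by blast
qed (auto simp: edges_def)

lemma edgeD:
  assumes "(p, q) \<in> edges \<phi>"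
  shows "p < q" "\<phi> q \<noteq> 0" "\<phi> p \<noteq> 0" "\<phi> q < \<phi> p" "q \<le> height (\<phi> p)"
    "\<And>s. p < s \<Longrightarrow> s < q \<Longrightarrow> \<not> (\<phi> q < \<phi> s \<and> \<phi> s < \<phi> p)"
  using assms by (auto simp: edges_def)

lemma state_edge: "state \<phi> \<Longrightarrow> (p, q) \<in> edges \<phi> \<Longrightarrow> state (switch \<phi> p q)"
  by (intro state_switch) (auto dest: edgeD)

lemma edges_bounded: "state \<phi> \<Longrightarrow> edges \<phi> \<subseteq> {1..4 * k} \<times> {1..4 * k}"
  using state_bounds edgeD(2,3) by fastforce

lemma finite_edges: "state \<phi> \<Longrightarrow> finite (edges \<phi>)"
  by (rule finite_subset[OF edges_bounded]) auto

text \<open>Only right double horizontals are opened by a step. A left one has the wrong position in the order of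
  the labels: every label above it has a smaller height.\<close>
lemma edge_constant_end:
  assumes "state \<phi>" "(p, q) \<in> edges \<phi>" "height (\<phi> q) = q"
  shows "\<phi> q = q"
proof (rule ccontr)
  assume "\<phi> q \<noteq> q"
  then have "4 * k < \<phi> q" using assms(3) by (auto simp: height_def split: if_splits)
  then show False using assms edgeD[OF assms(2)] state_bounds[OF assms(1), of p] by (auto simp: height_def split: if_splits)
qed

text \<open>After a step at \<open>q\<close> the matched point is out of play: either no strand starts there, or the step has
  just closed the left double horizontal at \<open>q\<close>, which is inert by \<open>edge_constant_end\<close>.\<close>
lemma path_avoids_mate:
  assumes st: "state \<phi>" and e1: "(p, q) \<in> edges \<phi>" and e2: "(p', q') \<in> edges (switch \<phi> p q)"
  shows "p' \<noteq> mate q" "q' \<noteq> mate q"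
proof -
  note E = edgeD[OF e1] and E' = edgeD[OF e2]
  have st': "state (switch \<phi> p q)" by (rule state_edge[OF st e1])
  have m: "switch \<phi> p q (mate q) = (if height (\<phi> p) = q then mate_label (\<phi> p) else 0)" by (simp add: switch_def)
  show "p' \<noteq> mate q"
    using E'(1,3,5) m state_label[OF st E(3)] by (auto split: if_splits)
  show "q' \<noteq> mate q"
  proof
    assume q': "q' = mate q"
    then have h: "height (\<phi> p) = q" and l: "switch \<phi> p q q' = mate_label (\<phi> p)"
      using m E'(2) by (auto split: if_splits)
    have "mate_label (\<phi> p) = mate q"
      using edge_constant_end[OF st' e2] l state_label[OF st E(3)] h q' by auto
    then have "mate_label (\<phi> p) \<le> 4 * k" using state_mate_pt[OF st E(2)] by simp
    then have "\<phi> p \<le> 4 * k" using mate_label_range(6) state_bounds[OF st E(3)] E(3) by blast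
    then have "\<phi> p = q" using h by (simp add: height_def)
    then show False using E(4) state_bounds[OF st E(2)] \<open>\<phi> p \<le> 4 * k\<close> by (auto simp: height_def)
  qed
qed

text \<open>The values at the mates of starts are determined by the values at the starts, so they can be ignored
  in comparing two states.\<close>
lemma state_eqI:
  assumes st: "state \<phi>" "state \<psi>" and eq: "\<And>s. s \<notin> mate ` A \<Longrightarrow> \<phi> s = \<psi> s"
    and A: "\<And>s. s \<in> A \<Longrightarrow> \<phi> s \<noteq> 0 \<and> s \<notin> mate ` A"
  shows "\<phi> = \<psi>"
proof
  fix s
  show "\<phi> s = \<psi> s"
  proof (cases "s \<in> mate ` A")
    case True
    then obtain t where t: "t \<in> A" "s = mate t" by blast
    then have "\<phi> t \<noteq> 0" "\<phi> t = \<psi> t" using A[OF t(1)] eq[of t] by simp_all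
    then show ?thesis using state_mate[OF st(1), of t] state_mate[OF st(2), of t] t by simp
  qed (use eq in blast)
qed

lemma state_mate_constant:
  assumes "state \<phi>" "\<phi> s \<noteq> 0"
  shows "height (\<phi> (mate s)) = mate s \<or> \<phi> (mate s) = 0"
  using state_mate[OF assms] state_label[OF assms] by auto

definition path :: "(nat \<Rightarrow> nat) \<Rightarrow> nat \<times> nat \<Rightarrow> nat \<times> nat \<Rightarrow> bool" where
  "path \<phi> e e' \<longleftrightarrow> e \<in> edges \<phi> \<and> e' \<in> edges (switch \<phi> (fst e) (snd e))"

definition path_end :: "(nat \<Rightarrow> nat) \<Rightarrow> nat \<times> nat \<Rightarrow> nat \<times> nat \<Rightarrow> nat \<Rightarrow> nat" where
  "path_end \<phi> e e' = switch (switch \<phi> (fst e) (snd e)) (fst e') (snd e')"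

context
  fixes \<phi> a b c
  assumes st: "state \<phi>" and abc: "a < b" "b < c" and nz: "\<phi> a \<noteq> 0" "\<phi> b \<noteq> 0" "\<phi> c \<noteq> 0"
    and nm: "a \<noteq> mate b" "a \<noteq> mate c" "b \<noteq> mate c"
begin

text \<open>The states met along a path of two steps that share a strand. They differ from \<open>\<phi>\<close> only in the
  labels at \<open>a, b, c\<close> and, as a consequence, at the matched points.\<close>
definition tri :: "(nat \<Rightarrow> nat) \<Rightarrow> bool" where
  "tri \<chi> \<longleftrightarrow> state \<chi> \<and> \<chi> a \<noteq> 0 \<and> \<chi> b \<noteq> 0 \<and> \<chi> c \<noteq> 0 \<and>
     (\<forall>s. s \<notin> {a, b, c, mate a, mate b, mate c} \<longrightarrow> \<chi> s = \<phi> s)"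

definition clear :: "nat \<Rightarrow> nat \<Rightarrow> nat \<Rightarrow> nat \<Rightarrow> bool" where
  "clear l r x y \<longleftrightarrow> (\<forall>s. s \<notin> {a, b, c, mate a, mate b, mate c} \<longrightarrow> l < s \<longrightarrow> s < r \<longrightarrow>
      \<not> (x < \<phi> s \<and> \<phi> s < y))"

lemma tri_self: "tri \<phi>"
  using st nz by (simp add: tri_def)

lemma mates: "mate a \<notin> {a, b, c}" "mate b \<notin> {a, b, c}" "mate c \<notin> {a, b, c}"
  "mate (mate a) = a" "mate (mate b) = b" "mate (mate c) = c"
  using nm state_mate_pt[OF st nz(1)] state_mate_pt[OF st nz(2)] state_mate_pt[OF st nz(3)] by auto

lemma mates_outside: "x \<in> {a, b, c} \<Longrightarrow> mate x \<notin> {a, b, c}"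
  using mates(1-3) by (elim insertE emptyE) (simp_all only: not_False_eq_True)

lemma tri_switch:
  assumes t: "tri \<chi>" and lr: "l \<in> {a, b, c}" "r \<in> {a, b, c}" "l < r" "r \<le> height (\<chi> l)"
  shows "tri (switch \<chi> l r)" "switch \<chi> l r l = \<chi> r" "switch \<chi> l r r = \<chi> l"
    "s \<in> {a, b, c} \<Longrightarrow> s \<noteq> l \<Longrightarrow> s \<noteq> r \<Longrightarrow> switch \<chi> l r s = \<chi> s"
proof -
  have z: "\<chi> l \<noteq> 0" "\<chi> r \<noteq> 0" "state \<chi>" using t lr by (auto simp: tri_def)
  have lm: "mate r \<notin> {a, b, c}" by (rule mates_outside[OF lr(2)])
  then have lm': "s \<noteq> mate r" if "s \<in> {a, b, c}" for s using that by metis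
  show v: "switch \<chi> l r l = \<chi> r" "switch \<chi> l r r = \<chi> l"
    using lm'[OF lr(1)] lm'[OF lr(2)] lr(3) by (simp_all add: switch_def)
  show v3: "switch \<chi> l r s = \<chi> s" if "s \<in> {a, b, c}" "s \<noteq> l" "s \<noteq> r" for s
    using lm'[OF that(1)] that(2,3) by (simp add: switch_def)
  have "switch \<chi> l r s = \<phi> s" if "s \<notin> {a, b, c, mate a, mate b, mate c}" for s
  proof -
    have "s \<notin> {a, b, c}" "s \<notin> {mate a, mate b, mate c}" using that by blast+
    then have "s \<noteq> l" "s \<noteq> r" "s \<noteq> mate r" using lr(1,2) by (blast, blast, elim insertE emptyE, simp_all)
    then have "switch \<chi> l r s = \<chi> s" by (simp add: switch_def)
    then show ?thesis using that t by (simp add: tri_def)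
  qed
  moreover have "switch \<chi> l r s \<noteq> 0" if "s \<in> {a, b, c}" for s
  proof -
    have "\<chi> s \<noteq> 0" using that t by (auto simp: tri_def)
    then show ?thesis using v(1,2) v3[OF that] z(1,2) by (cases "s = l"; cases "s = r") simp_all
  qed
  ultimately show "tri (switch \<chi> l r)"
    using state_switch[OF z(3,2,1) lr(3,4)] by (simp add: tri_def)
qed

lemma tri_edge:
  assumes t: "tri \<chi>" and lr: "l \<in> {a, b, c}" "r \<in> {a, b, c}" "l < r"
  shows "(l, r) \<in> edges \<chi> \<longleftrightarrow> \<chi> r < \<chi> l \<and> r \<le> height (\<chi> l) \<and>
     (\<forall>s\<in>{a, b, c}. l < s \<longrightarrow> s < r \<longrightarrow> \<not> (\<chi> r < \<chi> s \<and> \<chi> s < \<chi> l)) \<and> clear l r (\<chi> r) (\<chi> l)"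
proof -
  have s: "state \<chi>" and z: "\<chi> a \<noteq> 0" "\<chi> b \<noteq> 0" "\<chi> c \<noteq> 0" using t by (auto simp: tri_def)
  have Z: "height (\<chi> s) = s \<or> \<chi> s = 0" if "s \<in> {mate a, mate b, mate c}" for s
    using that state_mate_constant[OF s z(1)] state_mate_constant[OF s z(2)] state_mate_constant[OF s z(3)]
    by (elim insertE emptyE) simp_all
  have e: "\<chi> s = \<phi> s" if "s \<notin> {a, b, c, mate a, mate b, mate c}" for s using t that by (simp add: tri_def)
  have m: "\<forall>s\<in>{a, b, c}. s \<notin> {mate a, mate b, mate c}"
    using mates(1-3) by (simp only: insert_iff empty_iff ball_simps) metis
  have "\<chi> r \<noteq> 0" using lr(2) z by (elim insertE emptyE) simp_all
  then have "(l, r) \<in> edges \<chi> \<longleftrightarrow> \<chi> r < \<chi> l \<and> r \<le> height (\<chi> l) \<and>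
     (\<forall>s. s \<notin> {mate a, mate b, mate c} \<longrightarrow> l < s \<longrightarrow> s < r \<longrightarrow> \<not> (\<chi> r < \<chi> s \<and> \<chi> s < \<chi> l))"
    using edge_iff[OF s, of "{mate a, mate b, mate c}" l r, OF Z] lr(3) by metis
  moreover have "(\<forall>s. s \<notin> {mate a, mate b, mate c} \<longrightarrow> l < s \<longrightarrow> s < r \<longrightarrow> \<not> (\<chi> r < \<chi> s \<and> \<chi> s < \<chi> l))
     \<longleftrightarrow> (\<forall>s\<in>{a, b, c}. l < s \<longrightarrow> s < r \<longrightarrow> \<not> (\<chi> r < \<chi> s \<and> \<chi> s < \<chi> l)) \<and> clear l r (\<chi> r) (\<chi> l)"
    (is "?L \<longleftrightarrow> ?R")
  proof
    assume L: ?L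
    have "clear l r (\<chi> r) (\<chi> l)"
      unfolding clear_def
    proof (intro allI impI)
      fix s assume s: "s \<notin> {a, b, c, mate a, mate b, mate c}" "l < s" "s < r"
      then have "\<not> (\<chi> r < \<chi> s \<and> \<chi> s < \<chi> l)" using L by blast
      then show "\<not> (\<chi> r < \<phi> s \<and> \<phi> s < \<chi> l)" using e[OF s(1)] by simp
    qed
    then show ?R using L m by blast
  next
    assume R: ?R
    show ?L
    proof (intro allI impI)
      fix s assume s: "s \<notin> {mate a, mate b, mate c}" "l < s" "s < r"
      show "\<not> (\<chi> r < \<chi> s \<and> \<chi> s < \<chi> l)"
      proof (cases "s \<in> {a, b, c}")
        case True
        then show ?thesis using R s by blast
      next
        case False
        then have n: "s \<notin> {a, b, c, mate a, mate b, mate c}" using s by blast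
        then have "\<not> (\<chi> r < \<phi> s \<and> \<phi> s < \<chi> l)" using R s unfolding clear_def by blast
        then show ?thesis using e[OF n] by simp
      qed
    qed
  qed
  ultimately show ?thesis by blast
qed

lemma tri_eqI:
  assumes "tri \<chi>" "tri \<psi>" "\<chi> a = \<psi> a" "\<chi> b = \<psi> b" "\<chi> c = \<psi> c"
  shows "\<chi> = \<psi>"
proof (rule state_eqI[where A = "{a, b, c}"])
  show "\<chi> s = \<psi> s" if s: "s \<notin> mate ` {a, b, c}" for s
  proof (cases "s \<in> {a, b, c}")
    case True
    then show ?thesis using assms(3-5) by (elim insertE emptyE) simp_all
  next
    case False
    then have "s \<notin> {a, b, c, mate a, mate b, mate c}" using s by simp
    then show ?thesis using assms(1,2) unfolding tri_def by metis
  qed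
  show "\<chi> s \<noteq> 0 \<and> s \<notin> mate ` {a, b, c}" if s: "s \<in> {a, b, c}" for s
  proof
    show "\<chi> s \<noteq> 0" using assms(1) s unfolding tri_def by (elim insertE emptyE conjE) simp_all
    show "s \<notin> mate ` {a, b, c}" using mates_outside s by (metis imageE)
  qed
  show "state \<chi>" "state \<psi>" using assms(1,2) unfolding tri_def by metis+
qed

lemma labels: "s \<notin> {a, b, c} \<Longrightarrow> \<phi> s \<noteq> \<phi> a \<and> \<phi> s \<noteq> \<phi> b \<and> \<phi> s \<noteq> \<phi> c"
  using state_inj[OF st] nz by (metis insert_iff)

lemma clear_ac: "clear a c x y \<longleftrightarrow> clear a b x y \<and> clear b c x y"
proof -
  have "a < s \<and> s < c \<longleftrightarrow> (a < s \<and> s < b) \<or> (b < s \<and> s < c)"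
    if "s \<notin> {a, b, c, mate a, mate b, mate c}" for s
  proof -
    have "s \<noteq> b" using that by blast
    then show ?thesis using abc by linarith
  qed
  then show ?thesis unfolding clear_def by meson
qed

lemma clear_label:
  assumes "z \<in> {\<phi> a, \<phi> b, \<phi> c}" "x < z" "z < y"
  shows "clear l r x y \<longleftrightarrow> clear l r x z \<and> clear l r z y"
proof -
  have "x < \<phi> s \<and> \<phi> s < y \<longleftrightarrow> (x < \<phi> s \<and> \<phi> s < z) \<or> (z < \<phi> s \<and> \<phi> s < y)"
    if "s \<notin> {a, b, c, mate a, mate b, mate c}" for s
  proof -
    have "\<phi> s \<noteq> z" using labels[of s] that assms(1) by (elim insertE emptyE) simp_all
    then show ?thesis using assms(2,3) by linarith
  qed
  then show ?thesis unfolding clear_def by meson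
qed

lemma path_iff:
  assumes "l \<in> {a, b, c}" "r \<in> {a, b, c}" "l < r" "l' \<in> {a, b, c}" "r' \<in> {a, b, c}" "l' < r'"
  shows "path \<phi> (l, r) (l', r') \<longleftrightarrow>
    (\<phi> r < \<phi> l \<and> r \<le> height (\<phi> l) \<and>
     (\<forall>s\<in>{a, b, c}. l < s \<longrightarrow> s < r \<longrightarrow> \<not> (\<phi> r < \<phi> s \<and> \<phi> s < \<phi> l)) \<and> clear l r (\<phi> r) (\<phi> l)) \<and>
    (let \<chi> = \<phi>(l := \<phi> r, r := \<phi> l) in
     \<chi> r' < \<chi> l' \<and> r' \<le> height (\<chi> l') \<and>
     (\<forall>s\<in>{a, b, c}. l' < s \<longrightarrow> s < r' \<longrightarrow> \<not> (\<chi> r' < \<chi> s \<and> \<chi> s < \<chi> l')) \<and> clear l' r' (\<chi> r') (\<chi> l'))"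
proof (cases "(l, r) \<in> edges \<phi>")
  case True
  then have h: "r \<le> height (\<phi> l)" by (rule edgeD)
  define \<psi> where "\<psi> = switch \<phi> l r"
  have t: "tri \<psi>" "\<And>s. s \<in> {a, b, c} \<Longrightarrow> \<psi> s = (\<phi>(l := \<phi> r, r := \<phi> l)) s"
    using tri_switch[OF tri_self assms(1-3) h] assms(3) by (auto simp: \<psi>_def)
  have "path \<phi> (l, r) (l', r') \<longleftrightarrow> (l', r') \<in> edges \<psi>"
    using True by (simp add: path_def \<psi>_def)
  also have "\<dots> \<longleftrightarrow> (let \<chi> = \<phi>(l := \<phi> r, r := \<phi> l) in
     \<chi> r' < \<chi> l' \<and> r' \<le> height (\<chi> l') \<and>
     (\<forall>s\<in>{a, b, c}. l' < s \<longrightarrow> s < r' \<longrightarrow> \<not> (\<chi> r' < \<chi> s \<and> \<chi> s < \<chi> l')) \<and> clear l' r' (\<chi> r') (\<chi> l'))"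
    unfolding tri_edge[OF t(1) assms(4-6)] Let_def
    using t(2)[OF assms(4)] t(2)[OF assms(5)] t(2) by (simp del: fun_upd_apply)
  finally show ?thesis using True unfolding tri_edge[OF tri_self assms(1-3)] by blast
next
  case False
  then have "\<not> path \<phi> (l, r) (l', r')" by (simp add: path_def)
  then show ?thesis using False unfolding tri_edge[OF tri_self assms(1-3)] by blast
qed

lemma start_heights: "a \<le> height (\<phi> a)" "b \<le> height (\<phi> b)" "c \<le> height (\<phi> c)"
  using state_bounds[OF st] nz by auto

lemma path_end_eqI:
  assumes p: "path \<phi> (l, r) (l', r')" "path \<phi> (m, n) (m', n')"
    and lr: "{(l, r), (l', r'), (m, n), (m', n')} \<subseteq> {(a, b), (a, c), (b, c)}"
    and eq: "\<And>s. s \<in> {a, b, c} \<Longrightarrow>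
      (let \<chi> = \<phi>(l := \<phi> r, r := \<phi> l) in \<chi>(l' := \<chi> r', r' := \<chi> l')) s =
      (let \<chi> = \<phi>(m := \<phi> n, n := \<phi> m) in \<chi>(m' := \<chi> n', n' := \<chi> m')) s"
  shows "path_end \<phi> (l, r) (l', r') = path_end \<phi> (m, n) (m', n')"
proof -
  have val: "tri (path_end \<phi> (l, r) (l', r')) \<and> (\<forall>s\<in>{a, b, c}. path_end \<phi> (l, r) (l', r') s =
      (let \<chi> = \<phi>(l := \<phi> r, r := \<phi> l) in \<chi>(l' := \<chi> r', r' := \<chi> l')) s)"
    if p: "path \<phi> (l, r) (l', r')" and lr: "{(l, r), (l', r')} \<subseteq> {(a, b), (a, c), (b, c)}" for l r l' r'
  proof -
    have m: "l \<in> {a, b, c}" "r \<in> {a, b, c}" "l < r" "l' \<in> {a, b, c}" "r' \<in> {a, b, c}" "l' < r'"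
      using lr abc by auto
    have h: "r \<le> height (\<phi> l)" "r' \<le> height (switch \<phi> l r l')" using p edgeD(5) by (auto simp: path_def)
    note t = tri_switch[OF tri_self m(1-3) h(1)]
    note t' = tri_switch[OF t(1) m(4-6) h(2)]
    have v: "\<forall>s\<in>{a, b, c}. switch \<phi> l r s = (\<phi>(l := \<phi> r, r := \<phi> l)) s" using t m(3) by auto
    have "\<forall>s\<in>{a, b, c}. switch (switch \<phi> l r) l' r' s =
        (let \<chi> = \<phi>(l := \<phi> r, r := \<phi> l) in \<chi>(l' := \<chi> r', r' := \<chi> l')) s"
      using t'(2,3,4) v m unfolding Let_def by (smt (verit) fun_upd_apply)
    then show ?thesis using t'(1) by (simp add: path_end_def)
  qed
  show ?thesis
    using val[OF p(1)] val[OF p(2)] lr eq by (intro tri_eqI) simp_all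
qed

text \<open>A permutation of three letters that is reached by two length-decreasing transpositions with a
  three-cycle as product is reached so in exactly two ways. The rectangles that have to be clear along
  the two ways cover the same region: they are cut along the column of \<open>b\<close> and along the row of the
  middle label (\<open>clear_ac\<close>, \<open>clear_label\<close>). The lemmas are named after the pattern of the labels at
  \<open>a, b, c\<close>.\<close>
lemma tri_321:
  assumes "\<phi> c < \<phi> b" "\<phi> b < \<phi> a"
  shows "path \<phi> (a, b) (b, c) \<longleftrightarrow> path \<phi> (b, c) (a, c)"
    and "path \<phi> (a, b) (a, c) \<longleftrightarrow> path \<phi> (b, c) (a, b)"
  using assms abc start_heights height_quasiconcave[of "\<phi> c" "\<phi> b" "\<phi> a" c]
    clear_label[of "\<phi> b" "\<phi> c" "\<phi> a"]
  by (auto simp: path_iff clear_ac Let_def)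

lemma tri_312:
  assumes "\<phi> b < \<phi> c" "\<phi> c < \<phi> a"
  shows "path \<phi> (a, b) (b, c) \<longleftrightarrow> path \<phi> (a, c) (a, b)"
  using assms abc start_heights height_quasiconcave[of "\<phi> b" "\<phi> c" "\<phi> a" b]
    clear_label[of "\<phi> c" "\<phi> b" "\<phi> a"]
  by (auto simp: path_iff clear_ac Let_def)

lemma tri_231:
  assumes "\<phi> c < \<phi> a" "\<phi> a < \<phi> b"
  shows "path \<phi> (a, c) (b, c) \<longleftrightarrow> path \<phi> (b, c) (a, b)"
  using assms abc start_heights height_quasiconcave[of "\<phi> c" "\<phi> a" "\<phi> b" c]
    clear_label[of "\<phi> a" "\<phi> c" "\<phi> b"]
  by (auto simp: path_iff clear_ac Let_def)

end

section \<open>Pairs of disjoint steps\<close>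

lemma path_commute:
  assumes st: "state \<phi>" and p: "path \<phi> (p, q) (p', q')" and dis: "{p, q} \<inter> {p', q'} = {}"
  shows "path \<phi> (p', q') (p, q)" and "path_end \<phi> (p', q') (p, q) = path_end \<phi> (p, q) (p', q')"
proof -
  define \<psi> where "\<psi> = switch \<phi> p q"
  define \<chi> where "\<chi> = switch \<phi> p' q'"
  have e1: "(p, q) \<in> edges \<phi>" and e2: "(p', q') \<in> edges \<psi>"
    using p by (simp_all add: path_def \<psi>_def)
  note E1 = edgeD[OF e1] and E2 = edgeD[OF e2]
  have ne: "p \<noteq> p'" "p \<noteq> q'" "q \<noteq> p'" "q \<noteq> q'" using dis by simp_all
  have m: "p' \<noteq> mate q" "q' \<noteq> mate q"
    using path_avoids_mate[OF st e1] e2 by (simp_all add: \<psi>_def)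
  have mq: "mate q \<noteq> q" "mate (mate q) = q" using state_mate_pt[OF st E1(2)] by simp_all
  have pm: "p \<noteq> mate q" using state_moving_mate[OF st E1(3) _ E1(2)] E1(1,5) by simp
  have v: "\<psi> p = \<phi> q" "\<psi> q = \<phi> p" "\<And>s. s \<noteq> p \<Longrightarrow> s \<noteq> q \<Longrightarrow> s \<noteq> mate q \<Longrightarrow> \<psi> s = \<phi> s"
    using E1(1) mq(1) pm by (simp_all add: \<psi>_def switch_def)
  have v': "\<psi> p' = \<phi> p'" "\<psi> q' = \<phi> q'" using v(3) ne m by metis+
  have n: "\<phi> p' \<noteq> 0" "\<phi> q' \<noteq> 0" using E2(2,3) v' by simp_all
  have mq': "mate q' \<noteq> q'" "mate (mate q') = q'" using state_mate_pt[OF st n(2)] by simp_all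
  have pm': "p \<noteq> mate q'" "p' \<noteq> mate q'" "q \<noteq> mate q'"
    using state_moving_mate[OF st E1(3) _ n(2)] E1(1,5) state_moving_mate[OF st n(1) _ n(2)] E2(1,5) v' m(2) mq' by auto
  have w: "\<chi> p' = \<phi> q'" "\<chi> q' = \<phi> p'" "\<And>s. s \<noteq> p' \<Longrightarrow> s \<noteq> q' \<Longrightarrow> s \<noteq> mate q' \<Longrightarrow> \<chi> s = \<phi> s"
    using E2(1) mq'(1) pm' by (simp_all add: \<chi>_def switch_def)
  have w': "\<chi> p = \<phi> p" "\<chi> q = \<phi> q" using w(3) ne pm' by metis+
  have stp: "state \<psi>" using state_edge[OF st e1] by (simp add: \<psi>_def)
  have stc: "state \<chi>" unfolding \<chi>_def
    by (rule state_switch[OF st n(2,1)]) (use E2(1,5) v' in simp_all)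
  define Z where "Z = {mate q, mate q'}"
  have inj: "\<phi> p \<noteq> \<phi> p'" "\<phi> p \<noteq> \<phi> q'" "\<phi> q \<noteq> \<phi> p'" "\<phi> q \<noteq> \<phi> q'"
    using state_inj[OF st] n E1(2,3) ne by metis+
  have ZZ: "height (\<phi> s) = s \<or> \<phi> s = 0" "height (\<chi> s) = s \<or> \<chi> s = 0" if "s \<in> Z" for s
  proof -
    have "\<chi> q' \<noteq> 0" "\<chi> q \<noteq> 0" using w w' n E1 by simp_all
    with that show "height (\<phi> s) = s \<or> \<phi> s = 0" "height (\<chi> s) = s \<or> \<chi> s = 0" unfolding Z_def
      using state_mate_constant[OF st E1(2)] state_mate_constant[OF st n(2)]
        state_mate_constant[OF stc, of q'] state_mate_constant[OF stc, of q]
      by (elim insertE emptyE; simp)+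
  qed
  have b: "\<not> (\<phi> q < \<phi> s \<and> \<phi> s < \<phi> p)" if "p < s" "s < q" for s using E1(6) that by blast
  have b': "\<not> (\<phi> q' < \<psi> s \<and> \<psi> s < \<phi> p')" if "p' < s" "s < q'" for s using E2(6) that v' by metis
  have geo: "\<not> (p' < p \<and> p < q' \<and> \<phi> q' < \<phi> p \<and> \<phi> p < \<phi> p')"
    "\<not> (p' < q \<and> q < q' \<and> \<phi> q' < \<phi> q \<and> \<phi> q < \<phi> p')"
    "\<not> (p < p' \<and> p' < q \<and> \<phi> q < \<phi> q' \<and> \<phi> q' < \<phi> p)"
    "\<not> (p < q' \<and> q' < q \<and> \<phi> q < \<phi> p' \<and> \<phi> p' < \<phi> p)"
  proof -
    have c: "\<not> (p < p' \<and> p' < q \<and> \<phi> q < \<phi> p' \<and> \<phi> p' < \<phi> p)"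
      "\<not> (p < q' \<and> q' < q \<and> \<phi> q < \<phi> q' \<and> \<phi> q' < \<phi> p)"
      using b by simp_all
    have c': "\<not> (p' < p \<and> p < q' \<and> \<phi> q' < \<phi> q \<and> \<phi> q < \<phi> p')"
      "\<not> (p' < q \<and> q < q' \<and> \<phi> q' < \<phi> p \<and> \<phi> p < \<phi> p')"
      using b'[of p] b'[of q] unfolding v(1,2) by simp_all
    have "\<phi> q' < \<phi> p'" using E2(4) unfolding v' .
    note g = crossing_exchange[OF E1(1) E2(1) E1(4) this ne inj c c']
    show "\<not> (p' < p \<and> p < q' \<and> \<phi> q' < \<phi> p \<and> \<phi> p < \<phi> p')"
      "\<not> (p' < q \<and> q < q' \<and> \<phi> q' < \<phi> q \<and> \<phi> q < \<phi> p')"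
      "\<not> (p < p' \<and> p' < q \<and> \<phi> q < \<phi> q' \<and> \<phi> q' < \<phi> p)"
      "\<not> (p < q' \<and> q' < q \<and> \<phi> q < \<phi> p' \<and> \<phi> p' < \<phi> p)"
      by (rule g)+
  qed
  have f1: "(p', q') \<in> edges \<phi>"
  proof (intro edge_iff[OF st ZZ(1), of Z p' q', THEN iffD2] conjI allI impI)
    fix s assume s: "s \<notin> Z" "p' < s" "s < q'"
    show "\<not> (\<phi> q' < \<phi> s \<and> \<phi> s < \<phi> p')"
    proof (cases "s = p \<or> s = q")
      case False
      then show ?thesis using b'[OF s(2,3)] v(3)[of s] s(1) by (simp add: Z_def)
    next
      case True
      then show ?thesis
        using geo(1,2) s by (elim disjE) simp_all
    qed
  qed (use E2 v' n in simp_all)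
  have f2: "(p, q) \<in> edges \<chi>"
  proof (intro edge_iff[OF stc ZZ(2), of Z p q, THEN iffD2] conjI allI impI)
    fix s assume s: "s \<notin> Z" "p < s" "s < q"
    show "\<not> (\<chi> q < \<chi> s \<and> \<chi> s < \<chi> p)"
    proof (cases "s = p' \<or> s = q'")
      case False
      then show ?thesis using b[OF s(2,3)] w(3)[of s] s(1) w' by (simp add: Z_def)
    next
      case True
      then show ?thesis
        using geo(3,4) s w w' by (elim disjE) simp_all
    qed
  qed (use E1 w' in simp_all)
  show "path \<phi> (p', q') (p, q)" using f1 f2 by (simp add: path_def \<chi>_def)
  have "switch \<chi> p q = switch \<psi> p' q'"
  proof (rule state_eqI[where A = "{q, q'}"])
    show "state (switch \<chi> p q)" by (rule state_edge[OF stc f2])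
    show "state (switch \<psi> p' q')" by (rule state_edge[OF stp e2])
    show "switch \<chi> p q s = switch \<psi> p' q' s" if "s \<notin> mate ` {q, q'}" for s
      using that ne E1(1) E2(1) v' w' by (simp add: switch_def \<psi>_def \<chi>_def)
    show "switch \<chi> p q s \<noteq> 0 \<and> s \<notin> mate ` {q, q'}" if "s \<in> {q, q'}" for s
      using that m mq mq' pm' E1 E2 w w' n ne by (elim insertE emptyE) (simp_all add: switch_def)
  qed
  then show "path_end \<phi> (p', q') (p, q) = path_end \<phi> (p, q) (p', q')" by (simp add: path_end_def \<psi>_def \<chi>_def)
qed

section \<open>The boundary squares to zero\<close>

text \<open>The other factorization of a path of two steps. If the steps share a strand, the cases are those of
  \<open>tri_321\<close>, \<open>tri_312\<close> and \<open>tri_231\<close>, read in both directions.\<close>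
definition partner :: "(nat \<Rightarrow> nat) \<Rightarrow> (nat \<times> nat) \<times> (nat \<times> nat) \<Rightarrow> (nat \<times> nat) \<times> (nat \<times> nat)" where
  "partner \<phi> = (\<lambda>((p, q), (p', q')).
     if p' \<noteq> p \<and> p' \<noteq> q \<and> q' \<noteq> p \<and> q' \<noteq> q then ((p', q'), (p, q))
     else if p' = p then (if q < q' then ((q, q'), (p, q)) else ((p, q'), (q', q)))
     else if q' = q then (if p' < p then ((p', p), (p, q)) else ((p', q), (p, p')))
     else if p' = q then (if \<phi> q' < \<phi> q then ((q, q'), (p, q')) else ((p, q'), (p, q)))
     else (if \<phi> p < \<phi> p' then ((p', p), (p', q)) else ((p', q), (p, q))))"

lemma path_third:
  assumes st: "state \<phi>" and p: "path \<phi> (p, q) (p', q')" and r: "r \<in> {p', q'}" "r \<noteq> p" "r \<noteq> q"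
  shows "\<phi> r \<noteq> 0" "switch \<phi> p q r = \<phi> r" "p \<noteq> mate q" "q \<noteq> mate p" "p \<noteq> mate r" "r \<noteq> mate p"
    "q \<noteq> mate r" "r \<noteq> mate q"
proof -
  have e1: "(p, q) \<in> edges \<phi>" and e2: "(p', q') \<in> edges (switch \<phi> p q)"
    using p by (simp_all add: path_def)
  note E1 = edgeD[OF e1] and E2 = edgeD[OF e2]
  show m: "r \<noteq> mate q" using path_avoids_mate[OF st e1 e2] r(1) by (elim insertE emptyE) simp_all
  show v: "switch \<phi> p q r = \<phi> r" using r(2,3) m by (simp add: switch_def)
  have "switch \<phi> p q r \<noteq> 0" using E2(2,3) r(1) by (elim insertE emptyE) simp_all
  then show n: "\<phi> r \<noteq> 0" using v by simp
  have s: "mate (mate q) = q" "mate (mate r) = r" "mate (mate p) = p"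
    using state_mate_pt[OF st] E1(2,3) n by blast+
  show pq: "p \<noteq> mate q" and pr: "p \<noteq> mate r"
    using state_moving_mate[OF st E1(3)] E1(1,2,5) n by simp_all
  show "q \<noteq> mate p" using pq s by metis
  show "r \<noteq> mate p" using pr s by metis
  show "q \<noteq> mate r" using m s by metis
qed

lemma partner_path:
  assumes st: "state \<phi>" and p: "path \<phi> (p, q) (p', q')"
  defines "\<pi> \<equiv> partner \<phi> ((p, q), (p', q'))"
  shows "path \<phi> (fst \<pi>) (snd \<pi>) \<and> path_end \<phi> (fst \<pi>) (snd \<pi>) = path_end \<phi> (p, q) (p', q') \<and>
    partner \<phi> \<pi> = ((p, q), (p', q')) \<and> \<pi> \<noteq> ((p, q), (p', q'))"
proof -
  have e1: "(p, q) \<in> edges \<phi>" and e2: "(p', q') \<in> edges (switch \<phi> p q)"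
    using p by (simp_all add: path_def)
  note E1 = edgeD[OF e1] and E2 = edgeD[OF e2]
  have pm: "p \<noteq> mate q" using state_moving_mate[OF st E1(3) _ E1(2)] E1(1,5) by simp
  have v: "switch \<phi> p q p = \<phi> q" "switch \<phi> p q q = \<phi> p"
    using pm E1(1) state_mate_pt[OF st E1(2)] by (simp_all add: switch_def)
  consider (dis) "{p, q} \<inter> {p', q'} = {}" | (pp) "p' = p" "q' \<noteq> q" | (qq) "q' = q" "p' \<noteq> p"
    | (pq) "p' = q" | (qp) "q' = p" | (same) "p' = p" "q' = q" by blast
  then show ?thesis
  proof cases
    case dis
    then have "\<pi> = ((p', q'), (p, q))" by (simp add: \<pi>_def partner_def)
    then show ?thesis using path_commute[OF st p dis] dis by (simp add: partner_def)
  next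
    case pp
    have r: "q' \<noteq> p" "q' \<noteq> q" using pp E2(1) by simp_all
    have rm: "q' \<in> {p', q'}" by simp
    note t = path_third[OF st p rm r]
    have x: "\<phi> q' < \<phi> q" using E2(4) t(2) v pp by simp
    show ?thesis
    proof (cases "q < q'")
      case True
      have \<pi>: "\<pi> = ((q, q'), (p, q))" using pp True r E1(1) by (simp add: \<pi>_def partner_def)
      note T = tri_321(2)[OF st E1(1) True E1(3,2) t(1,3,5,7) x E1(4)]
      have p': "path \<phi> (q, q') (p, q)" using T p pp by simp
      have "path_end \<phi> (q, q') (p, q) = path_end \<phi> (p, q) (p', q')"
        by (rule path_end_eqI[OF st E1(1) True E1(3,2) t(1,3,5,7) p' p]) (use pp r E1(1) in \<open>auto simp: Let_def\<close>)
      then show ?thesis using p' \<pi> pp r E1(1,4) True by (simp add: partner_def)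
    next
      case False
      then have o: "p < q'" "q' < q" using pp r E2(1) by simp_all
      have \<pi>: "\<pi> = ((p, q'), (q', q))" using pp False r E1(1) by (simp add: \<pi>_def partner_def)
      note T = tri_312[OF st o E1(3) t(1) E1(2) t(5,3,8) x E1(4)]
      have p': "path \<phi> (p, q') (q', q)" using T p pp by simp
      have "path_end \<phi> (p, q') (q', q) = path_end \<phi> (p, q) (p', q')"
        by (rule path_end_eqI[OF st o E1(3) t(1) E1(2) t(5,3,8) p' p]) (use pp r E1(1) o in \<open>auto simp: Let_def\<close>)
      then show ?thesis using p' \<pi> pp r E1(1,4) o x by (simp add: partner_def)
    qed
  next
    case qq
    have r: "p' \<noteq> p" "p' \<noteq> q" using qq E2(1) by simp_all
    have rm: "p' \<in> {p', q'}" by simp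
    note t = path_third[OF st p rm r]
    have x: "\<phi> p < \<phi> p'" using E2(4) t(2) v qq by simp
    show ?thesis
    proof (cases "p' < p")
      case True
      have \<pi>: "\<pi> = ((p', p), (p, q))" using qq True r E1(1) by (simp add: \<pi>_def partner_def)
      note T = tri_321(1)[OF st True E1(1) t(1) E1(3,2) t(6,8,3) E1(4) x]
      have p': "path \<phi> (p', p) (p, q)" using T p qq by simp
      have "path_end \<phi> (p', p) (p, q) = path_end \<phi> (p, q) (p', q')"
        by (rule path_end_eqI[OF st True E1(1) t(1) E1(3,2) t(6,8,3) p' p]) (use qq r E1(1) True in \<open>auto simp: Let_def\<close>)
      then show ?thesis using p' \<pi> qq r E1(1,4) True by (simp add: partner_def)
    next
      case False
      then have o: "p < p'" "p' < q" using qq r E2(1) by simp_all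
      have \<pi>: "\<pi> = ((p', q), (p, p'))" using qq False r E1(1) by (simp add: \<pi>_def partner_def)
      note T = tri_231[OF st o E1(3) t(1) E1(2) t(5,3,8) E1(4) x]
      have p': "path \<phi> (p', q) (p, p')" using T p qq by simp
      have "path_end \<phi> (p', q) (p, p') = path_end \<phi> (p, q) (p', q')"
        by (rule path_end_eqI[OF st o E1(3) t(1) E1(2) t(5,3,8) p' p]) (use qq r E1(1) o in \<open>auto simp: Let_def\<close>)
      then show ?thesis using p' \<pi> qq r E1(1,4) o x by (simp add: partner_def)
    qed
  next
    case pq
    have r: "q' \<noteq> p" "q' \<noteq> q" using pq E2(1) E1(1) by simp_all
    have rm: "q' \<in> {p', q'}" by simp
    note t = path_third[OF st p rm r]
    have o: "q < q'" using pq E2(1) by simp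
    have x: "\<phi> q' < \<phi> p" using E2(4) t(2) v pq by simp
    show ?thesis
    proof (cases "\<phi> q' < \<phi> q")
      case True
      have \<pi>: "\<pi> = ((q, q'), (p, q'))" using pq True r E1(1) by (simp add: \<pi>_def partner_def)
      note T = tri_321(1)[OF st E1(1) o E1(3,2) t(1,3,5,7) True E1(4)]
      have p': "path \<phi> (q, q') (p, q')" using T p pq by simp
      have "path_end \<phi> (q, q') (p, q') = path_end \<phi> (p, q) (p', q')"
        by (rule path_end_eqI[OF st E1(1) o E1(3,2) t(1,3,5,7) p' p]) (use pq r E1(1) o in \<open>auto simp: Let_def\<close>)
      then show ?thesis using p' \<pi> pq r E1(1,4) True o by (simp add: partner_def)
    next
      case False
      have "\<phi> q \<noteq> \<phi> q'" using state_inj[OF st E1(2)] r by metis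
      then have y: "\<phi> q < \<phi> q'" using False by simp
      have \<pi>: "\<pi> = ((p, q'), (p, q))" using pq False r E1(1) by (simp add: \<pi>_def partner_def)
      note T = tri_312[OF st E1(1) o E1(3,2) t(1,3,5,7) y x]
      have p': "path \<phi> (p, q') (p, q)" using T p pq by simp
      have "path_end \<phi> (p, q') (p, q) = path_end \<phi> (p, q) (p', q')"
        by (rule path_end_eqI[OF st E1(1) o E1(3,2) t(1,3,5,7) p' p]) (use pq r E1(1) o in \<open>auto simp: Let_def\<close>)
      then show ?thesis using p' \<pi> pq r E1(1,4) o x by (simp add: partner_def)
    qed
  next
    case qp
    have r: "p' \<noteq> p" "p' \<noteq> q" using qp E2(1) E1(1) by simp_all
    have rm: "p' \<in> {p', q'}" by simp
    note t = path_third[OF st p rm r]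
    have o: "p' < p" using qp E2(1) by simp
    have x: "\<phi> q < \<phi> p'" using E2(4) t(2) v qp by simp
    show ?thesis
    proof (cases "\<phi> p < \<phi> p'")
      case True
      have \<pi>: "\<pi> = ((p', p), (p', q))" using qp True r E1(1) by (simp add: \<pi>_def partner_def)
      note T = tri_321(2)[OF st o E1(1) t(1) E1(3,2) t(6,8,3) E1(4) True]
      have p': "path \<phi> (p', p) (p', q)" using T p qp by simp
      have "path_end \<phi> (p', p) (p', q) = path_end \<phi> (p, q) (p', q')"
        by (rule path_end_eqI[OF st o E1(1) t(1) E1(3,2) t(6,8,3) p' p]) (use qp r E1(1) o in \<open>auto simp: Let_def\<close>)
      then show ?thesis using p' \<pi> qp r E1(1,4) True o by (simp add: partner_def)
    next
      case False
      have "\<phi> p \<noteq> \<phi> p'" using state_inj[OF st E1(3)] r by metis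
      then have y: "\<phi> p' < \<phi> p" using False by simp
      have \<pi>: "\<pi> = ((p', q), (p, q))" using qp False r E1(1) by (simp add: \<pi>_def partner_def)
      note T = tri_231[OF st o E1(1) t(1) E1(3,2) t(6,8,3) x y]
      have p': "path \<phi> (p', q) (p, q)" using T p qp by simp
      have "path_end \<phi> (p', q) (p, q) = path_end \<phi> (p, q) (p', q')"
        by (rule path_end_eqI[OF st o E1(1) t(1) E1(3,2) t(6,8,3) p' p]) (use qp r E1(1) o in \<open>auto simp: Let_def\<close>)
      then show ?thesis using p' \<pi> qp r E1(1,4) o x y by (simp add: partner_def)
    qed
  next
    case same
    then show ?thesis using E2(4) E1(4) v by simp
  qed
qed

theorem boundary_boundary:
  assumes st: "state \<phi>"
  shows "lin boundary (boundary \<phi>) = 0"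
proof -
  let ?P = "Sigma (edges \<phi>) (\<lambda>e. edges (switch \<phi> (fst e) (snd e)))"
  have mem: "(e, e') \<in> ?P \<longleftrightarrow> path \<phi> e e'" for e e' by (auto simp: path_def)
  have "lin boundary (boundary \<phi>) = (\<Sum>e\<in>edges \<phi>. boundary (switch \<phi> (fst e) (snd e)))"
    unfolding boundary_def[of \<phi>] lin_sum by (simp add: case_prod_beta)
  also have "\<dots> = (\<Sum>e\<in>edges \<phi>. \<Sum>e'\<in>edges (switch \<phi> (fst e) (snd e)). basis (path_end \<phi> e e'))"
    unfolding boundary_def path_end_def by (simp add: case_prod_beta)
  also have "\<dots> = (\<Sum>(e, e')\<in>?P. basis (path_end \<phi> e e'))"
    using finite_edges[OF st] finite_edges[OF state_edge[OF st]] by (subst sum.Sigma) auto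
  also have "\<dots> = 0"
  proof (rule sum_involution_zero[where \<tau> = "partner \<phi>"])
    show "finite ?P" using finite_edges[OF st] finite_edges[OF state_edge[OF st]] by auto
    fix \<pi> assume "\<pi> \<in> ?P"
    then obtain p q p' q' where \<pi>: "\<pi> = ((p, q), (p', q'))" "path \<phi> (p, q) (p', q')"
      using mem by (metis prod.exhaust)
    note P = partner_path[OF st \<pi>(2), folded \<pi>(1)]
    obtain e e' where e: "partner \<phi> \<pi> = (e, e')" by (cases "partner \<phi> \<pi>")
    show "partner \<phi> \<pi> \<in> ?P" "partner \<phi> (partner \<phi> \<pi>) = \<pi>" "partner \<phi> \<pi> \<noteq> \<pi>"
      using P e by (simp_all add: mem del: mem_Sigma_iff)
    show "(case partner \<phi> \<pi> of (e, e') \<Rightarrow> basis (path_end \<phi> e e')) = (case \<pi> of (e, e') \<Rightarrow> basis (path_end \<phi> e e'))"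
      using P e \<pi>(1) by simp
  qed
  finally show ?thesis .
qed

section \<open>The homotopy at a pivot\<close>

lemma left_label:
  assumes "1 \<le> t" "t \<le> 4 * k"
  shows "mate_label (8 * k + 1 - t) = 8 * k + 1 - mate t" "height (8 * k + 1 - t) = t"
proof -
  have "\<not> 8 * k + 1 - t \<le> 4 * k" "8 * k + 1 - (8 * k + 1 - t) = t" using assms by linarith+
  then show "mate_label (8 * k + 1 - t) = 8 * k + 1 - mate t" "height (8 * k + 1 - t) = t"
    unfolding mate_label_def height_def by (simp_all only: if_False)
qed

text \<open>The strands over the segment above \<open>c\<close>; their number is the multiplicity there.\<close>
definition cover :: "(nat \<Rightarrow> nat) \<Rightarrow> nat \<Rightarrow> nat set" where
  "cover \<phi> c = {s. s \<le> c \<and> c < height (\<phi> s)}"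

text \<open>The condition speaks of multiplicities only, so that it is inherited along steps. The last
  disjunction ensures that a strand starts at \<open>e\<close>: either the second strand over \<open>e\<close> can only start
  there, or no moving strand starts at the matched point.\<close>
definition pivot :: "nat \<Rightarrow> (nat \<Rightarrow> nat) \<Rightarrow> bool" where
  "pivot e \<phi> \<longleftrightarrow> state \<phi> \<and> 1 \<le> e \<and> e \<le> 4 * k \<and> card (cover \<phi> (e - 1)) = 1 \<and>
     (2 \<le> card (cover \<phi> e) \<or> cover \<phi> (mate e) = {})"

definition under :: "nat \<Rightarrow> (nat \<Rightarrow> nat) \<Rightarrow> nat" where
  "under e \<phi> = (THE w. w < e \<and> e \<le> height (\<phi> w))"

text \<open>The main term reverses the step at \<open>(under e \<phi>, e)\<close>. If this creates a right double horizontal at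
  \<open>e\<close>, a left strand ending at the matched point can interact with it; the correction term accounts
  for this. The restriction on \<open>r\<close> excludes the constant strand of a left double horizontal.\<close>
definition homotopy_at :: "nat \<Rightarrow> (nat \<Rightarrow> nat) \<Rightarrow> (nat \<Rightarrow> nat) f2span" where
  "homotopy_at e \<phi> = (let w = under e \<phi> in
     if \<phi> w < \<phi> e then
       basis (switch \<phi> w e) +
       (if \<phi> w = e then
          \<Sum>r | r \<noteq> mate e \<and> \<phi> r = 8 * k + 1 - mate e. basis (\<phi>(r := mate e, w := 8 * k + 1 - e))
        else 0)
     else 0)"

lemma finite_cover: "finite (cover \<phi> c)"
  by (rule finite_subset[of _ "{..c}"]) (auto simp: cover_def)

text \<open>Both strands start at or below \<open>q\<close> and both ends lie at or above \<open>q\<close>, so above \<open>q\<close> only the names of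
  the two strands are exchanged, and below \<open>q\<close> nothing happens.\<close>
lemma card_cover_switch:
  assumes st: "state \<phi>" and q: "\<phi> q \<noteq> 0" and p: "\<phi> p \<noteq> 0" and pq: "p < q" and qh: "q \<le> height (\<phi> p)"
  shows "card (cover (switch \<phi> p q) c) = card (cover \<phi> c)"
proof -
  define \<psi> where "\<psi> = switch \<phi> p q"
  have mq: "mate q \<noteq> q" using state_mate_pt[OF st q] by simp
  have pm: "p \<noteq> mate q" using state_moving_mate[OF st p _ q] pq qh by simp
  have v: "\<psi> p = \<phi> q" "\<psi> q = \<phi> p" "\<And>s. s \<noteq> p \<Longrightarrow> s \<noteq> q \<Longrightarrow> s \<noteq> mate q \<Longrightarrow> \<psi> s = \<phi> s"
    using pq mq pm by (simp_all add: \<psi>_def switch_def)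
  have qh': "q \<le> height (\<phi> q)" using state_bounds[OF st q] by simp
  have st': "state \<psi>" unfolding \<psi>_def by (rule state_switch[OF st q p pq qh])
  have "\<psi> q \<noteq> 0" using v p by simp
  then have n: "mate q \<notin> cover \<phi> c" "mate q \<notin> cover \<psi> c"
    using state_mate_constant[OF st q] state_mate_constant[OF st', of q] by (auto simp: cover_def)
  define \<sigma> where "\<sigma> s = (if s = p then q else if s = q then p else s)" for s
  have \<sigma>: "\<sigma> (\<sigma> s) = s" for s by (simp add: \<sigma>_def)
  show ?thesis
  proof (cases "c < q")
    case True
    have "s \<in> cover \<psi> c \<longleftrightarrow> s \<in> cover \<phi> c" for s
    proof -
      consider "s = p" | "s = q" | "s = mate q" | "s \<noteq> p" "s \<noteq> q" "s \<noteq> mate q" by blast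
      then show ?thesis
      proof cases
        case 3
        then show ?thesis using n by simp
      qed (use v True qh qh' in \<open>simp_all add: cover_def\<close>)
    qed
    then have "cover \<psi> c = cover \<phi> c" by blast
    then show ?thesis by (simp add: \<psi>_def)
  next
    case False
    have iff: "\<sigma> s \<in> cover \<psi> c \<longleftrightarrow> s \<in> cover \<phi> c" for s
    proof -
      consider "s = p" | "s = q" | "s = mate q" | "s \<noteq> p" "s \<noteq> q" "s \<noteq> mate q" by blast
      then show ?thesis
      proof cases
        case 3
        then show ?thesis using n pm mq by (simp add: \<sigma>_def)
      qed (use v False pq in \<open>simp_all add: cover_def \<sigma>_def\<close>)
    qed
    have "bij_betw \<sigma> (cover \<phi> c) (cover \<psi> c)"
      by (rule bij_betw_byWitness[where f' = \<sigma>]) (use \<sigma> iff in \<open>auto, metis+\<close>)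
    then show ?thesis unfolding \<psi>_def by (metis bij_betw_same_card)
  qed
qed

lemma pivot_switch:
  assumes "pivot e \<phi>" "\<phi> q \<noteq> 0" "\<phi> p \<noteq> 0" "p < q" "q \<le> height (\<phi> p)"
  shows "pivot e (switch \<phi> p q)"
proof -
  have st: "state \<phi>" using assms(1) by (simp add: pivot_def)
  have "cover (switch \<phi> p q) (mate e) = {} \<longleftrightarrow> cover \<phi> (mate e) = {}"
    using card_cover_switch[OF st assms(2-5), of "mate e"] finite_cover by (metis card_eq_0_iff)
  then show ?thesis
    using assms(1) card_cover_switch[OF st assms(2-5)] state_switch[OF st assms(2-5)] by (simp add: pivot_def)
qed

lemma pivot_edge: "pivot e \<phi> \<Longrightarrow> (p, q) \<in> edges \<phi> \<Longrightarrow> pivot e (switch \<phi> p q)"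
  by (rule pivot_switch) (auto dest: edgeD)

lemma under_unique:
  assumes l: "pivot e \<phi>"
  shows "under e \<phi> < e" "e \<le> height (\<phi> (under e \<phi>))" "\<And>s. s < e \<Longrightarrow> e \<le> height (\<phi> s) \<Longrightarrow> under e \<phi> = s"
proof -
  have "1 \<le> e" using l unfolding pivot_def by metis
  then have c: "s \<in> cover \<phi> (e - 1) \<longleftrightarrow> s < e \<and> e \<le> height (\<phi> s)" for s
    unfolding cover_def mem_Collect_eq by linarith
  obtain w where "cover \<phi> (e - 1) = {w}"
    using l card_1_singletonE unfolding pivot_def by metis
  then have w: "s < e \<and> e \<le> height (\<phi> s) \<longleftrightarrow> s = w" for s using c[of s] by simp
  have u: "under e \<phi> = w" unfolding under_def w by simp
  show "under e \<phi> < e" "e \<le> height (\<phi> (under e \<phi>))" "\<And>s. s < e \<Longrightarrow> e \<le> height (\<phi> s) \<Longrightarrow> under e \<phi> = s"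
    unfolding u using w by metis+
qed

lemma pivot_start:
  assumes l: "pivot e \<phi>"
  shows "\<phi> e \<noteq> 0"
proof
  assume z: "\<phi> e = 0"
  have st: "state \<phi>" and e: "1 \<le> e" "e \<le> 4 * k" using l by (simp_all add: pivot_def)
  have "s \<in> cover \<phi> (e - 1)" if "s \<in> cover \<phi> e" for s
  proof -
    have "s \<noteq> e" using that z by (auto simp: cover_def)
    then show ?thesis using that e by (auto simp: cover_def)
  qed
  then have "card (cover \<phi> e) \<le> card (cover \<phi> (e - 1))" by (intro card_mono finite_cover) auto
  then have "cover \<phi> (mate e) = {}" using l by (simp add: pivot_def)
  moreover have "\<phi> (mate e) \<noteq> 0" using state_start[OF st e] z by simp
  then have "mate e \<in> cover \<phi> (mate e)"
    using state_mate[OF st, of "mate e"] state_label[OF st, of "mate e"] mate_pt[OF e] z state_bounds[OF st, of "mate e"]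
    by (auto simp: cover_def split: if_splits)
  ultimately show False by simp
qed

lemma under_nz: "pivot e \<phi> \<Longrightarrow> \<phi> (under e \<phi>) \<noteq> 0"
  using under_unique(1,2)[of e \<phi>] by (metis height_0 le_zero_eq not_less_zero)

text \<open>A strand between the two would start below \<open>e\<close> and, by quasiconcavity, end at or above \<open>e\<close>, against
  the uniqueness of the strand over the segment below \<open>e\<close>.\<close>
lemma pivot_edge_mem:
  assumes l: "pivot e \<phi>" and S: "\<phi> e < \<phi> (under e \<phi>)"
  shows "(under e \<phi>, e) \<in> edges \<phi>"
proof -
  define w where "w = under e \<phi>"
  note U = under_unique[OF l, folded w_def]
  have st: "state \<phi>" using l by (simp add: pivot_def)
  have eh: "e \<le> height (\<phi> e)" using state_bounds[OF st pivot_start[OF l]] by simp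
  have "\<not> (\<phi> e < \<phi> s \<and> \<phi> s < \<phi> w)" if s: "w < s" "s < e" for s
  proof
    assume a: "\<phi> e < \<phi> s \<and> \<phi> s < \<phi> w"
    have "e \<le> height (\<phi> s)"
      using height_quasiconcave[of "\<phi> e" "\<phi> s" "\<phi> w" e] a eh U(2) by simp
    then show False using U(3)[of s] s by simp
  qed
  then show ?thesis using U(1,2) pivot_start[OF l] S by (simp add: edges_def w_def)
qed

lemma homotopy_crossed:
  "pivot e \<phi> \<Longrightarrow> \<phi> e < \<phi> (under e \<phi>) \<Longrightarrow> homotopy_at e \<phi> = 0"
  by (simp add: homotopy_at_def Let_def)

text \<open>A step raises the label at its upper start and lowers it at its lower one. Only the strand over the
  pivot reaches far enough to raise the label at \<open>e\<close>, which is the excluded step. If a step lowered the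
  label of the strand over the pivot below the label at \<open>e\<close>, the strand at \<open>e\<close> would lie between its two
  strands. The other steps only move the start of the strand over the pivot. The exception opens the
  double horizontal at the pivot through its other point.\<close>
lemma edge_keeps_crossed:
  assumes l: "pivot e \<phi>" and S: "\<phi> e < \<phi> (under e \<phi>)" and pq: "(p, q) \<in> edges \<phi>"
    and ne: "(p, q) \<noteq> (under e \<phi>, e)" and exc: "\<not> (\<phi> e = e \<and> q = mate e)"
  shows "switch \<phi> p q e < switch \<phi> p q (under e (switch \<phi> p q))"
proof -
  define w where "w = under e \<phi>"
  define \<psi> where "\<psi> = switch \<phi> p q"
  note U = under_unique[OF l, folded w_def] and E = edgeD[OF pq]
  have st: "state \<phi>" and e: "1 \<le> e" "e \<le> 4 * k" using l by (simp_all add: pivot_def)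
  have l': "pivot e \<psi>" unfolding \<psi>_def by (rule pivot_edge[OF l pq])
  note U' = under_unique[OF l']
  have ez: "\<phi> e \<noteq> 0" and wz: "\<phi> w \<noteq> 0" using pivot_start[OF l] under_nz[OF l] by (simp_all add: w_def)
  have me: "mate (mate e) = e" using mate_pt[OF e] by simp
  have mq: "mate q \<noteq> q" "mate (mate q) = q" "mate q \<le> 4 * k" using state_mate_pt[OF st E(2)] by simp_all
  have em: "e \<noteq> mate q"
  proof
    assume a: "e = mate q"
    then have h: "height (\<phi> q) = q" "\<phi> e = mate_label (\<phi> q)"
      using state_mate[OF st E(2)] ez by (auto split: if_splits)
    have "\<phi> q = q" by (rule edge_constant_end[OF st pq h(1)])
    then have "\<phi> e = e" using h a state_bounds[OF st E(2)] by (simp add: mate_label_def)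
    then show False using exc a mq by simp
  qed
  have wm: "w \<noteq> mate q" using state_moving_mate[OF st wz _ E(2)] U(1,2) by simp
  have pm: "p \<noteq> mate q" using state_moving_mate[OF st E(3) _ E(2)] E(1,5) by simp
  have v: "\<psi> p = \<phi> q" "\<psi> q = \<phi> p" "\<And>s. s \<noteq> p \<Longrightarrow> s \<noteq> q \<Longrightarrow> s \<noteq> mate q \<Longrightarrow> \<psi> s = \<phi> s"
    using E(1) mq pm by (simp_all add: \<psi>_def switch_def)
  have S': "\<phi> e < \<phi> w" using S by (simp add: w_def)
  have "\<exists>w'. w' < e \<and> e \<le> height (\<psi> w') \<and> \<psi> e < \<psi> w'"
  proof -
    consider "p = w" "q < e" | "p = w" "e < q" | "p = w" "q = e" | "q = w" | "p = e" | "q = e" "p \<noteq> w"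
      | "w \<noteq> p" "w \<noteq> q" "e \<noteq> p" "e \<noteq> q" by linarith
    then show ?thesis
    proof cases
      case 1
      then show ?thesis using v em U(1,2) S' by (intro exI[of _ q]) simp
    next
      case 2
      have "\<not> \<phi> q < \<phi> e" using E(6)[of e] 2 U(1) S' by simp
      moreover have "\<phi> q \<noteq> \<phi> e" using state_inj[OF st E(2)] 2 by auto
      moreover have "q \<le> height (\<phi> q)" using state_bounds[OF st E(2)] by simp
      ultimately show ?thesis using v(1) v(3)[of e] em 2 U(1) by (intro exI[of _ w]) simp
    next
      case 3
      then show ?thesis using ne by (simp add: w_def)
    next
      case 4
      then show ?thesis using v(1) v(3)[of e] em U(1,2) S' E(1) by (intro exI[of _ p]) simp
    next
      case 5
      then show ?thesis using v(1) v(3)[of w] wm U(1,2) S' E(1,4) by (intro exI[of _ w]) simp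
    next
      case 6
      then show ?thesis using U(3)[of p] E(1,5) by simp
    next
      case 7
      then show ?thesis using v(3) wm em U(1,2) S' by (intro exI[of _ w]) simp
    qed
  qed
  then show ?thesis using U'(3) unfolding \<psi>_def by metis
qed

text \<open>Nothing covers the segment above the matched point, so the strand of the exceptional step has to end
  at that point, on the left.\<close>
lemma exceptional_edge_iff:
  assumes l: "pivot e \<phi>" and ee: "\<phi> e = e"
  shows "(r, mate e) \<in> edges \<phi> \<longleftrightarrow> \<phi> r = 8 * k + 1 - mate e"
proof -
  define m where "m = mate e"
  have st: "state \<phi>" and e: "1 \<le> e" "e \<le> 4 * k" using l by (simp_all add: pivot_def)
  have m: "1 \<le> m" "m \<le> 4 * k" using mate_pt[OF e] by (simp_all add: m_def)
  have he: "height e = e" using e by (simp add: height_def)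
  have mm: "\<phi> m = m" using state_mate[OF st, of e] ee e he m by (simp add: m_def mate_label_def)
  have "e \<notin> cover \<phi> e" using ee he by (simp add: cover_def)
  then have "cover \<phi> e \<subseteq> cover \<phi> (e - 1)" using e unfolding cover_def by (auto simp: le_less)
  then have "card (cover \<phi> e) \<le> card (cover \<phi> (e - 1))" by (intro card_mono finite_cover)
  then have cm: "cover \<phi> m = {}" using l by (simp add: pivot_def m_def)
  have c: "height (\<phi> s) \<le> m" if "s \<le> m" for s using cm that by (force simp: cover_def)
  show ?thesis unfolding m_def[symmetric]
  proof
    assume r: "(r, m) \<in> edges \<phi>"
    note R = edgeD[OF r]
    have "height (\<phi> r) = m" using c[of r] R(1,5) by simp
    then show "\<phi> r = 8 * k + 1 - m"
      using R(4) mm state_bounds[OF st R(3)] unfolding height_def by (simp split: if_splits)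
  next
    assume r: "\<phi> r = 8 * k + 1 - m"
    then have rz: "\<phi> r \<noteq> 0" using m by simp
    have h: "height (\<phi> r) = m" using r m by (auto simp: height_def)
    have "r \<le> m" using state_bounds[OF st rz] h by simp
    moreover have "r \<noteq> m" using r mm m by auto
    moreover have "\<not> (m < \<phi> s \<and> \<phi> s < \<phi> r)" if "s < m" for s
      using c[of s] that r m by (auto simp: height_def split: if_splits)
    ultimately show "(r, m) \<in> edges \<phi>" using h r m mm by (auto simp: edges_def)
  qed
qed

text \<open>The correction term for the state reached by the main step is the homotopy applied to the state
  reached by the exceptional step; in the sum over all steps the two cancel.\<close>
lemma homotopy_switch:
  assumes l: "pivot e \<phi>" and S: "\<phi> e < \<phi> (under e \<phi>)"
  shows "homotopy_at e (switch \<phi> (under e \<phi>) e) =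
    basis \<phi> + (if \<phi> e = e then \<Sum>r | \<phi> r = 8 * k + 1 - mate e. homotopy_at e (switch \<phi> r (mate e)) else 0)"
proof -
  define w where "w = under e \<phi>"
  define m where "m = mate e"
  define t where "t = switch \<phi> w e"
  note U = under_unique[OF l, folded w_def]
  have S': "\<phi> e < \<phi> w" using S by (simp add: w_def)
  have st: "state \<phi>" and e: "1 \<le> e" "e \<le> 4 * k" using l by (simp_all add: pivot_def)
  have ez: "\<phi> e \<noteq> 0" and wz: "\<phi> w \<noteq> 0" using pivot_start[OF l] under_nz[OF l] by (simp_all add: w_def)
  have m: "1 \<le> m" "m \<le> 4 * k" "m \<noteq> e" "mate m = e" using mate_pt[OF e] by (simp_all add: m_def)
  have wm: "w \<noteq> m" using state_moving_mate[OF st wz _ ez] U(1,2) by (simp add: m_def)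
  have lt: "pivot e t" unfolding t_def by (rule pivot_switch[OF l ez wz U(1,2)])
  note Ut = under_unique[OF lt]
  have tv: "t w = \<phi> e" "t e = \<phi> w" "\<And>s. s \<noteq> w \<Longrightarrow> s \<noteq> e \<Longrightarrow> s \<noteq> m \<Longrightarrow> t s = \<phi> s"
    "t m = (if height (\<phi> w) = e then mate_label (\<phi> w) else 0)"
    using U(1) m(3) wm by (simp_all add: t_def switch_def m_def)
  have "e \<le> height (t w)" using tv state_bounds[OF st ez] by simp
  then have ut: "under e t = w" by (rule Ut(3)[OF U(1)])
  have tw: "switch t w e = \<phi>" unfolding t_def by (rule switch_switch[OF st ez wz U(1,2)])
  have h: "homotopy_at e t = basis \<phi> + (if \<phi> e = e then
      \<Sum>r | r \<noteq> m \<and> t r = 8 * k + 1 - m. basis (t(r := m, w := 8 * k + 1 - e)) else 0)"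
    using tv S' by (simp add: homotopy_at_def Let_def ut tw m_def)
  have "(\<Sum>r | r \<noteq> m \<and> t r = 8 * k + 1 - m. basis (t(r := m, w := 8 * k + 1 - e))) =
      (\<Sum>r | \<phi> r = 8 * k + 1 - m. homotopy_at e (switch \<phi> r m))" if ee: "\<phi> e = e"
  proof (cases "\<exists>r. \<phi> r = 8 * k + 1 - m")
    case True
    then obtain r where r: "\<phi> r = 8 * k + 1 - m" by blast
    have rz: "\<phi> r \<noteq> 0" using r m by simp
    have he: "height e = e" using e by (simp add: height_def)
    have mm: "\<phi> m = m" using state_mate[OF st ez] ee e he by (simp add: m_def mate_label_def)
    have rm: "r \<noteq> m" using r mm m by auto
    have re: "r \<noteq> e" using r ee e m by auto
    have edge: "(r, m) \<in> edges \<phi>" using exceptional_edge_iff[OF l ee] r by (simp add: m_def)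
    have all: "{r. \<phi> r = 8 * k + 1 - m} = {r}"
    proof -
      have "\<phi> s = 8 * k + 1 - m \<longleftrightarrow> s = r" for s using state_inj[OF st rz, of s] r by metis
      then show ?thesis by simp
    qed
    have hw: "height (\<phi> w) \<noteq> e"
    proof
      assume a: "height (\<phi> w) = e"
      then have "\<phi> w = 8 * k + 1 - e" using S' ee state_bounds[OF st wz] unfolding height_def by (simp split: if_splits)
      then have "\<phi> r = mate_label (\<phi> w)" using r left_label(1)[OF e] by (simp only: m_def)
      then have "w = height (\<phi> w)" by (rule state_end[OF st wz])
      then show False using U(1,2) by simp
    qed
    define t2 where "t2 = switch \<phi> r m"
    have l2: "pivot e t2" unfolding t2_def by (rule pivot_edge[OF l edge])
    have st2: "state t2" using l2 by (simp add: pivot_def)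
    have hm: "height (8 * k + 1 - m) = m" using m by (simp add: height_def)
    have t2v: "t2 r = m" "t2 m = 8 * k + 1 - m" "t2 e = 8 * k + 1 - e"
      "\<And>s. s \<noteq> r \<Longrightarrow> s \<noteq> m \<Longrightarrow> s \<noteq> e \<Longrightarrow> t2 s = \<phi> s"
      using rm re m r mm hm left_label(1)[OF m(1,2)] by (simp_all add: t2_def switch_def)
    have h2w: "e \<le> height (t2 w)"
    proof (cases "w = r")
      case True
      then have "height (\<phi> w) = m" using r hm by simp
      then show ?thesis using True t2v(1) U(2) m by (simp add: height_def)
    next
      case False
      then show ?thesis using t2v(4)[of w] wm U(1,2) by simp
    qed
    then have u2: "under e t2 = w" by (rule under_unique(3)[OF l2 U(1)])
    have h2n: "height (t2 w) \<noteq> e"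
      using hw t2v(1) t2v(4)[of w] wm U(1) m by (cases "w = r") (auto simp: height_def)
    have w2z: "t2 w \<noteq> 0" using h2w e height_0 by (metis le_zero_eq not_one_le_zero)
    have lt2: "t2 w < t2 e"
      using h2w h2n state_bounds[OF st2 w2z] e unfolding t2v(3) height_def by (simp split: if_splits)
    have n2: "t2 w \<noteq> e" using h2n he by metis
    have hom2: "homotopy_at e t2 = basis (switch t2 w e)" using lt2 n2 by (simp add: homotopy_at_def Let_def u2)
    \<comment> \<open>the left strand ending at the matched point; if it is the strand over the pivot, it starts at
      \<open>e\<close> after the switch\<close>
    define r' where "r' = (if r = w then e else r)"
    have tr': "t r' = 8 * k + 1 - m" using r tv(2) tv(3)[of r] rm re by (cases "r = w") (simp_all add: r'_def)
    have stt: "state t" using lt by (simp add: pivot_def)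
    have r'm: "r' \<noteq> m" using rm m by (simp add: r'_def)
    have all': "{r. r \<noteq> m \<and> t r = 8 * k + 1 - m} = {r'}"
    proof -
      have "t r' \<noteq> 0" using tr' m by simp
      then have "t s = 8 * k + 1 - m \<longleftrightarrow> s = r'" for s using state_inj[OF stt] tr' by metis
      then show ?thesis using r'm by auto
    qed
    have "switch t2 w e = t(r' := m, w := 8 * k + 1 - e)"
    proof
      fix s
      have tm: "t m = 0" using tv(4) hw by simp
      show "switch t2 w e s = (t(r' := m, w := 8 * k + 1 - e)) s"
        using tv(1-3) tm t2v h2n rm re wm U(1) m(3) unfolding switch_def m_def[symmetric] r'_def
        by (cases "r = w") simp_all
    qed
    then show ?thesis unfolding all all' using hom2 by (simp add: t2_def)
  next
    case False
    have "t r \<noteq> 8 * k + 1 - m" if "r \<noteq> m" for r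
    proof -
      have "t r \<in> range \<phi>" using tv(1-3) that by (cases "r = w"; cases "r = e") auto
      then show ?thesis using False by auto
    qed
    then have "{r. r \<noteq> m \<and> t r = 8 * k + 1 - m} = {}" "{r. \<phi> r = 8 * k + 1 - m} = {}"
      using False by auto
    then show ?thesis by (simp only: sum.empty)
  qed
  then show ?thesis using h by (simp add: t_def w_def m_def)
qed

lemma homotopy_boundary:
  assumes l: "pivot e \<phi>" and S: "\<phi> e < \<phi> (under e \<phi>)"
  shows "lin (homotopy_at e) (boundary \<phi>) = basis \<phi>"
proof -
  define w where "w = under e \<phi>"
  define X where "X = {(r, m). \<phi> e = e \<and> m = mate e \<and> \<phi> r = 8 * k + 1 - m}"
  have st: "state \<phi>" and e: "1 \<le> e" "e \<le> 4 * k" using l by (simp_all add: pivot_def)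
  have m: "mate e \<noteq> e" using mate_pt[OF e] by simp
  have Xe: "X \<subseteq> edges \<phi>" using exceptional_edge_iff[OF l] by (auto simp: X_def)
  have we: "(w, e) \<in> edges \<phi>" unfolding w_def by (rule pivot_edge_mem[OF l S])
  have fin: "finite (edges \<phi>)" by (rule finite_edges[OF st])
  have z: "homotopy_at e (switch \<phi> p q) = 0" if pq: "(p, q) \<in> edges \<phi> - ({(w, e)} \<union> X)" for p q
  proof (rule homotopy_crossed)
    have "(p, q) \<in> edges \<phi>" "(p, q) \<noteq> (under e \<phi>, e)" "\<not> (\<phi> e = e \<and> q = mate e)"
      using pq exceptional_edge_iff[OF l, of p] by (auto simp: X_def w_def)
    then show "pivot e (switch \<phi> p q)" "switch \<phi> p q e < switch \<phi> p q (under e (switch \<phi> p q))"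
      using pivot_edge[OF l] edge_keeps_crossed[OF l S] by blast+
  qed
  have "lin (homotopy_at e) (boundary \<phi>) = (\<Sum>(p, q)\<in>edges \<phi>. homotopy_at e (switch \<phi> p q))"
    unfolding boundary_def lin_sum by (simp add: case_prod_beta)
  also have "\<dots> = (\<Sum>(p, q)\<in>{(w, e)} \<union> X. homotopy_at e (switch \<phi> p q))"
    by (rule sum.mono_neutral_right) (use fin Xe we z in auto)
  also have "\<dots> = homotopy_at e (switch \<phi> w e) + (\<Sum>(p, q)\<in>X. homotopy_at e (switch \<phi> p q))"
    using m finite_subset[OF Xe fin] by (subst sum.union_disjoint) (auto simp: X_def)
  also have "(\<Sum>(p, q)\<in>X. homotopy_at e (switch \<phi> p q)) =
      (if \<phi> e = e then \<Sum>r | \<phi> r = 8 * k + 1 - mate e. homotopy_at e (switch \<phi> r (mate e)) else 0)"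
  proof (cases "\<phi> e = e")
    case True
    have "X = (\<lambda>r. (r, mate e)) ` {r. \<phi> r = 8 * k + 1 - mate e}" using True by (auto simp: X_def)
    then show ?thesis using True by (simp add: sum.reindex inj_on_def)
  next
    case False
    then have "X = {}" by (simp add: X_def)
    then show ?thesis using False by simp
  qed
  finally show ?thesis using homotopy_switch[OF l S] by (simp add: w_def add.assoc)
qed

definition defect :: "nat \<Rightarrow> (nat \<Rightarrow> nat) \<Rightarrow> (nat \<Rightarrow> nat) f2span" where
  "defect e \<phi> = lin boundary (homotopy_at e \<phi>) + lin (homotopy_at e) (boundary \<phi>) + basis \<phi>"

lemma lin_defect: "lin (defect e) x = lin boundary (lin (homotopy_at e) x) + lin (homotopy_at e) (lin boundary x) + x"
  unfolding defect_def[abs_def] lin_plus_map by (simp add: lin_lin lin_basis_id)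

lemma defect_crossed:
  assumes "pivot e \<phi>" "\<phi> e < \<phi> (under e \<phi>)"
  shows "defect e \<phi> = 0"
  using assms by (simp add: defect_def homotopy_crossed homotopy_boundary)

text \<open>The place where the vanishing of the square of the boundary enters.\<close>
lemma defect_boundary_crossed:
  assumes "pivot e \<phi>" "\<phi> e < \<phi> (under e \<phi>)"
  shows "lin (defect e) (boundary \<phi>) = 0"
proof -
  have "state \<phi>" using assms(1) by (simp add: pivot_def)
  then show ?thesis using homotopy_boundary[OF assms] boundary_boundary by (simp add: lin_defect boundary_def[symmetric])
qed

text \<open>In the vanishing sum of the defects over the boundary of a crossed state, the main step contributes
  the only term that is not known to be zero.\<close>
lemma defect_uncrossed_aux:
  assumes l: "pivot e \<phi>" and S: "\<phi> e < \<phi> (under e \<phi>)"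
    and z: "\<And>r. \<phi> e = e \<Longrightarrow> \<phi> r = 8 * k + 1 - mate e \<Longrightarrow> defect e (switch \<phi> r (mate e)) = 0"
  shows "defect e (switch \<phi> (under e \<phi>) e) = 0"
proof -
  have st: "state \<phi>" using l by (simp add: pivot_def)
  have we: "(under e \<phi>, e) \<in> edges \<phi>" by (rule pivot_edge_mem[OF l S])
  have "0 = (\<Sum>(p, q)\<in>edges \<phi>. defect e (switch \<phi> p q))"
    using defect_boundary_crossed[OF l S] unfolding boundary_def lin_sum by (simp add: case_prod_beta)
  also have "\<dots> = (\<Sum>(p, q)\<in>{(under e \<phi>, e)}. defect e (switch \<phi> p q))"
  proof (rule sum.mono_neutral_right[OF finite_edges[OF st]])
    show "{(under e \<phi>, e)} \<subseteq> edges \<phi>" using we by simp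
    show "\<forall>i\<in>edges \<phi> - {(under e \<phi>, e)}. (case i of (p, q) \<Rightarrow> defect e (switch \<phi> p q)) = 0"
    proof
      fix i assume "i \<in> edges \<phi> - {(under e \<phi>, e)}"
      then obtain p q where i: "i = (p, q)" and pq: "(p, q) \<in> edges \<phi>" "(p, q) \<noteq> (under e \<phi>, e)"
        by (cases i) auto
      have "defect e (switch \<phi> p q) = 0"
      proof (cases "\<phi> e = e \<and> q = mate e")
        case True
        then show ?thesis using z exceptional_edge_iff[OF l] pq by blast
      next
        case False
        then show ?thesis using edge_keeps_crossed[OF l S pq(1)] pq pivot_edge[OF l pq(1)]
          by (intro defect_crossed) auto
      qed
      then show "(case i of (p, q) \<Rightarrow> defect e (switch \<phi> p q)) = 0" using i by simp
    qed
  qed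
  finally show ?thesis by simp
qed

text \<open>Every uncrossed state is reached by the main step from a crossed one.\<close>
lemma under_switch:
  assumes l: "pivot e t" and T: "t (under e t) < t e"
  shows "pivot e (switch t (under e t) e)" "under e (switch t (under e t) e) = under e t"
    "switch t (under e t) e (under e t) = t e" "switch t (under e t) e e = t (under e t)"
    "switch (switch t (under e t) e) (under e t) e = t"
proof -
  define w where "w = under e t"
  note U = under_unique[OF l, folded w_def]
  have st: "state t" and e: "1 \<le> e" "e \<le> 4 * k" using l by (simp_all add: pivot_def)
  have ez: "t e \<noteq> 0" and wz: "t w \<noteq> 0" using pivot_start[OF l] under_nz[OF l] by (simp_all add: w_def)
  have wm: "w \<noteq> mate e" using state_moving_mate[OF st wz _ ez] U(1,2) by simp
  have v: "switch t w e w = t e" "switch t w e e = t w" using U(1) wm mate_pt[OF e] by (simp_all add: switch_def)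
  have p: "pivot e (switch t w e)" by (rule pivot_switch[OF l ez wz U(1,2)])
  have "e \<le> height (switch t w e w)" using v state_bounds[OF st ez] by simp
  then have "under e (switch t w e) = w" by (rule under_unique(3)[OF p U(1)])
  then show "pivot e (switch t (under e t) e)" "under e (switch t (under e t) e) = under e t"
    "switch t (under e t) e (under e t) = t e" "switch t (under e t) e e = t (under e t)"
    "switch (switch t (under e t) e) (under e t) e = t"
    using p v switch_switch[OF st ez wz U(1,2)] by (simp_all add: w_def)
qed

text \<open>The exceptional step leads to a state whose own crossed partner has no exceptional step. Applying
  \<open>defect_uncrossed_aux\<close> to that state first removes the remaining hypothesis.\<close>
theorem defect_zero:
  assumes l: "pivot e t"
  shows "defect e t = 0"
proof -
  have nontrivial: "defect e t = 0" if l: "pivot e t" and T: "t (under e t) < t e"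
    and z: "\<And>r. t (under e t) = e \<Longrightarrow> switch t (under e t) e r = 8 * k + 1 - mate e \<Longrightarrow>
      defect e (switch (switch t (under e t) e) r (mate e)) = 0" for t
    using defect_uncrossed_aux[OF under_switch(1)[OF l T]] under_switch[OF l T] T z by simp
  show ?thesis
  proof (cases "t e < t (under e t)")
    case True
    then show ?thesis by (rule defect_crossed[OF l])
  next
    case False
    have st: "state t" using l by (simp add: pivot_def)
    have "t e \<noteq> t (under e t)"
      using state_inj[OF st pivot_start[OF l], of "under e t"] under_unique(1)[OF l] by auto
    then have T: "t (under e t) < t e" using False by simp
    show ?thesis
    proof (rule nontrivial[OF l T])
      fix r assume r: "t (under e t) = e" "switch t (under e t) e r = 8 * k + 1 - mate e"
      define \<phi> where "\<phi> = switch t (under e t) e"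
      note P = under_switch[OF l T, folded \<phi>_def]
      have ee: "\<phi> e = e" using P r by simp
      have r2: "\<phi> r = 8 * k + 1 - mate e" using r(2) by (simp only: \<phi>_def)
      have rr: "(r, mate e) \<in> edges \<phi>" using exceptional_edge_iff[OF P(1) ee] r by (simp add: \<phi>_def)
      \<comment> \<open>in the state after the exceptional step the label \<open>e\<close> is gone, so there is no second exception\<close>
      define t2 where "t2 = switch \<phi> r (mate e)"
      have l2: "pivot e t2" unfolding t2_def by (rule pivot_edge[OF P(1) rr])
      have e: "1 \<le> e" "e \<le> 4 * k" using l by (simp_all add: pivot_def)
      note m = mate_pt[OF e]
      have st2: "state t2" using l2 by (simp add: pivot_def)
      have mm: "\<phi> (mate e) = mate e"
        using state_mate[of \<phi> e] P(1) ee e by (simp add: pivot_def height_def mate_label_def)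
      have t2e: "t2 e = 8 * k + 1 - e"
        using r2 m left_label[of "mate e"] by (simp add: t2_def switch_def)
      show "defect e (switch (switch t (under e t) e) r (mate e)) = 0"
        unfolding \<phi>_def[symmetric] t2_def[symmetric]
      proof (cases "t2 e < t2 (under e t2)")
        case True
        then show "defect e t2 = 0" by (rule defect_crossed[OF l2])
      next
        case False
        have "t2 e \<noteq> t2 (under e t2)"
          using state_inj[OF st2 pivot_start[OF l2], of "under e t2"] under_unique(1)[OF l2] by auto
        then have T2: "t2 (under e t2) < t2 e" using False by simp
        have "t2 (under e t2) \<noteq> e"
        proof
          assume a: "t2 (under e t2) = e"
          define u where "u = under e t2"
          have ue: "u < e" using under_unique(1)[OF l2] by (simp add: u_def)
          have "r < mate e" by (rule edgeD(1)[OF rr])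
          moreover have "r \<noteq> e" using r2 ee e m by auto
          ultimately have v: "t2 r = mate e" "t2 (mate e) = 8 * k + 1 - mate e"
            "\<And>s. s \<noteq> r \<Longrightarrow> s \<noteq> mate e \<Longrightarrow> s \<noteq> e \<Longrightarrow> t2 s = \<phi> s"
            using r2 m mm by (simp_all add: t2_def switch_def)
          have "u \<noteq> r" "u \<noteq> mate e" using a v(1,2) m e by (auto simp: u_def)
          then have "\<phi> u = \<phi> e" using a v(3)[of u] ue ee by (simp add: u_def)
          then show False using state_inj[of \<phi> e u] P(1) ee e ue by (auto simp: pivot_def)
        qed
        then show "defect e t2 = 0" by (intro nontrivial[OF l2 T2]) simp
      qed
    qed
  qed
qed

section \<open>Generators and their resolutions\<close>

lemma gens_finite: "finite gens"
proof -
  have "chords \<subseteq> points \<times> points" by (auto simp: chords_def)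
  then have "finite chords" by (rule finite_subset) (simp add: points_def)
  moreover have "finite pairs" by (simp add: pairs_def points_def)
  ultimately have "finite ((\<lambda>(V, h). Gen V h) ` (Pow chords \<times> Pow pairs))" by simp
  moreover have "gens \<subseteq> (\<lambda>(V, h). Gen V h) ` (Pow chords \<times> Pow pairs)"
  proof
    fix a assume "a \<in> gens"
    then have "(mov a, dh a) \<in> Pow chords \<times> Pow pairs" by (simp add: gens_def)
    then show "a \<in> (\<lambda>(V, h). Gen V h) ` (Pow chords \<times> Pow pairs)" by (rule rev_image_eqI) simp
  qed
  ultimately show ?thesis by (rule finite_subset[rotated])
qed

lemma pair_mate: "i \<in> points \<Longrightarrow> pair (mate i) = pair i"
  using mate_mate[of i] by (auto simp: pair_def points_def)

lemma pair_eq_iff: "i \<in> points \<Longrightarrow> j \<in> points \<Longrightarrow> pair i = pair j \<longleftrightarrow> j = i \<or> j = mate i"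
  using mate_mate[of i] mate_mate[of j] by (auto simp: pair_def points_def doubleton_eq_iff)

lemma mate_points: "i \<in> points \<Longrightarrow> mate i \<in> points \<and> mate i \<noteq> i \<and> mate (mate i) = i"
  using mate_pt[of i] by (simp add: points_def)

lemma in_pair_iff: "P \<in> pairs \<Longrightarrow> c \<in> P \<longleftrightarrow> c \<in> points \<and> P = pair c"
  using mate_points pair_mate by (auto simp: pairs_def pair_def)

text \<open>One of the bijections whose sum is the generator \<open>a\<close>.\<close>
definition resolved :: "gen \<Rightarrow> nat set \<Rightarrow> strands" where
  "resolved a C = mov a \<union> Id_on C"

context
  fixes a assumes a: "a \<in> gens"
begin

lemma mov_chord: "(s, t) \<in> mov a \<Longrightarrow> s \<in> points \<and> t \<in> points \<and> s < t"
  using a by (auto simp: gens_def chords_def)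

lemma dh_pairs: "P \<in> dh a \<Longrightarrow> P \<in> pairs"
  using a by (auto simp: gens_def)

lemma mov_start: "(s, t) \<in> mov a \<Longrightarrow> (s', t') \<in> mov a \<Longrightarrow> pair s = pair s' \<Longrightarrow> s = s' \<and> t = t'"
  using a inj_onD[of "(\<lambda>(s, t). pair s)" "mov a" "(s, t)" "(s', t')"] by (simp add: gens_def)

lemma mov_end: "(s, t) \<in> mov a \<Longrightarrow> (s', t') \<in> mov a \<Longrightarrow> pair t = pair t' \<Longrightarrow> s = s' \<and> t = t'"
  using a inj_onD[of "(\<lambda>(s, t). pair t)" "mov a" "(s, t)" "(s', t')"] by (simp add: gens_def)

lemma dh_mov: "P \<in> dh a \<Longrightarrow> (s, t) \<in> mov a \<Longrightarrow> s \<notin> P \<and> t \<notin> P"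
  using a unfolding gens_def by fast

lemma dh_iff: "c \<in> \<Union>(dh a) \<longleftrightarrow> c \<in> points \<and> pair c \<in> dh a"
  using dh_pairs in_pair_iff by (metis UnionE UnionI insertI1 pair_def)

lemma finite_mov: "finite (mov a)"
  by (rule finite_subset[of _ "points \<times> points"]) (use mov_chord in \<open>auto simp: points_def\<close>)

lemma choice_points: "C \<in> choices (dh a) \<Longrightarrow> C \<subseteq> points"
  using dh_iff unfolding choices_def by blast

lemma finite_choices: "finite (choices (dh a))"
proof (rule finite_subset)
  show "choices (dh a) \<subseteq> Pow points" using choice_points by blast
qed (simp add: points_def)

text \<open>A point-wise form of the choice of one point from each pair, in which adding or removing a pair is
  easy to follow.\<close>
lemma choices_iff:
  "C \<in> choices (dh a) \<longleftrightarrow> (\<forall>c\<in>C. c \<in> points \<and> pair c \<in> dh a \<and> mate c \<notin> C) \<and>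
     (\<forall>c\<in>points. pair c \<in> dh a \<longrightarrow> c \<in> C \<or> mate c \<in> C)"
  (is "_ \<longleftrightarrow> ?R")
proof -
  have P: "(\<exists>!c. c \<in> P \<and> c \<in> C) \<longleftrightarrow> (\<forall>c\<in>points. P = pair c \<longrightarrow> (c \<in> C) \<noteq> (mate c \<in> C))" if Pd: "P \<in> dh a" for P
  proof -
    obtain c where c: "c \<in> points" "P = pair c" using dh_pairs[OF Pd] by (auto simp: pairs_def)
    have L: "(\<exists>!c. c \<in> P \<and> c \<in> C) \<longleftrightarrow> (c \<in> C) \<noteq> (mate c \<in> C)"
      unfolding c(2) pair_def using mate_points[OF c(1)] by auto
    have R: "(c' \<in> C) \<noteq> (mate c' \<in> C) \<longleftrightarrow> (c \<in> C) \<noteq> (mate c \<in> C)" if c': "c' \<in> points" "P = pair c'" for c'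
    proof -
      have "c' = c \<or> c' = mate c" using pair_eq_iff[OF c(1) c'(1)] c(2) c'(2) by metis
      then show ?thesis using mate_points[OF c(1)] by metis
    qed
    show ?thesis
    proof
      assume "\<exists>!c. c \<in> P \<and> c \<in> C"
      then show "\<forall>c\<in>points. P = pair c \<longrightarrow> (c \<in> C) \<noteq> (mate c \<in> C)" using L R by simp
    next
      assume "\<forall>c\<in>points. P = pair c \<longrightarrow> (c \<in> C) \<noteq> (mate c \<in> C)"
      then have "(c \<in> C) \<noteq> (mate c \<in> C)" using c by simp
      then show "\<exists>!c. c \<in> P \<and> c \<in> C" using L by simp
    qed
  qed
  have "C \<in> choices (dh a) \<longleftrightarrow> C \<subseteq> \<Union>(dh a) \<and>
      (\<forall>P\<in>dh a. \<forall>c\<in>points. P = pair c \<longrightarrow> (c \<in> C) \<noteq> (mate c \<in> C))"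
    unfolding choices_def mem_Collect_eq using P by (simp cong: ball_cong)
  also have "\<dots> \<longleftrightarrow> (\<forall>c\<in>C. c \<in> points \<and> pair c \<in> dh a) \<and>
      (\<forall>c\<in>points. pair c \<in> dh a \<longrightarrow> (c \<in> C) \<noteq> (mate c \<in> C))"
    unfolding subset_iff dh_iff by blast
  also have "\<dots> \<longleftrightarrow> ?R" by blast
  finally show ?thesis .
qed

lemma choice_exists: "\<exists>C. C \<in> choices (dh a)"
proof -
  define C where "C = {c \<in> points. pair c \<in> dh a \<and> c < mate c}"
  have "C \<in> choices (dh a)"
    unfolding choices_iff C_def using mate_points pair_mate by (auto, metis nat_neq_iff)
  then show ?thesis by blast
qed

lemma mov_resolved: "mov a = {(s, t) \<in> resolved a C. s \<noteq> t}"
  using mov_chord by (auto simp: resolved_def)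

lemma choice_resolved: "C = {c. (c, c) \<in> resolved a C}"
  using mov_chord by (auto simp: resolved_def)

end

section \<open>The differential of the algebra on generators\<close>

lemma emb_resolved: "emb a = (\<Sum>C\<in>choices (dh a). basis (resolved a C))"
  by (simp add: emb_def resolved_def)

lemma dh_choice:
  assumes a: "a \<in> gens" and C: "C \<in> choices (dh a)"
  shows "dh a = pair ` C"
proof (intro equalityI subsetI)
  fix P assume P: "P \<in> dh a"
  then obtain c where c: "c \<in> points" "P = pair c" using dh_pairs[OF a] by (auto simp: pairs_def)
  then have "c \<in> C \<or> mate c \<in> C" using C P by (simp add: choices_iff[OF a])
  then show "P \<in> pair ` C" using c pair_mate[OF c(1)] by (metis imageI)
next
  fix P assume "P \<in> pair ` C"
  then show "P \<in> dh a" using C by (auto simp: choices_iff[OF a])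
qed

lemma resolved_inj:
  assumes a: "a \<in> gens" "C \<in> choices (dh a)" and b: "b \<in> gens" "D \<in> choices (dh b)"
    and eq: "resolved a C = resolved b D"
  shows "a = b \<and> C = D"
proof -
  have "C = D" using choice_resolved[OF a(1), of C] choice_resolved[OF b(1), of D] eq by metis
  moreover have "mov a = mov b" using mov_resolved[OF a(1), of C] mov_resolved[OF b(1), of D] eq by metis
  moreover have "dh a = dh b" using dh_choice[OF a] dh_choice[OF b] \<open>C = D\<close> by simp
  ultimately show ?thesis by (simp add: gen.expand)
qed

lemma lookup_emb:
  assumes a: "a \<in> gens" and b: "b \<in> gens" "C \<in> choices (dh b)"
  shows "Poly_Mapping.lookup (emb a) (resolved b C) = (if a = b then 1 else (0::bit))"
proof -
  have "Poly_Mapping.lookup (emb a) (resolved b C) =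
      (\<Sum>D\<in>choices (dh a). if D = C \<and> a = b then 1 else 0)"
    unfolding emb_resolved lookup_sum lookup_single when_def
    by (rule sum.cong[OF refl]) (use resolved_inj[OF a _ b] in auto)
  also have "\<dots> = (if a = b then 1 else 0)"
    using b finite_choices[OF a] by auto
  finally show ?thesis .
qed

text \<open>A generator can be read off from any one of its resolutions, because the supports are disjoint.\<close>
lemma lookup_sum_emb:
  assumes B: "B \<subseteq> gens" and b: "b \<in> gens" "C \<in> choices (dh b)"
  shows "Poly_Mapping.lookup (\<Sum>a\<in>B. emb a) (resolved b C) = (if b \<in> B then 1 else (0::bit))"
proof -
  have "Poly_Mapping.lookup (\<Sum>a\<in>B. emb a) (resolved b C) = (\<Sum>a\<in>B. if a = b then 1 else (0::bit))"
    unfolding lookup_sum by (rule sum.cong[OF refl]) (use lookup_emb[OF _ b] B in auto)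
  then show ?thesis using finite_subset[OF B gens_finite] by simp
qed

text \<open>The expansion in generators is unique, so one expansion decides which generators occur.\<close>
lemma occurs_in_sum:
  assumes B: "B \<subseteq> gens"
  shows "occurs_in b (\<Sum>a\<in>B. emb a) \<longleftrightarrow> b \<in> B"
proof
  assume "occurs_in b (\<Sum>a\<in>B. emb a)"
  then obtain B' where B': "B' \<subseteq> gens" "(\<Sum>a\<in>B. emb a) = (\<Sum>a\<in>B'. emb a)" "b \<in> B'"
    by (auto simp: occurs_in_def)
  then have b: "b \<in> gens" by blast
  obtain C where C: "C \<in> choices (dh b)" using choice_exists[OF b] by blast
  show "b \<in> B"
    using lookup_sum_emb[OF B b C] lookup_sum_emb[OF B'(1) b C] B'(2,3) by (auto split: if_splits)
qed (use B in \<open>auto simp: occurs_in_def\<close>)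

lemma emb_inj: "a \<in> gens \<Longrightarrow> b \<in> gens \<Longrightarrow> emb a = emb b \<Longrightarrow> a = b"
  using occurs_in_sum[of "{a}" b] occurs_in_sum[of "{b}" b] by simp

lemma emb_nonzero: "a \<in> gens \<Longrightarrow> emb a \<noteq> 0"
  using occurs_in_sum[of "{a}" a] occurs_in_sum[of "{}" a] by auto

lemma gensI:
  assumes "\<And>s t. (s, t) \<in> mov a \<Longrightarrow> s \<in> points \<and> t \<in> points \<and> s < t"
    and "\<And>s t s' t'. (s, t) \<in> mov a \<Longrightarrow> (s', t') \<in> mov a \<Longrightarrow> pair s = pair s' \<Longrightarrow> (s, t) = (s', t')"
    and "\<And>s t s' t'. (s, t) \<in> mov a \<Longrightarrow> (s', t') \<in> mov a \<Longrightarrow> pair t = pair t' \<Longrightarrow> (s, t) = (s', t')"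
    and "dh a \<subseteq> pairs"
    and "\<And>P s t. P \<in> dh a \<Longrightarrow> (s, t) \<in> mov a \<Longrightarrow> s \<notin> P \<and> t \<notin> P"
  shows "a \<in> gens"
  unfolding gens_def mem_Collect_eq
proof (intro conjI)
  show "mov a \<subseteq> chords" using assms(1) by (auto simp: chords_def)
  show "inj_on (\<lambda>(s, t). pair s) (mov a)"
    by (rule inj_onI) (use assms(2) in \<open>auto split: prod.splits\<close>)
  show "inj_on (\<lambda>(s, t). pair t) (mov a)"
    by (rule inj_onI) (use assms(3) in \<open>auto split: prod.splits\<close>)
  show "dh a \<subseteq> pairs" by (rule assms(4))
  show "\<forall>P\<in>dh a. \<forall>(s, t)\<in>mov a. s \<notin> P \<and> t \<notin> P" using assms(5) by blast
qed

lemma pair_self: "i \<in> pair i"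
  by (simp add: pair_def)

text \<open>The second strand may be a constant one, standing for a double horizontal, which is then opened.\<close>
fun uncrossed :: "gen \<Rightarrow> (nat \<times> nat) \<times> (nat \<times> nat) \<Rightarrow> gen" where
  "uncrossed a ((s, t), (s', t')) =
     Gen (mov a - {(s, t), (s', t')} \<union> {(s, t'), (s', t)}) (dh a - (if s' = t' then {pair s'} else {}))"

definition uncrossable :: "gen \<Rightarrow> ((nat \<times> nat) \<times> (nat \<times> nat)) set" where
  "uncrossable a = {((s, t), (s', t')). (s, t) \<in> mov a \<and>
     ((s', t') \<in> mov a \<or> s' = t' \<and> s' \<in> points \<and> pair s' \<in> dh a) \<and> s < s' \<and> t' < t \<and>
     (\<forall>(x, y)\<in>mov a. \<not> (s < x \<and> x < s' \<and> t' < y \<and> y < t))}"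

context
  fixes a s t s' t' assumes a: "a \<in> gens" and u: "((s, t), (s', t')) \<in> uncrossable a"
begin

lemma uncrossable_facts:
  shows "(s, t) \<in> mov a" "s < s'" "t' < t" "s' \<le> t'" "s \<in> points" "t \<in> points" "s' \<in> points" "t' \<in> points"
    "(s', t') \<in> mov a \<or> s' = t' \<and> pair s' \<in> dh a" "pair s \<noteq> pair s'" "pair t \<noteq> pair t'"
proof -
  show m: "(s, t) \<in> mov a" and c: "s < s'" "t' < t" and d: "(s', t') \<in> mov a \<or> s' = t' \<and> pair s' \<in> dh a"
    using u by (auto simp: uncrossable_def)
  show "s \<in> points" "t \<in> points" using mov_chord[OF a m] by auto
  show "s' \<in> points" "t' \<in> points" "s' \<le> t'" using u mov_chord[OF a, of s' t'] by (auto simp: uncrossable_def)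
  have "s \<notin> pair s' \<and> t \<notin> pair s'" if "pair s' \<in> dh a" using dh_mov[OF a that m] .
  then show "pair s \<noteq> pair s'" "pair t \<noteq> pair t'"
    using d mov_start[OF a m, of s' t'] mov_end[OF a m, of s' t'] c pair_self[of s] pair_self[of t]
    by (metis nat_neq_iff)+
qed

lemma uncrossable_old:
  assumes o: "(x, y) \<in> mov a" "(x, y) \<noteq> (s, t)" "(x, y) \<noteq> (s', t')"
  shows "pair x \<noteq> pair s" "pair x \<noteq> pair s'" "pair y \<noteq> pair t" "pair y \<noteq> pair t'"
proof -
  note F = uncrossable_facts
  have d: "x \<notin> pair s' \<and> y \<notin> pair s'" if "pair s' \<in> dh a" using dh_mov[OF a that o(1)] .
  show "pair x \<noteq> pair s" "pair y \<noteq> pair t" using mov_start[OF a o(1) F(1)] mov_end[OF a o(1) F(1)] o(2) by auto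
  show "pair x \<noteq> pair s'" "pair y \<noteq> pair t'"
    using mov_start[OF a o(1), of s' t'] mov_end[OF a o(1), of s' t'] o(3) F(9) d pair_self[of x] pair_self[of y]
    by metis+
qed

lemma uncrossed_gens: "uncrossed a ((s, t), (s', t')) \<in> gens"
proof (rule gensI; unfold uncrossed.simps gen.sel)
  note F = uncrossable_facts and O = uncrossable_old
  fix x y assume "(x, y) \<in> mov a - {(s, t), (s', t')} \<union> {(s, t'), (s', t)}"
  then show "x \<in> points \<and> y \<in> points \<and> x < y"
    using mov_chord[OF a] F(2-8) by auto
next
  note F = uncrossable_facts and O = uncrossable_old
  fix x y x' y'
  assume x: "(x, y) \<in> mov a - {(s, t), (s', t')} \<union> {(s, t'), (s', t)}"
    "(x', y') \<in> mov a - {(s, t), (s', t')} \<union> {(s, t'), (s', t)}"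
  then consider "(x, y) \<in> mov a" "(x, y) \<noteq> (s, t)" "(x, y) \<noteq> (s', t')" "(x', y') \<in> mov a" "(x', y') \<noteq> (s, t)" "(x', y') \<noteq> (s', t')"
    | "(x, y) \<in> mov a" "(x, y) \<noteq> (s, t)" "(x, y) \<noteq> (s', t')" "(x', y') = (s, t') \<or> (x', y') = (s', t)"
    | "(x', y') \<in> mov a" "(x', y') \<noteq> (s, t)" "(x', y') \<noteq> (s', t')" "(x, y) = (s, t') \<or> (x, y) = (s', t)"
    | "(x, y) = (s, t') \<or> (x, y) = (s', t)" "(x', y') = (s, t') \<or> (x', y') = (s', t)" by blast
  note cas = this
  show "(x, y) = (x', y')" if "pair x = pair x'"
    using cas
  proof cases
    case 1
    then show ?thesis using mov_start[OF a 1(1) 1(4) that] by simp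
  next
    case 2
    then show ?thesis using O[OF 2(1-3)] that by auto
  next
    case 3
    then show ?thesis using O[OF 3(1-3)] that by auto
  next
    case 4
    then show ?thesis using F(10) that by auto
  qed
  show "(x, y) = (x', y')" if "pair y = pair y'"
    using cas
  proof cases
    case 1
    then show ?thesis using mov_end[OF a 1(1) 1(4) that] by simp
  next
    case 2
    then show ?thesis using O[OF 2(1-3)] that by auto
  next
    case 3
    then show ?thesis using O[OF 3(1-3)] that by auto
  next
    case 4
    then show ?thesis using F(11) that by auto
  qed
next
  show "dh a - (if s' = t' then {pair s'} else {}) \<subseteq> pairs" using dh_pairs[OF a] by auto
next
  note F = uncrossable_facts
  fix P x y assume P: "P \<in> dh a - (if s' = t' then {pair s'} else {})"
    and xy: "(x, y) \<in> mov a - {(s, t), (s', t')} \<union> {(s, t'), (s', t)}"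
  have Pd: "P \<in> dh a" using P by simp
  have "s \<notin> P" "t \<notin> P" using dh_mov[OF a Pd F(1)] by auto
  moreover have "s' \<notin> P \<and> t' \<notin> P"
  proof (cases "(s', t') \<in> mov a")
    case True
    then show ?thesis using dh_mov[OF a Pd True] by simp
  next
    case False
    then have "P \<noteq> pair s'" "s' = t'" using F(9) P by auto
    then show ?thesis using in_pair_iff[OF dh_pairs[OF a Pd]] by metis
  qed
  moreover have "x \<notin> P \<and> y \<notin> P" if "(x, y) \<in> mov a" using dh_mov[OF a Pd that] .
  ultimately show "x \<notin> P \<and> y \<notin> P" using xy by auto
qed

end

lemma resolved_facts:
  assumes a: "a \<in> gens" and C: "C \<in> choices (dh a)"
  shows "finite (resolved a C)" "\<And>x y. (x, y) \<in> resolved a C \<Longrightarrow> x \<le> y"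
    "\<And>x y z. (x, y) \<in> resolved a C \<Longrightarrow> (x, z) \<in> resolved a C \<Longrightarrow> y = z"
    "\<And>x y z. (x, y) \<in> resolved a C \<Longrightarrow> (z, y) \<in> resolved a C \<Longrightarrow> x = z"
proof -
  have "finite C" using choice_points[OF a C] by (rule finite_subset) (simp add: points_def)
  then show "finite (resolved a C)" using finite_mov[OF a] by (simp add: resolved_def Id_on_def)
  show "x \<le> y" if "(x, y) \<in> resolved a C" for x y
    using that mov_chord[OF a, of x y] by (auto simp: resolved_def)
  have d: "x \<notin> C \<and> y \<notin> C" if "(x, y) \<in> mov a" for x y
  proof -
    have "C \<subseteq> \<Union>(dh a)" using C by (simp add: choices_def)
    then show ?thesis using dh_mov[OF a _ that] by blast
  qed
  show "y = z" if "(x, y) \<in> resolved a C" "(x, z) \<in> resolved a C" for x y z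
    using that mov_start[OF a, of x y x z] d[of x y] d[of x z] by (auto simp: resolved_def)
  show "x = z" if "(x, y) \<in> resolved a C" "(z, y) \<in> resolved a C" for x y z
    using that mov_end[OF a, of x y z y] d[of x y] d[of z y] by (auto simp: resolved_def)
qed

text \<open>Constant strands are never between two crossing strands, so the condition does not depend on the
  chosen resolution, except that the point of an opened double horizontal has to be the chosen one.\<close>
lemma crossings_drop_one:
  assumes a: "a \<in> gens" and C: "C \<in> choices (dh a)"
  shows "{c. c \<in> crossings (resolved a C) \<and> inv_count (swap_ends (resolved a C) c) + 1 = inv_count (resolved a C)}
    = {((s, t), (s', t')). ((s, t), (s', t')) \<in> uncrossable a \<and> (s' = t' \<longrightarrow> s' \<in> C)}"
proof -
  define \<phi> where "\<phi> = resolved a C"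
  note R = resolved_facts[OF a C, folded \<phi>_def]
  have "((s, t), (s', t')) \<in> crossings \<phi> \<and> inv_count (swap_ends \<phi> ((s, t), (s', t'))) + 1 = inv_count \<phi> \<longleftrightarrow>
      ((s, t), (s', t')) \<in> uncrossable a \<and> (s' = t' \<longrightarrow> s' \<in> C)" for s t s' t'
  proof -
    define \<psi> where "\<psi> = \<phi> - {(s, t), (s', t')}"
    have mem: "(s, t) \<in> \<phi> \<and> (s', t') \<in> \<phi> \<and> s < s' \<and> t' < t \<longleftrightarrow>
        (s, t) \<in> mov a \<and> ((s', t') \<in> mov a \<or> s' = t' \<and> s' \<in> C) \<and> s < s' \<and> t' < t"
    proof -
      have "s \<noteq> t" if "(s', t') \<in> \<phi>" "s < s'" "t' < t" using R(2)[OF that(1)] that by simp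
      then show ?thesis by (auto simp: \<phi>_def resolved_def)
    qed
    show ?thesis
    proof (cases "(s, t) \<in> \<phi> \<and> (s', t') \<in> \<phi> \<and> s < s' \<and> t' < t")
      case True
      then have T: "(s, t) \<in> \<phi>" "(s', t') \<in> \<phi>" "s < s'" "t' < t" by auto
      have fin: "finite \<psi>" using R(1) by (simp add: \<psi>_def)
      have \<phi>: "\<phi> = insert (s, t) (insert (s', t') \<psi>)" using T by (auto simp: \<psi>_def)
      have switch: "swap_ends \<phi> ((s, t), (s', t')) = insert (s, t') (insert (s', t) \<psi>)" by (auto simp: \<psi>_def)
      have new: "x \<noteq> s \<and> x \<noteq> s' \<and> y \<noteq> t \<and> y \<noteq> t'" if "(x, y) \<in> \<psi>" for x y
      proof -
        have "(x, y) \<in> \<phi>" "(x, y) \<noteq> (s, t)" "(x, y) \<noteq> (s', t')" using that by (simp_all add: \<psi>_def)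
        then show ?thesis using R(3,4) T(1,2) by metis
      qed
      have "inv_count (swap_ends \<phi> ((s, t), (s', t'))) + 1 = inv_count \<phi> \<longleftrightarrow>
          card {(x, y) \<in> \<psi>. s < x \<and> x < s' \<and> t' < y \<and> y < t} = 0"
        unfolding switch using inv_count_swap[OF fin T(3,4) new, folded \<phi>] by simp
      also have "\<dots> \<longleftrightarrow> {(x, y) \<in> \<psi>. s < x \<and> x < s' \<and> t' < y \<and> y < t} = {}"
      proof -
        have "finite {(x, y) \<in> \<psi>. s < x \<and> x < s' \<and> t' < y \<and> y < t}"
          by (rule finite_subset[OF _ fin]) auto
        then show ?thesis by (rule card_0_eq)
      qed
      also have "\<dots> \<longleftrightarrow> (\<forall>(x, y)\<in>mov a. \<not> (s < x \<and> x < s' \<and> t' < y \<and> y < t))"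
        using R(2)[OF T(2)] by (auto simp: \<psi>_def \<phi>_def resolved_def)
      finally have drop: "inv_count (swap_ends \<phi> ((s, t), (s', t'))) + 1 = inv_count \<phi> \<longleftrightarrow>
        (\<forall>(x, y)\<in>mov a. \<not> (s < x \<and> x < s' \<and> t' < y \<and> y < t))" .
      have "s' = t' \<longrightarrow> s' \<in> C \<longrightarrow> s' \<in> points \<and> pair s' \<in> dh a" using C by (simp add: choices_iff[OF a])
      moreover have "(s', t') \<in> mov a \<longrightarrow> s' \<noteq> t'" using mov_chord[OF a] by auto
      ultimately show ?thesis
        unfolding drop using True mem by (auto simp: crossings_def uncrossable_def)
    next
      case False
      have "(s', t') \<in> mov a \<longrightarrow> s' \<noteq> t'" using mov_chord[OF a] by auto
      then show ?thesis using False mem by (auto simp: crossings_def uncrossable_def)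
    qed
  qed
  then show ?thesis
    unfolding \<phi>_def[symmetric] by (simp only: set_eq_iff split_paired_All mem_Collect_eq prod.case simp_thms)
qed

text \<open>The chosen point that an uncrossing consumes.\<close>
definition used :: "(nat \<times> nat) \<times> (nat \<times> nat) \<Rightarrow> nat set" where
  "used l = (if fst (snd l) = snd (snd l) then {fst (snd l)} else {})"

lemma choices_remove:
  assumes a: "a \<in> gens" and b: "b \<in> gens" and q: "q \<in> points" "pair q \<in> dh a" and dh: "dh b = dh a - {pair q}"
  shows "C \<in> choices (dh a) \<and> q \<in> C \<longleftrightarrow> q \<in> C \<and> C - {q} \<in> choices (dh b)"
    and "D \<in> choices (dh b) \<Longrightarrow> q \<notin> D"
proof -
  note m = mate_points[OF q(1)]
  show qD: "q \<notin> D" if "D \<in> choices (dh b)" for D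
    using that unfolding choices_iff[OF b] by (auto simp: dh)
  have P: "pair c \<in> dh b \<longleftrightarrow> pair c \<in> dh a \<and> c \<noteq> q \<and> c \<noteq> mate q" if "c \<in> points" for c
    using pair_eq_iff[OF q(1) that] by (auto simp: dh)
  have n: "mate c \<noteq> q \<longleftrightarrow> c \<noteq> mate q" "mate c = mate q \<longleftrightarrow> c = q" if "c \<in> points" for c
    using mate_points[OF that] m by metis+
  show "C \<in> choices (dh a) \<and> q \<in> C \<longleftrightarrow> q \<in> C \<and> C - {q} \<in> choices (dh b)"
  proof
    assume A: "C \<in> choices (dh a) \<and> q \<in> C"
    then have c1: "\<And>c. c \<in> C \<Longrightarrow> c \<in> points \<and> pair c \<in> dh a \<and> mate c \<notin> C"
      and c2: "\<And>c. c \<in> points \<Longrightarrow> pair c \<in> dh a \<Longrightarrow> c \<in> C \<or> mate c \<in> C" and qC: "q \<in> C"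
      by (simp_all add: choices_iff[OF a])
    have "c \<in> points \<and> pair c \<in> dh b \<and> mate c \<notin> C - {q}" if "c \<in> C - {q}" for c
      using c1[of c] c1[OF qC] P[of c] that by auto
    moreover have "c \<in> C - {q} \<or> mate c \<in> C - {q}" if "c \<in> points" "pair c \<in> dh b" for c
      using c2[OF that(1)] P[OF that(1)] n[OF that(1)] that(2) by auto
    ultimately show "q \<in> C \<and> C - {q} \<in> choices (dh b)" using qC by (simp add: choices_iff[OF b])
  next
    assume A: "q \<in> C \<and> C - {q} \<in> choices (dh b)"
    then have c1: "\<And>c. c \<in> C - {q} \<Longrightarrow> c \<in> points \<and> pair c \<in> dh b \<and> mate c \<notin> C - {q}"
      and c2: "\<And>c. c \<in> points \<Longrightarrow> pair c \<in> dh b \<Longrightarrow> c \<in> C - {q} \<or> mate c \<in> C - {q}" and qC: "q \<in> C"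
      by (simp_all add: choices_iff[OF b])
    have "c \<in> points \<and> pair c \<in> dh a \<and> mate c \<notin> C" if "c \<in> C" for c
    proof (cases "c = q")
      case True
      have "mate q \<notin> C - {q}" using c1[of "mate q"] P m by auto
      then show ?thesis using True q m by auto
    next
      case False
      then show ?thesis using c1[of c] P[of c] n(1)[of c] that by auto
    qed
    moreover have "c \<in> C \<or> mate c \<in> C" if "c \<in> points" "pair c \<in> dh a" for c
      using c2[OF that(1)] P[OF that(1)] that(2) qC m by (cases "c = q"; cases "c = mate q") auto
    ultimately show "C \<in> choices (dh a) \<and> q \<in> C" using qC by (simp add: choices_iff[OF a])
  qed
qed

lemma uncrossed_choices:
  assumes a: "a \<in> gens" and u: "l \<in> uncrossable a"
  shows "C \<in> choices (dh a) \<Longrightarrow> used l \<subseteq> C \<Longrightarrow> C - used l \<in> choices (dh (uncrossed a l))"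
    and "D \<in> choices (dh (uncrossed a l)) \<Longrightarrow> D \<union> used l \<in> choices (dh a) \<and> D \<inter> used l = {}"
    and "C \<in> choices (dh a) \<Longrightarrow> used l \<subseteq> C \<Longrightarrow>
      swap_ends (resolved a C) l = resolved (uncrossed a l) (C - used l)"
proof -
  obtain s t s' t' where l: "l = ((s, t), (s', t'))" by (metis prod.exhaust)
  note u' = u[unfolded l]
  note F = uncrossable_facts[OF a u'] and b = uncrossed_gens[OF a u', folded l]
  show "C - used l \<in> choices (dh (uncrossed a l))" if C: "C \<in> choices (dh a)" "used l \<subseteq> C"
  proof (cases "s' = t'")
    case True
    then have "pair s' \<in> dh a" using F(9) mov_chord[OF a, of s' t'] by auto
    then show ?thesis using choices_remove(1)[OF a b F(7), of C] C True by (simp add: used_def l)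
  next
    case False
    then show ?thesis using C by (simp add: used_def l)
  qed
  show "D \<union> used l \<in> choices (dh a) \<and> D \<inter> used l = {}" if D: "D \<in> choices (dh (uncrossed a l))"
  proof (cases "s' = t'")
    case True
    then have p: "pair s' \<in> dh a" using F(9) mov_chord[OF a, of s' t'] by auto
    have dh: "dh (uncrossed a l) = dh a - {pair s'}" using True by (simp add: l)
    have "s' \<notin> D" by (rule choices_remove(2)[OF a b F(7) p dh D])
    then have "insert s' D - {s'} = D" by blast
    then show ?thesis using choices_remove(1)[OF a b F(7) p dh, of "insert s' D"] D \<open>s' \<notin> D\<close> True
      by (simp add: used_def l)
  next
    case False
    then show ?thesis using D by (simp add: used_def l)
  qed
  show "swap_ends (resolved a C) l = resolved (uncrossed a l) (C - used l)" if "C \<in> choices (dh a)" "used l \<subseteq> C"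
  proof (cases "s' = t'")
    case True
    then show ?thesis using F(2,3,4) mov_chord[OF a] that
      by (auto simp: l used_def resolved_def)
  next
    case False
    then have "s \<noteq> t" using F by simp
    then show ?thesis using False by (auto simp: l used_def resolved_def)
  qed
qed

lemma uncrossed_inj: "a \<in> gens \<Longrightarrow> inj_on (uncrossed a) (uncrossable a)"
proof (rule inj_onI)
  fix l m assume a: "a \<in> gens" and lm: "l \<in> uncrossable a" "m \<in> uncrossable a" "uncrossed a l = uncrossed a m"
  obtain s t s' t' where l: "l = ((s, t), (s', t'))" by (metis prod.exhaust)
  obtain p u q v where m: "m = ((p, u), (q, v))" by (metis prod.exhaust)
  note F = uncrossable_facts[OF a lm(1)[unfolded l]] and G = uncrossable_facts[OF a lm(2)[unfolded m]]
  have O: "x \<noteq> q \<or> y = v" if "(x, y) \<in> mov a" for x y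
    using G(9) mov_start[OF a that, of q v] dh_mov[OF a _ that, of "pair q"] pair_self[of q] by auto
  have "mov (uncrossed a l) = mov (uncrossed a m)" using lm(3) by simp
  then have eq: "mov a - {(s, t), (s', t')} \<union> {(s, t'), (s', t)} = mov a - {(p, u), (q, v)} \<union> {(p, v), (q, u)}"
    by (simp add: l m)
  have "(s, t') \<notin> mov a" using mov_start[OF a F(1), of s t'] F(3) by auto
  moreover have "(s, t') \<in> mov a - {(p, u), (q, v)} \<union> {(p, v), (q, u)}" unfolding eq[symmetric] by simp
  ultimately have c: "(s, t') = (p, v) \<or> (s, t') = (q, u)" by blast
  have "(s, t') \<noteq> (q, u)" using O[OF F(1)] F(3) G(3) by auto
  then have sp: "s = p" "t' = v" using c by auto
  then have tu: "t = u" using mov_start[OF a F(1), of p u] G(1) by auto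
  have "(s', t) \<noteq> (s, t')" using F(2) by simp
  moreover have "(s', t) \<in> mov a - {(p, u), (q, v)} \<union> {(p, v), (q, u)}" unfolding eq[symmetric] by simp
  moreover have "(s', t) \<notin> mov a" using mov_end[OF a F(1), of s' t] F(2) by auto
  ultimately have "s' = q" using sp by auto
  then show "l = m" using sp tu by (simp add: l m)
qed

lemma uncrossable_finite: "a \<in> gens \<Longrightarrow> finite (uncrossable a)"
proof -
  assume a: "a \<in> gens"
  have "uncrossable a \<subseteq> (points \<times> points) \<times> (points \<times> points)"
  proof
    fix l assume u: "l \<in> uncrossable a"
    obtain s t s' t' where l: "l = ((s, t), (s', t'))" by (metis prod.exhaust)
    show "l \<in> (points \<times> points) \<times> (points \<times> points)" using uncrossable_facts(5-8)[OF a u[unfolded l]] by (simp add: l)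
  qed
  then show ?thesis by (rule finite_subset) (simp add: points_def)
qed

text \<open>Pairs of a resolution of \<open>a\<close> and one of its uncrossings correspond to pairs of an uncrossing of \<open>a\<close>
  and a resolution of the result.\<close>
lemma strands_diff_emb:
  assumes a: "a \<in> gens"
  shows "strands_diff (emb a) = (\<Sum>b\<in>uncrossed a ` uncrossable a. emb b)"
proof -
  define S where "S = (SIGMA C:choices (dh a). {l \<in> uncrossable a. used l \<subseteq> C})"
  define T where "T = (SIGMA l:uncrossable a. choices (dh (uncrossed a l)))"
  note U = uncrossed_choices[OF a]
  have g: "uncrossed a l \<in> gens" if "l \<in> uncrossable a" for l
    using uncrossed_gens[OF a] that by (metis prod.exhaust)
  have "strands_diff (emb a) = (\<Sum>C\<in>choices (dh a). strands_diff_basis (resolved a C))"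
    unfolding strands_diff_def emb_resolved lin_sum by simp
  also have "\<dots> = (\<Sum>C\<in>choices (dh a). \<Sum>l | l \<in> uncrossable a \<and> used l \<subseteq> C. basis (swap_ends (resolved a C) l))"
  proof (rule sum.cong[OF refl])
    fix C assume C: "C \<in> choices (dh a)"
    have "{((s, t), (s', t')). ((s, t), (s', t')) \<in> uncrossable a \<and> (s' = t' \<longrightarrow> s' \<in> C)} =
        {l. l \<in> uncrossable a \<and> used l \<subseteq> C}" by (auto simp: used_def)
    then show "strands_diff_basis (resolved a C) =
        (\<Sum>l | l \<in> uncrossable a \<and> used l \<subseteq> C. basis (swap_ends (resolved a C) l))"
      unfolding strands_diff_basis_def crossings_drop_one[OF a C] by simp
  qed
  also have "\<dots> = (\<Sum>(C, l)\<in>S. basis (swap_ends (resolved a C) l))"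
    unfolding S_def using finite_choices[OF a] uncrossable_finite[OF a] by (subst sum.Sigma) auto
  also have "\<dots> = (\<Sum>(l, D)\<in>T. basis (resolved (uncrossed a l) D))"
    by (rule sum.reindex_bij_witness[of _ "\<lambda>(l, D). (D \<union> used l, l)" "\<lambda>(C, l). (l, C - used l)"])
       (use U in \<open>fastforce simp: S_def T_def\<close>)+
  also have "\<dots> = (\<Sum>l\<in>uncrossable a. emb (uncrossed a l))"
    unfolding T_def emb_resolved using g finite_choices uncrossable_finite[OF a] by (subst sum.Sigma) auto
  also have "\<dots> = (\<Sum>b\<in>uncrossed a ` uncrossable a. emb b)"
    by (simp add: sum.reindex[OF uncrossed_inj[OF a]])
  finally show ?thesis .
qed

lemma occurs_in_diff:
  assumes a: "a \<in> gens"
  shows "occurs_in b (strands_diff (emb a)) \<longleftrightarrow> (\<exists>l\<in>uncrossable a. b = uncrossed a l)"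
proof -
  have "uncrossed a ` uncrossable a \<subseteq> gens" using uncrossed_gens[OF a] by fastforce
  then show ?thesis unfolding strands_diff_emb[OF a] by (subst occurs_in_sum) auto
qed

section \<open>Multiplication by a chord\<close>

text \<open>The chord from \<open>p\<close> to \<open>q\<close> can be put in front of the strand from \<open>q\<close> to \<open>r\<close>, which is constant for
  \<open>q = r\<close>: the pair of \<open>p\<close> is free once \<open>q\<close> is given up, and no strand is crossed twice.\<close>
definition lowerable :: "gen \<Rightarrow> nat \<Rightarrow> nat \<Rightarrow> nat \<Rightarrow> bool" where
  "lowerable c p q r \<longleftrightarrow> ((q, r) \<in> mov c \<or> q = r \<and> pair q \<in> dh c) \<and>
     pair p \<notin> left_idem c - {pair q} \<and> (\<forall>(x, y)\<in>mov c. \<not> (p < x \<and> x < q \<and> r < y))"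

definition lowered :: "gen \<Rightarrow> nat \<Rightarrow> nat \<Rightarrow> nat \<Rightarrow> gen" where
  "lowered c p q r = Gen (mov c - {(q, r)} \<union> {(p, r)}) (dh c - (if q = r then {pair q} else {}))"

lemma pair_inj_domain:
  assumes c: "c \<in> gens" and C: "C \<in> choices (dh c)"
  shows "inj_on pair (Domain (resolved c C))" "pair ` Domain (resolved c C) = left_idem c"
    "Domain (resolved c C) \<subseteq> points"
proof -
  have Cd: "x \<in> points \<and> pair x \<in> dh c \<and> mate x \<notin> C" if "x \<in> C" for x
    using C that by (simp add: choices_iff[OF c])
  show "inj_on pair (Domain (resolved c C))"
  proof (rule inj_onI)
    fix x x' assume x: "x \<in> Domain (resolved c C)" "x' \<in> Domain (resolved c C)" "pair x = pair x'"
    then obtain y y' where y: "(x, y) \<in> resolved c C" "(x', y') \<in> resolved c C" by blast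
    have no: False if "(u, v) \<in> mov c" "w \<in> C" "pair u = pair w" for u v w
      using dh_mov[OF c _ that(1), of "pair w"] Cd[OF that(2)] that(3) pair_self[of u] by simp
    consider "(x, y) \<in> mov c" "(x', y') \<in> mov c" | "x \<in> C" "x' \<in> C"
      | "(x, y) \<in> mov c" "x' \<in> C" | "x \<in> C" "(x', y') \<in> mov c"
      using y by (auto simp: resolved_def)
    then show "x = x'"
    proof cases
      case 1
      then show ?thesis using mov_start[OF c 1 x(3)] by simp
    next
      case 2
      then show ?thesis using pair_eq_iff[of x x'] Cd[OF 2(1)] Cd[OF 2(2)] x(3) by auto
    next
      case 3
      then show ?thesis using no[OF 3 x(3)] by simp
    next
      case 4
      then show ?thesis using no[OF 4(2,1)] x(3) by simp
    qed
  qed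
  have "left_idem c = pair ` C \<union> (\<lambda>(s, t). pair s) ` mov c"
    using dh_choice[OF c C] by (simp add: left_idem_def)
  also have "\<dots> = pair ` Domain (resolved c C)" by (force simp: resolved_def)
  finally show "pair ` Domain (resolved c C) = left_idem c" by simp
  show "Domain (resolved c C) \<subseteq> points" using Cd mov_chord[OF c] by (auto simp: resolved_def)
qed

lemma pair_image_start:
  assumes c: "c \<in> gens" and C: "C \<in> choices (dh c)" and q: "q \<in> Domain (resolved c C)"
  shows "pair ` (Domain (resolved c C) - {q}) = left_idem c - {pair q}"
  using inj_on_image_set_diff[OF pair_inj_domain(1)[OF c C] Diff_subset, of "{q}"] q pair_inj_domain(2)[OF c C]
  by (simp add: inj_on_image_set_diff[OF pair_inj_domain(1)[OF c C]])

text \<open>The domain of the resolution of \<open>c\<close> determines the other strands of the first factor, hence the only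
  generator in the chord element, and the only resolution of it, that can be composed with it.\<close>
lemma chord_factor:
  assumes c: "c \<in> gens" and C': "C' \<in> choices (dh c)" and pq: "(p, q) \<in> chords"
  defines "D \<equiv> Domain (resolved c C')"
  defines "ok \<equiv> q \<in> D \<and> pair p \<notin> pair ` (D - {q})"
  shows "(\<Sum>a | a \<in> gens \<and> mov a = {(p, q)}. \<Sum>C\<in>choices (dh a). strands_mult_basis (resolved a C) (resolved c C')) =
    (if ok then strands_mult_basis (insert (p, q) (Id_on (D - {q}))) (resolved c C') else 0)"
proof -
  define G where "G = {a. a \<in> gens \<and> mov a = {(p, q)}}"
  define h where "h = (\<lambda>(a, C). strands_mult_basis (resolved a C) (resolved c C'))"
  define a0 where "a0 = Gen {(p, q)} (pair ` (D - {q}))"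
  have pq': "p \<in> points" "q \<in> points" "p < q" using pq by (auto simp: chords_def)
  note I = pair_inj_domain[OF c C', folded D_def]
  have fin: "finite (Sigma G (\<lambda>a. choices (dh a)))"
    using finite_subset[OF _ gens_finite, of G] finite_choices by (auto simp: G_def)
  have un: "a = a0 \<and> C = D - {q} \<and> ok" if "(a, C) \<in> Sigma G (\<lambda>a. choices (dh a))" "h (a, C) \<noteq> 0" for a C
  proof -
    have a: "a \<in> gens" "mov a = {(p, q)}" and C: "C \<in> choices (dh a)" using that(1) by (auto simp: G_def)
    have no: "p \<notin> pair x \<and> q \<notin> pair x" if "x \<in> C" for x
      using dh_mov[OF a(1), of "pair x" p q] a(2) C that by (auto simp: choices_iff[OF a(1)])
    have "Range (resolved a C) = insert q C" using a(2) by (auto simp: resolved_def)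
    moreover have "Range (resolved a C) = D"
      using that(2) by (auto simp: h_def strands_mult_basis_def D_def split: if_splits)
    moreover have "q \<notin> C" using no pair_self by blast
    ultimately have CD: "C = D - {q}" "q \<in> D" by auto
    have "dh a = pair ` (D - {q})" using dh_choice[OF a(1) C] CD by simp
    then have "a = a0" using a(2) by (simp add: a0_def gen.expand)
    moreover have "pair p \<notin> pair ` (D - {q})" using no CD(1) pair_self[of p] by auto
    ultimately show ?thesis using CD by (simp add: ok_def)
  qed
  have ex: "(a0, D - {q}) \<in> Sigma G (\<lambda>a. choices (dh a))" if ok: ok
  proof -
    have P: "pair p \<noteq> pair x \<and> pair q \<noteq> pair x" if "x \<in> D - {q}" for x
      using ok that I(1) unfolding ok_def inj_on_def by (metis DiffD1 DiffD2 image_eqI singletonI)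
    have inP: "y \<in> pair x \<longleftrightarrow> pair y = pair x" if "x \<in> D" "y \<in> points" for x y
      using that I(3) in_pair_iff[of "pair x" y] by (auto simp: pairs_def)
    have a0: "a0 \<in> gens"
    proof (rule gensI)
      show "dh a0 \<subseteq> pairs" using I(3) by (auto simp: a0_def pairs_def)
      show "s \<notin> P \<and> t \<notin> P" if "P \<in> dh a0" "(s, t) \<in> mov a0" for P s t
        using that P inP pq' by (auto simp: a0_def)
    qed (use pq' in \<open>auto simp: a0_def\<close>)
    have "D - {q} \<in> choices (dh a0)"
      unfolding choices_iff[OF a0]
    proof (intro conjI ballI impI)
      fix x assume x: "x \<in> D - {q}"
      then have xp: "x \<in> points" using I(3) by blast
      show "x \<in> points" by (rule xp)
      show "pair x \<in> dh a0" using x by (simp add: a0_def)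
      show "mate x \<notin> D - {q}"
      proof
        assume "mate x \<in> D - {q}"
        then have "mate x = x" using I(1) x pair_mate[OF xp] by (auto simp: inj_on_def)
        then show False using mate_points[OF xp] by simp
      qed
    next
      fix x assume x: "x \<in> points" "pair x \<in> dh a0"
      then obtain y where y: "y \<in> D - {q}" "pair x = pair y" by (auto simp: a0_def)
      then have "y = x \<or> y = mate x" using pair_eq_iff[of x y] x I(3) by auto
      then show "x \<in> D - {q} \<or> mate x \<in> D - {q}" using y by auto
    qed
    then show ?thesis using a0 by (simp add: G_def a0_def)
  qed
  have "(\<Sum>a | a \<in> gens \<and> mov a = {(p, q)}. \<Sum>C\<in>choices (dh a). strands_mult_basis (resolved a C) (resolved c C')) =
      (\<Sum>x\<in>Sigma G (\<lambda>a. choices (dh a)). h x)"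
    unfolding G_def[symmetric] h_def using finite_subset[OF _ gens_finite, of G] finite_choices
    by (subst sum.Sigma) (auto simp: G_def)
  also have "\<dots> = (if ok then h (a0, D - {q}) else 0)"
  proof (cases ok)
    case True
    have "(\<Sum>x\<in>Sigma G (\<lambda>a. choices (dh a)). h x) = (\<Sum>x\<in>{(a0, D - {q})}. h x)"
    proof (rule sum.mono_neutral_right[OF fin])
      show "{(a0, D - {q})} \<subseteq> Sigma G (\<lambda>a. choices (dh a))" using ex[OF True] by simp
      show "\<forall>x\<in>Sigma G (\<lambda>a. choices (dh a)) - {(a0, D - {q})}. h x = 0"
        using un by (metis DiffD1 DiffD2 insertCI prod.exhaust)
    qed
    then show ?thesis using True by simp
  next
    case False
    have "h x = 0" if "x \<in> Sigma G (\<lambda>a. choices (dh a))" for x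
      using un[of "fst x" "snd x"] that False by auto
    then show ?thesis using False by (simp add: sum.neutral)
  qed
  also have "h (a0, D - {q}) = strands_mult_basis (insert (p, q) (Id_on (D - {q}))) (resolved c C')"
    by (simp add: h_def resolved_def a0_def)
  finally show ?thesis .
qed

text \<open>The chord crosses exactly the constant strands between \<open>p\<close> and \<open>q\<close>, and \<open>inv_count_lower_start\<close> compares
  the result with the second factor.\<close>
lemma chord_term:
  assumes c: "c \<in> gens" and C': "C' \<in> choices (dh c)" and pq: "(p, q) \<in> chords" and r: "(q, r) \<in> resolved c C'"
  defines "D \<equiv> Domain (resolved c C')"
  assumes p: "pair p \<notin> pair ` (D - {q})"
  shows "strands_mult_basis (insert (p, q) (Id_on (D - {q}))) (resolved c C') =
    (if \<forall>(x, y)\<in>mov c. \<not> (p < x \<and> x < q \<and> r < y) then basis (resolved (lowered c p q r) (C' - {q})) else 0)"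
proof -
  define \<phi> where "\<phi> = resolved c C'"
  define \<psi> where "\<psi> = \<phi> - {(q, r)}"
  note R = resolved_facts[OF c C', folded \<phi>_def] and I = pair_inj_domain[OF c C', folded D_def]
  have pq': "p \<in> points" "q \<in> points" "p < q" using pq by (auto simp: chords_def)
  have r': "(q, r) \<in> \<phi>" using r by (simp add: \<phi>_def)
  have D: "D = Domain \<phi>" by (simp add: D_def \<phi>_def)
  have qD: "q \<in> D" using r' D by blast
  have fin: "finite \<psi>" "finite (D - {q})" using R(1) by (auto simp: \<psi>_def D finite_Domain)
  have new: "x \<noteq> p \<and> x \<noteq> q \<and> y \<noteq> r" if xy: "(x, y) \<in> \<psi>" for x y
  proof -
    have m: "(x, y) \<in> \<phi>" "(x, y) \<noteq> (q, r)" using xy by (simp_all add: \<psi>_def)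
    have "x \<noteq> q" "y \<noteq> r" using R(3)[OF m(1)] R(4)[OF m(1)] r' m(2) by auto
    moreover from this have "x \<in> D - {q}" using m(1) D by blast
    then have "x \<noteq> p" using p by auto
    ultimately show ?thesis by simp
  qed
  have phi: "insert (q, r) \<psi> = \<phi>" using r' by (auto simp: \<psi>_def)
  have rng: "Range (insert (p, q) (Id_on (D - {q}))) = Domain \<phi>" using qD D by auto
  have comp: "insert (p, q) (Id_on (D - {q})) O \<phi> = insert (p, r) \<psi>"
  proof (intro set_eqI)
    fix z :: "nat \<times> nat"
    obtain x y where z: "z = (x, y)" by (cases z)
    have "x \<in> D" if "(x, y) \<in> \<phi>" using that D by blast
    then show "z \<in> insert (p, q) (Id_on (D - {q})) O \<phi> \<longleftrightarrow> z \<in> insert (p, r) \<psi>"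
      using r' R(3)[of q y r] unfolding z \<psi>_def relcomp_unfold by auto
  qed
  have "card {x \<in> D - {q}. p < x \<and> x < q} = card {(x, y) \<in> \<psi>. p < x \<and> x < q}"
  proof -
    have "inj_on fst {(x, y) \<in> \<psi>. p < x \<and> x < q}"
      using R(3) by (auto simp: inj_on_def \<psi>_def)
    moreover have "fst ` {(x, y) \<in> \<psi>. p < x \<and> x < q} = {x \<in> D - {q}. p < x \<and> x < q}"
    proof (intro equalityI subsetI)
      fix x assume "x \<in> fst ` {(x, y) \<in> \<psi>. p < x \<and> x < q}"
      then obtain y where "(x, y) \<in> \<psi>" "p < x" "x < q" by auto
      then show "x \<in> {x \<in> D - {q}. p < x \<and> x < q}" by (auto simp: D \<psi>_def)
    next
      fix x assume x: "x \<in> {x \<in> D - {q}. p < x \<and> x < q}"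
      then obtain y where "(x, y) \<in> \<phi>" by (auto simp: D)
      then show "x \<in> fst ` {(x, y) \<in> \<psi>. p < x \<and> x < q}"
        using x by (intro image_eqI[of _ _ "(x, y)"]) (auto simp: \<psi>_def)
    qed
    ultimately show ?thesis using card_image[of fst "{(x, y) \<in> \<psi>. p < x \<and> x < q}"] by simp
  qed
  then have "inv_count (insert (p, q) (Id_on (D - {q}))) = card {(x, y) \<in> \<psi>. p < x \<and> x < q}"
    using inv_count_chord_Id[OF fin(2) pq'(3)] by simp
  then have "inv_count (insert (p, r) \<psi>) = inv_count (insert (p, q) (Id_on (D - {q}))) + inv_count \<phi> \<longleftrightarrow>
      card {(x, y) \<in> \<psi>. p < x \<and> x < q \<and> r < y} = 0"
    using inv_count_lower_start[OF fin(1) pq'(3) new] unfolding phi by linarith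
  also have "\<dots> \<longleftrightarrow> {(x, y) \<in> \<psi>. p < x \<and> x < q \<and> r < y} = {}"
  proof -
    have "finite {(x, y) \<in> \<psi>. p < x \<and> x < q \<and> r < y}"
      by (rule finite_subset[OF _ fin(1)]) auto
    then show ?thesis by (rule card_0_eq)
  qed
  also have "\<dots> \<longleftrightarrow> (\<forall>(x, y)\<in>mov c. \<not> (p < x \<and> x < q \<and> r < y))"
    using R(2)[OF r'] by (auto simp: \<psi>_def \<phi>_def resolved_def)
  finally have inv: "inv_count (insert (p, r) \<psi>) = inv_count (insert (p, q) (Id_on (D - {q}))) + inv_count \<phi> \<longleftrightarrow>
      (\<forall>(x, y)\<in>mov c. \<not> (p < x \<and> x < q \<and> r < y))" .
  have "insert (p, r) \<psi> = resolved (lowered c p q r) (C' - {q})"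
  proof (cases "q = r")
    case True
    then show ?thesis using mov_chord[OF c] by (auto simp: \<psi>_def \<phi>_def resolved_def lowered_def)
  next
    case False
    then have "(q, r) \<in> mov c" using r by (auto simp: resolved_def)
    then have "q \<notin> C'" using R(3)[of q q r] False by (auto simp: \<phi>_def resolved_def)
    then show ?thesis using False by (auto simp: \<psi>_def \<phi>_def resolved_def lowered_def)
  qed
  then show ?thesis unfolding strands_mult_basis_def \<phi>_def[symmetric] using rng comp inv by simp
qed

lemma strands_mult_chord:
  assumes c: "c \<in> gens" and pq: "(p, q) \<in> chords"
  shows "strands_mult (chord_elt (p, q)) (emb c) =
    (\<Sum>C'\<in>choices (dh c).
       let D = Domain (resolved c C') in
       if q \<in> D \<and> pair p \<notin> pair ` (D - {q})
       then strands_mult_basis (insert (p, q) (Id_on (D - {q}))) (resolved c C') else 0)"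
proof -
  have "strands_mult (chord_elt (p, q)) (emb c) =
      (\<Sum>a | a \<in> gens \<and> mov a = {(p, q)}. \<Sum>C\<in>choices (dh a). \<Sum>C'\<in>choices (dh c).
         strands_mult_basis (resolved a C) (resolved c C'))"
    unfolding strands_mult_def chord_elt_def emb_resolved lin_sum by simp
  also have "\<dots> = (\<Sum>a | a \<in> gens \<and> mov a = {(p, q)}. \<Sum>C'\<in>choices (dh c). \<Sum>C\<in>choices (dh a).
         strands_mult_basis (resolved a C) (resolved c C'))"
    by (rule sum.cong[OF refl]) (rule sum.swap)
  also have "\<dots> = (\<Sum>C'\<in>choices (dh c). \<Sum>a | a \<in> gens \<and> mov a = {(p, q)}. \<Sum>C\<in>choices (dh a).
         strands_mult_basis (resolved a C) (resolved c C'))"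
    by (rule sum.swap)
  also have "\<dots> = (\<Sum>C'\<in>choices (dh c).
       let D = Domain (resolved c C') in
       if q \<in> D \<and> pair p \<notin> pair ` (D - {q})
       then strands_mult_basis (insert (p, q) (Id_on (D - {q}))) (resolved c C') else 0)"
    unfolding Let_def by (rule sum.cong[OF refl]) (rule chord_factor[OF c _ pq])
  finally show ?thesis .
qed

lemma lowered_gens:
  assumes c: "c \<in> gens" and pq: "(p, q) \<in> chords" and l: "lowerable c p q r"
  shows "lowered c p q r \<in> gens"
proof -
  have pq': "p \<in> points" "q \<in> points" "p < q" using pq by (auto simp: chords_def)
  have qr: "(q, r) \<in> mov c \<or> q = r \<and> pair q \<in> dh c" and pl: "pair p \<notin> left_idem c - {pair q}"
    using l by (simp_all add: lowerable_def)
  have r: "r \<in> points" "p < r" using qr pq' mov_chord[OF c, of q r] by auto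
  have O: "pair x \<noteq> pair p" "pair y \<noteq> pair r" if "(x, y) \<in> mov c" "(x, y) \<noteq> (q, r)" for x y
  proof -
    have "pair x \<noteq> pair q" using qr mov_start[OF c that(1), of q r] that(2) dh_mov[OF c _ that(1), of "pair q"] pair_self[of x]
      by auto
    moreover have "pair x \<in> left_idem c" using that(1) by (force simp: left_idem_def)
    ultimately show "pair x \<noteq> pair p" using pl by (metis DiffI singletonD)
    show "pair y \<noteq> pair r" using qr mov_end[OF c that(1), of q r] that(2) dh_mov[OF c _ that(1), of "pair q"] pair_self[of y]
      by metis
  qed
  have PD: "p \<notin> P \<and> r \<notin> P" if "P \<in> dh c" "q = r \<longrightarrow> P \<noteq> pair q" for P
  proof -
    have Pp: "P \<in> pairs" by (rule dh_pairs[OF c that(1)])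
    have "P \<noteq> pair q" using qr that dh_mov[OF c that(1), of q r] pair_self[of q] by auto
    then have "P \<in> left_idem c - {pair q}" using that(1) by (simp add: left_idem_def)
    then have "pair p \<noteq> P" using pl by metis
    then have "p \<notin> P" using in_pair_iff[OF Pp] by metis
    moreover have "r \<notin> P"
      using qr dh_mov[OF c that(1), of q r] in_pair_iff[OF Pp] \<open>P \<noteq> pair q\<close> by metis
    ultimately show ?thesis by simp
  qed
  show ?thesis
  proof (rule gensI; unfold lowered_def gen.sel)
    fix x y assume "(x, y) \<in> mov c - {(q, r)} \<union> {(p, r)}"
    then show "x \<in> points \<and> y \<in> points \<and> x < y" using mov_chord[OF c] pq' r by auto
  next
    fix x y x' y' assume "(x, y) \<in> mov c - {(q, r)} \<union> {(p, r)}" "(x', y') \<in> mov c - {(q, r)} \<union> {(p, r)}"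
    then consider "(x, y) \<in> mov c" "(x, y) \<noteq> (q, r)" "(x', y') \<in> mov c"
      | "(x, y) \<in> mov c" "(x, y) \<noteq> (q, r)" "(x', y') = (p, r)"
      | "(x, y) = (p, r)" "(x', y') \<in> mov c" "(x', y') \<noteq> (q, r)" | "(x, y) = (p, r)" "(x', y') = (p, r)" by blast
    note cas = this
    show "(x, y) = (x', y')" if "pair x = pair x'"
      using cas
    proof cases
      case 1
      then show ?thesis using mov_start[OF c 1(1,3) that] by simp
    next
      case 2
      then show ?thesis using O(1)[OF 2(1,2)] that by auto
    next
      case 3
      then show ?thesis using O(1)[OF 3(2,3)] that by auto
    qed simp
    show "(x, y) = (x', y')" if "pair y = pair y'"
      using cas
    proof cases
      case 1
      then show ?thesis using mov_end[OF c 1(1,3) that] by simp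
    next
      case 2
      then show ?thesis using O(2)[OF 2(1,2)] that by auto
    next
      case 3
      then show ?thesis using O(2)[OF 3(2,3)] that by auto
    qed simp
  next
    show "dh c - (if q = r then {pair q} else {}) \<subseteq> pairs" using dh_pairs[OF c] by auto
  next
    fix P x y assume P: "P \<in> dh c - (if q = r then {pair q} else {})" and xy: "(x, y) \<in> mov c - {(q, r)} \<union> {(p, r)}"
    have "P \<in> dh c" "q = r \<longrightarrow> P \<noteq> pair q" using P by (auto split: if_splits)
    then show "x \<notin> P \<and> y \<notin> P" using PD[of P] xy dh_mov[OF c, of P x y] by auto
  qed
qed

lemma strands_mult_chord_lowerable:
  assumes c: "c \<in> gens" and pq: "(p, q) \<in> chords" and l: "lowerable c p q r"
  shows "strands_mult (chord_elt (p, q)) (emb c) = emb (lowered c p q r)"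
proof -
  let ?b = "lowered c p q r"
  have q: "q \<in> points" using pq by (auto simp: chords_def)
  have b: "?b \<in> gens" by (rule lowered_gens[OF c pq l])
  have qr: "(q, r) \<in> mov c \<or> q = r \<and> pair q \<in> dh c" and pl: "pair p \<notin> left_idem c - {pair q}"
    and free: "\<forall>(x, y)\<in>mov c. \<not> (p < x \<and> x < q \<and> r < y)"
    using l by (simp_all add: lowerable_def)
  have idem: "pair ` (Domain (resolved c C') - {q}) = left_idem c - {pair q}"
    if "C' \<in> choices (dh c)" "q \<in> Domain (resolved c C')" for C'
    using pair_image_start[OF c that] .
  have t: "(let D = Domain (resolved c C') in
       if q \<in> D \<and> pair p \<notin> pair ` (D - {q})
       then strands_mult_basis (insert (p, q) (Id_on (D - {q}))) (resolved c C') else 0) =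
      (if (q, r) \<in> resolved c C' then basis (resolved ?b (C' - {q})) else 0)"
    if C': "C' \<in> choices (dh c)" for C'
  proof (cases "q \<in> Domain (resolved c C')")
    case True
    then obtain r' where r': "(q, r') \<in> resolved c C'" by blast
    have "r' = r"
    proof (cases "(q, r) \<in> mov c")
      case True
      then have "(q, r) \<in> resolved c C'" by (simp add: resolved_def)
      then show ?thesis using resolved_facts(3)[OF c C' r'] by simp
    next
      case False
      then have "q = r" "pair q \<in> dh c" using qr by auto
      moreover have "(q, r') \<notin> mov c" using dh_mov[OF c \<open>pair q \<in> dh c\<close>, of q r'] pair_self[of q] by auto
      ultimately show ?thesis using r' by (auto simp: resolved_def)
    qed
    then have rr: "(q, r) \<in> resolved c C'" using r' by simp
    show ?thesis
      using chord_term[OF c C' pq rr] idem[OF C' True] pl free True rr by (simp add: Let_def)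
  next
    case False
    then have "(q, r) \<notin> resolved c C'" by blast
    then show ?thesis using False by (simp add: Let_def)
  qed
  have "strands_mult (chord_elt (p, q)) (emb c) =
      (\<Sum>C'\<in>choices (dh c). if (q, r) \<in> resolved c C' then basis (resolved ?b (C' - {q})) else 0)"
    unfolding strands_mult_chord[OF c pq] using t by (rule sum.cong[OF refl])
  also have "\<dots> = (\<Sum>C'\<in>{C' \<in> choices (dh c). (q, r) \<in> resolved c C'}. basis (resolved ?b (C' - {q})))"
    by (simp add: sum.inter_filter[OF finite_choices[OF c]])
  also have "\<dots> = (\<Sum>D\<in>choices (dh ?b). basis (resolved ?b D))"
  proof (cases "(q, r) \<in> mov c")
    case True
    then have "q \<noteq> r" using mov_chord[OF c] by auto
    have "q \<notin> C'" if "C' \<in> choices (dh c)" for C'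
      using resolved_facts(3)[OF c that, of q q r] True \<open>q \<noteq> r\<close> by (auto simp: resolved_def)
    then show ?thesis using True \<open>q \<noteq> r\<close>
      by (intro sum.cong) (auto simp: lowered_def resolved_def)
  next
    case False
    then have qr': "q = r" "pair q \<in> dh c" using qr by auto
    have dh: "dh ?b = dh c - {pair q}" using qr' by (simp add: lowered_def)
    have mem: "(q, r) \<in> resolved c C' \<longleftrightarrow> q \<in> C'" for C' using False qr' by (auto simp: resolved_def)
    note R = choices_remove[OF c b q qr'(2) dh]
    show ?thesis unfolding mem
    proof (rule sum.reindex_bij_witness[of _ "insert q" "\<lambda>C'. C' - {q}"])
      fix D assume D: "D \<in> choices (dh ?b)"
      show "insert q D - {q} = D" using R(2)[OF D] by blast
      then show "insert q D \<in> {C' \<in> choices (dh c). q \<in> C'}" using R(1)[of "insert q D"] D by simp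
    next
      fix C' assume "C' \<in> {C' \<in> choices (dh c). q \<in> C'}"
      then show "C' - {q} \<in> choices (dh ?b)" "insert q (C' - {q}) = C'" using R(1)[of C'] by auto
    qed simp
  qed
  finally show ?thesis by (simp add: emb_resolved)
qed

lemma strands_mult_chord_zero:
  assumes c: "c \<in> gens" and pq: "(p, q) \<in> chords" and l: "\<And>r. \<not> lowerable c p q r"
  shows "strands_mult (chord_elt (p, q)) (emb c) = 0"
  unfolding strands_mult_chord[OF c pq]
proof (rule sum.neutral, rule ballI)
  fix C' assume C': "C' \<in> choices (dh c)"
  define D where "D = Domain (resolved c C')"
  show "(let D = Domain (resolved c C') in
       if q \<in> D \<and> pair p \<notin> pair ` (D - {q})
       then strands_mult_basis (insert (p, q) (Id_on (D - {q}))) (resolved c C') else 0) = 0"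
    unfolding Let_def D_def[symmetric]
  proof (clarsimp, goal_cases)
    case 1
    then obtain r where r: "(q, r) \<in> resolved c C'" by (auto simp: D_def)
    have "pair ` (D - {q}) = left_idem c - {pair q}"
      using pair_image_start[OF c C'] 1(1) by (simp add: D_def)
    moreover have "(q, r) \<in> mov c \<or> q = r \<and> pair q \<in> dh c"
      using r C' by (auto simp: resolved_def choices_iff[OF c])
    ultimately have "\<not> (\<forall>(x, y)\<in>mov c. \<not> (p < x \<and> x < q \<and> r < y))"
      using l[of r] 1(2) by (auto simp: lowerable_def)
    then show ?case using chord_term[OF c C' pq r 1(2)[unfolded D_def]] unfolding D_def by (simp only: if_False)
  qed
qed

lemma strands_mult_chord_eq_iff:
  assumes c: "c \<in> gens" and a: "a \<in> gens" and pq: "(p, q) \<in> chords"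
  shows "strands_mult (chord_elt (p, q)) (emb c) = emb a \<longleftrightarrow> (\<exists>r. lowerable c p q r \<and> a = lowered c p q r)"
proof
  assume eq: "strands_mult (chord_elt (p, q)) (emb c) = emb a"
  then obtain r where r: "lowerable c p q r"
    using strands_mult_chord_zero[OF c pq] emb_nonzero[OF a] by metis
  then have "emb a = emb (lowered c p q r)" using strands_mult_chord_lowerable[OF c pq r] eq by simp
  then show "\<exists>r. lowerable c p q r \<and> a = lowered c p q r"
    using emb_inj[OF a lowered_gens[OF c pq r]] r by blast
qed (use strands_mult_chord_lowerable[OF c pq] in auto)

section \<open>Generators of the complex as states\<close>

definition left_lab :: "nat \<Rightarrow> nat" where
  "left_lab t = 8 * k + 1 - t"

definition right_lab :: "nat \<Rightarrow> nat" where
  "right_lab t = t"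

text \<open>What the two ways of labelling end points have in common; it allows both sides to be treated at once.\<close>
definition is_side :: "(nat \<Rightarrow> nat) \<Rightarrow> bool" where
  "is_side lab \<longleftrightarrow> (\<forall>t\<in>points. lab t \<noteq> 0 \<and> lab t \<le> 8 * k \<and> height (lab t) = t \<and> mate_label (lab t) = lab (mate t))"

text \<open>The generator formed by the strands of one side of a state.\<close>
definition side :: "(nat \<Rightarrow> nat) \<Rightarrow> (nat \<Rightarrow> nat) \<Rightarrow> gen" where
  "side lab \<phi> = Gen {(s, t). s < t \<and> t \<in> points \<and> \<phi> s = lab t} {pair c |c. c \<in> points \<and> \<phi> c = lab c}"

definition decode :: "(nat \<Rightarrow> nat) \<Rightarrow> gen \<times> gen" where
  "decode \<phi> = (side left_lab \<phi>, side right_lab \<phi>)"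

lemma is_side_right: "is_side right_lab"
  by (auto simp: is_side_def right_lab_def points_def height_def mate_label_def)

lemma is_side_left: "is_side left_lab"
  using left_label by (auto simp: is_side_def left_lab_def points_def)

lemma label_cases:
  assumes "u \<noteq> 0" "u \<le> 8 * k"
  obtains "u \<le> 4 * k" "u = right_lab (height u)" "height u \<in> points"
    | "4 * k < u" "u = left_lab (height u)" "height u \<in> points"
proof (cases "u \<le> 4 * k")
  case True
  then show ?thesis using assms by (intro that(1)) (auto simp: height_def right_lab_def points_def)
next
  case False
  then show ?thesis using assms by (intro that(2)) (auto simp: height_def left_lab_def points_def)
qed

lemma state_points: "state \<phi> \<Longrightarrow> \<phi> s \<noteq> 0 \<Longrightarrow> s \<in> points"
  using state_bounds[of \<phi> s] by (simp add: points_def)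

lemma right_lab_le: "t \<in> points \<Longrightarrow> right_lab t \<le> 4 * k"
  by (simp add: right_lab_def points_def)

lemma left_lab_gt: "t \<in> points \<Longrightarrow> 4 * k < left_lab t"
  by (auto simp: left_lab_def points_def)

context
  fixes lab assumes lab: "is_side lab"
begin

lemma lab_facts:
  assumes "t \<in> points"
  shows "lab t \<noteq> 0" "lab t \<le> 8 * k" "height (lab t) = t" "mate_label (lab t) = lab (mate t)"
  using lab assms by (auto simp: is_side_def)

lemma lab_inj: "t \<in> points \<Longrightarrow> t' \<in> points \<Longrightarrow> lab t = lab t' \<Longrightarrow> t = t'"
  using lab_facts(3) by metis

lemma mov_side: "(s, t) \<in> mov (side lab \<phi>) \<longleftrightarrow> s < t \<and> t \<in> points \<and> \<phi> s = lab t"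
  by (simp add: side_def)

context
  fixes \<phi> assumes st: "state \<phi>"
begin

lemma side_mate_dh: "c \<in> points \<Longrightarrow> \<phi> c = lab c \<longleftrightarrow> \<phi> (mate c) = lab (mate c)"
proof -
  have *: "\<phi> (mate c) = lab (mate c)" if c: "c \<in> points" "\<phi> c = lab c" for c
    using state_mate[OF st, of c] lab_facts[OF c(1)] c(2) by simp
  assume c: "c \<in> points"
  show ?thesis using *[OF c] *[of "mate c"] mate_points[OF c] by auto
qed

lemma dh_side: "c \<in> points \<Longrightarrow> pair c \<in> dh (side lab \<phi>) \<longleftrightarrow> \<phi> c = lab c"
proof -
  assume c: "c \<in> points"
  have "\<phi> c = lab c" if "c' \<in> points" "pair c = pair c'" "\<phi> c' = lab c'" for c'
  proof -
    have "c' = c \<or> c' = mate c" using pair_eq_iff[OF c that(1)] that(2) by simp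
    then show ?thesis using side_mate_dh[OF c] that(3) by auto
  qed
  then show ?thesis using c by (auto simp: side_def)
qed

lemma dh_side_pairs: "dh (side lab \<phi>) \<subseteq> pairs"
  by (auto simp: side_def pairs_def)

lemma moving_mate_free:
  assumes "s < t" "t \<in> points" "\<phi> s = lab t"
  shows "s \<in> points" "\<phi> (mate s) = 0"
  using state_mate[OF st, of s] lab_facts[OF assms(2)] assms state_points[OF st, of s] by auto

lemma side_gens: "side lab \<phi> \<in> gens"
proof (rule gensI)
  show "dh (side lab \<phi>) \<subseteq> pairs" by (rule dh_side_pairs)
  fix s t assume m: "(s, t) \<in> mov (side lab \<phi>)"
  then have m': "s < t" "t \<in> points" "\<phi> s = lab t" by (simp_all add: mov_side)
  note L = lab_facts[OF m'(2)]
  have s: "s \<in> points" using moving_mate_free[OF m'] by simp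
  show "s \<in> points \<and> t \<in> points \<and> s < t" using m' s by simp
  show "(s, t) = (s', t')" if "(s', t') \<in> mov (side lab \<phi>)" "pair s = pair s'" for s' t'
  proof -
    have n: "s' < t'" "t' \<in> points" "\<phi> s' = lab t'" using that by (simp_all add: mov_side)
    have "s' \<in> points" "\<phi> s' \<noteq> 0" using moving_mate_free[OF n] n lab_facts[OF n(2)] by simp_all
    moreover have "\<phi> (mate s) = 0" using moving_mate_free[OF m'] by simp
    ultimately have "s' = s" using pair_eq_iff[OF s, of s'] that(2) by auto
    then show ?thesis using lab_inj m' n by auto
  qed
  show "(s, t) = (s', t')" if "(s', t') \<in> mov (side lab \<phi>)" "pair t = pair t'" for s' t'
  proof -
    have n: "s' < t'" "t' \<in> points" "\<phi> s' = lab t'" using that by (simp_all add: mov_side)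
    have "t' \<noteq> mate t"
    proof
      assume "t' = mate t"
      then have "\<phi> s' = mate_label (\<phi> s)" using n m' L by simp
      then have "s = height (\<phi> s)" using state_end[OF st, of s s'] m' L by simp
      then show False using m' L by simp
    qed
    then have "t' = t" using pair_eq_iff[OF m'(2) n(2)] that(2) by auto
    then show ?thesis using state_inj[OF st, of s s'] m' n L by simp
  qed
  fix P assume P: "P \<in> dh (side lab \<phi>)"
  then obtain c where c: "c \<in> points" "P = pair c" "\<phi> c = lab c" by (auto simp: side_def)
  have nz: "\<phi> c = lab c" "\<phi> (mate c) = lab (mate c)" using c side_mate_dh[OF c(1)] by auto
  have no: "s \<noteq> x \<and> t \<noteq> x" if x: "x \<in> points" "\<phi> x = lab x" for x
  proof -
    have "s \<noteq> x" using lab_inj[OF m'(2) x(1)] m' x(2) by auto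
    moreover have "t \<noteq> x" using state_inj[OF st, of s x] m' x(2) L by auto
    ultimately show ?thesis by simp
  qed
  show "s \<notin> P \<and> t \<notin> P"
    using no[OF c(1) nz(1)] no[OF _ nz(2)] mate_points[OF c(1)] c(2) by (auto simp: pair_def)
qed

lemma left_idem_side:
  assumes c: "c \<in> points"
  shows "pair c \<in> left_idem (side lab \<phi>) \<longleftrightarrow> (\<exists>c'\<in>{c, mate c}. \<exists>t\<in>points. \<phi> c' = lab t)"
proof
  assume "pair c \<in> left_idem (side lab \<phi>)"
  then consider "pair c \<in> dh (side lab \<phi>)" | s t where "(s, t) \<in> mov (side lab \<phi>)" "pair c = pair s"
    unfolding left_idem_def by auto
  then show "\<exists>c'\<in>{c, mate c}. \<exists>t\<in>points. \<phi> c' = lab t"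
  proof cases
    case 1
    then show ?thesis using dh_side[OF c] c by blast
  next
    case 2
    then have m: "s < t" "t \<in> points" "\<phi> s = lab t" by (simp_all add: mov_side)
    then have "s = c \<or> s = mate c" using moving_mate_free(1)[OF m] pair_eq_iff[OF c, of s] 2(2) by simp
    then show ?thesis using m by auto
  qed
next
  assume "\<exists>c'\<in>{c, mate c}. \<exists>t\<in>points. \<phi> c' = lab t"
  then obtain c' t where c': "c' = c \<or> c' = mate c" "t \<in> points" "\<phi> c' = lab t" by blast
  have p: "c' \<in> points" "pair c' = pair c" using c'(1) c mate_points pair_mate by auto
  have "c' \<le> t" using state_bounds[OF st, of c'] lab_facts[OF c'(2)] c'(3) by simp
  then show "pair c \<in> left_idem (side lab \<phi>)"
  proof (cases "c' = t")
    case True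
    then show ?thesis using dh_side[OF p(1)] c'(3) p by (simp add: left_idem_def)
  next
    case False
    then have "(c', t) \<in> mov (side lab \<phi>)" using \<open>c' \<le> t\<close> c' by (simp add: mov_side)
    then have "pair c' \<in> left_idem (side lab \<phi>)" unfolding left_idem_def by (intro UnI2 image_eqI[of _ _ "(c', t)"]) simp_all
    then show ?thesis using p(2) by simp
  qed
qed

end
end

lemma decode_M_gens:
  assumes st: "state \<phi>"
  shows "decode \<phi> \<in> M_gens"
proof -
  note L = left_idem_side[OF is_side_left st] and R = left_idem_side[OF is_side_right st]
  have lr: "\<phi> x \<noteq> right_lab t'" if "\<phi> x = left_lab t" "t \<in> points" "t' \<in> points" for x t t'
    using that right_lab_le[of t'] left_lab_gt[of t] by auto
  have same: "\<phi> (mate c) = left_lab (mate c)" if "\<phi> c = left_lab t" "t \<in> points" "\<phi> (mate c) \<noteq> 0" for c t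
    using state_mate[OF st, of c] that lab_facts[OF is_side_left that(2)] by (auto split: if_splits)
  have same': "\<phi> (mate c) = right_lab (mate c)" if "\<phi> c = right_lab t" "t \<in> points" "\<phi> (mate c) \<noteq> 0" for c t
    using state_mate[OF st, of c] that lab_facts[OF is_side_right that(2)] by (auto split: if_splits)
  have sub: "left_idem (side lab \<phi>) \<subseteq> pairs" if "is_side lab" for lab
    using dh_side_pairs[OF that st] moving_mate_free(1)[OF that st]
    by (auto simp: left_idem_def pairs_def mov_side[OF that])
  have "pair c \<in> left_idem (side left_lab \<phi>) \<longleftrightarrow> pair c \<notin> left_idem (side right_lab \<phi>)" if c: "c \<in> points" for c
  proof
    assume "pair c \<in> left_idem (side left_lab \<phi>)"
    then obtain x t where x: "x \<in> {c, mate c}" "t \<in> points" "\<phi> x = left_lab t" unfolding L[OF c] by blast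
    show "pair c \<notin> left_idem (side right_lab \<phi>)"
    proof
      assume "pair c \<in> left_idem (side right_lab \<phi>)"
      then obtain y t' where y: "y \<in> {c, mate c}" "t' \<in> points" "\<phi> y = right_lab t'" unfolding R[OF c] by blast
      have "y \<noteq> x" using lr[OF x(3,2) y(2)] y(3) by auto
      then have "y = mate x" using x(1) y(1) mate_points[OF c] by auto
      then have "\<phi> y = left_lab y" "y \<in> points"
        using same[OF x(3,2)] y lab_facts[OF is_side_right y(2)] state_points[OF st, of y] by auto
      then show False using lr[of y y t'] y by auto
    qed
  next
    assume n: "pair c \<notin> left_idem (side right_lab \<phi>)"
    obtain x where x: "x \<in> {c, mate c}" "\<phi> x \<noteq> 0" using state_start[OF st, of c] c by (auto simp: points_def)
    have "\<exists>t\<in>points. \<phi> x = left_lab t"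
    proof (rule label_cases[of "\<phi> x"])
      assume "\<phi> x = right_lab (height (\<phi> x))" "height (\<phi> x) \<in> points"
      then show ?thesis using n x(1) unfolding R[OF c] by blast
    qed (use x state_bounds[OF st x(2)] in auto)
    then show "pair c \<in> left_idem (side left_lab \<phi>)" unfolding L[OF c] using x(1) by blast
  qed
  then have "left_idem (side left_lab \<phi>) \<inter> left_idem (side right_lab \<phi>) = {} \<and>
      left_idem (side left_lab \<phi>) \<union> left_idem (side right_lab \<phi>) = pairs"
    using sub[OF is_side_left] sub[OF is_side_right] unfolding pairs_def by blast
  then show ?thesis
    using side_gens[OF is_side_left st] side_gens[OF is_side_right st] by (simp add: M_gens_def decode_def)
qed

lemma decode_inj:
  assumes st: "state \<phi>" "state \<psi>" and eq: "decode \<phi> = decode \<psi>"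
  shows "\<phi> = \<psi>"
proof -
  have *: "\<psi> s = \<phi> s" if st: "state \<phi>" "state \<psi>" and eq: "decode \<phi> = decode \<psi>" and s: "\<phi> s \<noteq> 0" for \<phi> \<psi> s
  proof -
    have key: "\<psi> s = \<phi> s" if lab: "is_side lab" and e: "side lab \<phi> = side lab \<psi>"
      and l: "\<phi> s = lab (height (\<phi> s))" "height (\<phi> s) \<in> points" for lab
    proof (cases "s = height (\<phi> s)")
      case True
      then have "pair s \<in> dh (side lab \<phi>)" using dh_side[OF lab st(1)] l by simp
      then show ?thesis using dh_side[OF lab st(2), of s] e l True by simp
    next
      case False
      then have "s < height (\<phi> s)" using state_bounds[OF st(1) s] by simp
      then have "(s, height (\<phi> s)) \<in> mov (side lab \<phi>)" using l by (simp add: mov_side[OF lab])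
      then show ?thesis using l unfolding e by (simp add: mov_side[OF lab])
    qed
    show ?thesis
    proof (rule label_cases[of "\<phi> s"])
      assume "\<phi> s = right_lab (height (\<phi> s))" "height (\<phi> s) \<in> points"
      then show ?thesis using key[OF is_side_right] eq by (simp add: decode_def)
    next
      assume "\<phi> s = left_lab (height (\<phi> s))" "height (\<phi> s) \<in> points"
      then show ?thesis using key[OF is_side_left] eq by (simp add: decode_def)
    qed (use s state_bounds[OF st(1) s] in auto)
  qed
  show ?thesis
  proof
    fix s show "\<phi> s = \<psi> s" using *[OF st eq, of s] *[OF st(2,1) eq[symmetric], of s] by metis
  qed
qed

text \<open>The graph of the state that encodes a generator: at \<open>s\<close> there is a strand with label \<open>u\<close>.\<close>
definition enc_rel :: "gen \<times> gen \<Rightarrow> nat \<Rightarrow> nat \<Rightarrow> bool" where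
  "enc_rel x s u \<longleftrightarrow> (\<exists>t lab a. (a, lab) \<in> {(fst x, left_lab), (snd x, right_lab)} \<and> u = lab t \<and>
     ((s, t) \<in> mov a \<or> s = t \<and> s \<in> points \<and> pair s \<in> dh a))"

text \<open>Complementary left idempotents make the graph single-valued and give every pair a start.\<close>
lemma decode_surj:
  assumes x: "x \<in> M_gens"
  shows "\<exists>\<phi>. state \<phi> \<and> decode \<phi> = x"
proof -
  obtain a1 a2 where x': "x = (a1, a2)" by (cases x)
  have g: "a1 \<in> gens" "a2 \<in> gens" and idem: "left_idem a1 \<inter> left_idem a2 = {}" "left_idem a1 \<union> left_idem a2 = pairs"
    using x by (simp_all add: M_gens_def x')
  define T where "T a s t \<longleftrightarrow> (s, t) \<in> mov a \<or> s = t \<and> s \<in> points \<and> pair s \<in> dh a" for a s t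
  define R where "R = enc_rel x"
  have R: "R s u \<longleftrightarrow> (\<exists>t. u = left_lab t \<and> T a1 s t) \<or> (\<exists>t. u = right_lab t \<and> T a2 s t)" for s u
    by (auto simp: R_def enc_rel_def T_def x')
  have T_pt: "s \<in> points \<and> t \<in> points \<and> s \<le> t \<and> pair s \<in> left_idem a" if "a \<in> gens" "T a s t" for a s t
    using that mov_chord[OF that(1), of s t] by (force simp: T_def left_idem_def)
  have T_start: "s = s' \<and> t = t' \<or> s' = mate s \<and> s = t \<and> s' = t'" if a: "a \<in> gens" and T: "T a s t" "T a s' t'" and p: "pair s = pair s'" for a s t s' t'
  proof -
    have no: False if "(u, v) \<in> mov a" "pair w \<in> dh a" "pair u = pair w" for u v w
      using dh_mov[OF a that(2,1)] pair_self[of u] that(3) by simp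
    have "s' = s \<or> s' = mate s" using pair_eq_iff p T_pt[OF a T(1)] T_pt[OF a T(2)] by blast
    then show ?thesis using T mov_start[OF a _ _ p, of t t'] no[of s t s'] no[of s' t' s] p unfolding T_def by metis
  qed
  have T_end: "s = s' \<and> t = t' \<or> t' = mate t \<and> s = t \<and> s' = t'" if a: "a \<in> gens" and T: "T a s t" "T a s' t'" and p: "pair t = pair t'" for a s t s' t'
  proof -
    have no: False if "(u, v) \<in> mov a" "pair w \<in> dh a" "pair v = pair w" for u v w
      using dh_mov[OF a that(2,1)] pair_self[of v] that(3) by simp
    have "t' = t \<or> t' = mate t" using pair_eq_iff p T_pt[OF a T(1)] T_pt[OF a T(2)] by blast
    then show ?thesis using T mov_end[OF a _ _ p, of s s'] no[of s t t'] no[of s' t' t] p unfolding T_def by metis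
  qed
  have T_mate: "T a (mate s) (mate s)" if a: "a \<in> gens" and T: "T a s s" for a s
  proof -
    have "s \<in> points" "pair s \<in> dh a" using T mov_chord[OF a, of s s] by (auto simp: T_def)
    then show ?thesis using mate_points pair_mate by (simp add: T_def)
  qed
  have R_cases: "\<exists>lab a t. is_side lab \<and> a \<in> gens \<and> u = lab t \<and> T a s t \<and> s \<in> points \<and> t \<in> points \<and> s \<le> t \<and>
      (\<forall>s' t'. T a s' t' \<longrightarrow> R s' (lab t')) \<and>
      (\<forall>s' u'. R s' u' \<longrightarrow> (u' \<le> 4 * k \<longleftrightarrow> u \<le> 4 * k) \<or> pair s = pair s' \<longrightarrow> (\<exists>t'. u' = lab t' \<and> T a s' t' \<and> t' \<in> points))"
    if r: "R s u" for s u
  proof -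
    have dj: "pair s \<noteq> pair s'" if "T a1 s t" "T a2 s' t'" for s t s' t'
      using T_pt[OF g(1) that(1)] T_pt[OF g(2) that(2)] idem(1) by auto
    consider t where "u = left_lab t" "T a1 s t" | t where "u = right_lab t" "T a2 s t" using r R by blast
    then show ?thesis
    proof cases
      case 1
      have p: "s \<in> points" "t \<in> points" "s \<le> t" using T_pt[OF g(1) 1(2)] by auto
      have "\<exists>t'. u' = left_lab t' \<and> T a1 s' t' \<and> t' \<in> points" if "R s' u'" "(u' \<le> 4 * k \<longleftrightarrow> u \<le> 4 * k) \<or> pair s = pair s'" for s' u'
        using that 1 left_lab_gt[OF p(2)] T_pt[OF g(2), of s'] T_pt[OF g(1), of s'] right_lab_le dj[of s t s'] unfolding R
        by (metis not_le)
      then show ?thesis using 1 g p is_side_left R by (intro exI[of _ left_lab] exI[of _ a1] exI[of _ t]) blast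
    next
      case 2
      have p: "s \<in> points" "t \<in> points" "s \<le> t" using T_pt[OF g(2) 2(2)] by auto
      have "\<exists>t'. u' = right_lab t' \<and> T a2 s' t' \<and> t' \<in> points" if "R s' u'" "(u' \<le> 4 * k \<longleftrightarrow> u \<le> 4 * k) \<or> pair s = pair s'" for s' u'
        using that 2 right_lab_le[OF p(2)] T_pt[OF g(2), of s'] T_pt[OF g(1), of s'] left_lab_gt dj[of s' _ s t] unfolding R
        by (metis not_le)
      then show ?thesis using 2 g p is_side_right R by (intro exI[of _ right_lab] exI[of _ a2] exI[of _ t]) blast
    qed
  qed
  have R_nz: "u \<noteq> 0" if "R s u" for s u
    using R_cases[OF that] lab_facts(1) by blast
  have R_fun: "u = u'" if r: "R s u" "R s u'" for s u u'
  proof -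
    obtain lab a t where L: "is_side lab" "a \<in> gens" "u = lab t" "T a s t" "t \<in> points"
      and O: "\<forall>s' u'. R s' u' \<longrightarrow> (u' \<le> 4 * k \<longleftrightarrow> u \<le> 4 * k) \<or> pair s = pair s' \<longrightarrow> (\<exists>t'. u' = lab t' \<and> T a s' t' \<and> t' \<in> points)"
      using R_cases[OF r(1)] by blast
    obtain t' where "u' = lab t'" "T a s t'" using O r(2) by blast
    then show ?thesis using T_start[OF L(2,4), of s t'] L by auto
  qed
  define \<phi> where "\<phi> s = (if \<exists>u. R s u then THE u. R s u else 0)" for s
  have phi: "\<phi> s = u \<and> u \<noteq> 0 \<longleftrightarrow> R s u" for s u
  proof (cases "\<exists>u. R s u")
    case True
    then obtain u' where u': "R s u'" by blast
    then have "(THE u. R s u) = u'" using R_fun by blast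
    then show ?thesis using u' R_fun R_nz True by (auto simp: \<phi>_def)
  next
    case False
    then show ?thesis by (auto simp: \<phi>_def)
  qed
  have phi0: "\<phi> s = 0" if "\<And>u. \<not> R s u" for s using phi that by blast
  have st: "state \<phi>"
    unfolding state_def
  proof (intro conjI allI impI ballI)
    fix s assume s: "\<phi> s \<noteq> 0"
    then obtain lab a t where L: "is_side lab" "a \<in> gens" "\<phi> s = lab t" "T a s t" "s \<in> points" "t \<in> points" "s \<le> t"
      and I: "\<forall>s' t'. T a s' t' \<longrightarrow> R s' (lab t')"
      and O: "\<forall>s' u'. R s' u' \<longrightarrow> (u' \<le> 4 * k \<longleftrightarrow> \<phi> s \<le> 4 * k) \<or> pair s = pair s' \<longrightarrow> (\<exists>t'. u' = lab t' \<and> T a s' t' \<and> t' \<in> points)"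
      using R_cases[of s "\<phi> s"] phi by blast
    note F = lab_facts[OF L(1,6)]
    show "1 \<le> s" "s \<le> height (\<phi> s)" "\<phi> s \<le> 8 * k" using L F by (simp_all add: points_def)
    show "s = s'" if e: "\<phi> s = \<phi> s'" for s'
    proof -
      have "R s' (\<phi> s)" using phi[of s' "\<phi> s"] s e by simp
      then obtain t' where t': "\<phi> s = lab t'" "T a s' t'" "t' \<in> points" using O by blast
      then have "t' = t" using lab_inj[OF L(1)] L by metis
      then show ?thesis using T_end[OF L(2,4) t'(2)] mate_points[OF L(6)] by auto
    qed
    show "\<phi> (mate s) = (if height (\<phi> s) = s then mate_label (\<phi> s) else 0)"
    proof (cases "t = s")
      case True
      then have "T a (mate s) (mate s)" using T_mate L by simp
      then have "R (mate s) (lab (mate s))" using I by blast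
      then have "\<phi> (mate s) = lab (mate s)" using phi by blast
      then show ?thesis using True F L(3) by simp
    next
      case False
      have "\<not> R (mate s) u" for u
      proof
        assume r: "R (mate s) u"
        have "pair s = pair (mate s)" using pair_mate[OF L(5)] by simp
        then obtain t' where "T a (mate s) t'" using O r by blast
        then show False using T_start[OF L(2,4), of "mate s" t'] pair_mate[OF L(5)] mate_points[OF L(5)] False by auto
      qed
      then have "\<phi> (mate s) = 0" by (rule phi0)
      then show ?thesis using False F L(3) by simp
    qed
    show "s = height (\<phi> s)" if e: "\<phi> s' = mate_label (\<phi> s)" for s'
    proof -
      have m: "\<phi> s' = lab (mate t)" using e F L(3) by simp
      have mt: "mate t \<in> points" "mate t \<noteq> t" using mate_points[OF L(6)] by auto
      have n: "\<phi> s' \<noteq> 0" using m lab_facts(1)[OF L(1) mt(1)] by simp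
      have "\<phi> s' \<le> 4 * k \<longleftrightarrow> \<phi> s \<le> 4 * k"
        using e mate_label_range(6)[OF F(1,2)] L(3) by simp
      then obtain t' where t': "\<phi> s' = lab t'" "T a s' t'" "t' \<in> points" using O phi[of s' "\<phi> s'"] n by blast
      have "t' = mate t" using lab_inj[OF L(1) t'(3) mt(1)] t'(1) m by simp
      then have "s = t" using T_end[OF L(2,4) t'(2)] pair_mate[OF L(6)] mt by auto
      then show ?thesis using F L(3) by simp
    qed
  next
    fix s assume s: "s \<in> points"
    have "pair s \<in> left_idem a1 \<union> left_idem a2" using idem(2) s by (auto simp: pairs_def)
    then obtain a where a: "a \<in> {a1, a2}" "pair s \<in> left_idem a" by blast
    have "\<exists>c t. pair c = pair s \<and> c \<in> points \<and> T a c t"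
    proof -
      consider "pair s \<in> dh a" | c t where "(c, t) \<in> mov a" "pair s = pair c"
        using a(2) by (auto simp: left_idem_def)
      then show ?thesis
      proof cases
        case 1
        then show ?thesis using s by (auto simp: T_def)
      next
        case 2
        then have "c \<in> points" using mov_chord[of a c t] a(1) g by auto
        then show ?thesis using 2 by (auto simp: T_def)
      qed
    qed
    then obtain c t where c: "pair c = pair s" "c \<in> points" "T a c t" by blast
    then have "\<exists>u. R c u" using a(1) R by blast
    then have "\<phi> c \<noteq> 0" using phi by metis
    then show "\<phi> s \<noteq> 0 \<or> \<phi> (mate s) \<noteq> 0" using pair_eq_iff[OF s c(2)] c(1) by auto
  qed
  have sd: "side lab \<phi> = a" if "(a, lab) \<in> {(a1, left_lab), (a2, right_lab)}" for a lab
  proof -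
    have lab: "is_side lab" and a: "a \<in> gens" using that is_side_left is_side_right g by auto
    have "T a s t \<longleftrightarrow> t \<in> points \<and> \<phi> s = lab t" for s t
    proof
      assume t: "T a s t"
      then have "R s (lab t)" using R that by auto
      then show "t \<in> points \<and> \<phi> s = lab t" using phi T_pt[OF a t] by blast
    next
      assume t: "t \<in> points \<and> \<phi> s = lab t"
      then have "R s (lab t)" using phi[of s "lab t"] lab_facts(1)[OF lab] by simp
      then consider t' where "lab t = left_lab t'" "T a1 s t'" | t' where "lab t = right_lab t'" "T a2 s t'" using R by blast
      then show "T a s t"
      proof cases
        case 1
        have t': "t' \<in> points" using T_pt[OF g(1) 1(2)] by simp
        then have "lab = left_lab" "a = a1" using that 1(1) left_lab_gt[OF t'] right_lab_le[of t] t by auto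
        then show ?thesis using lab_inj[OF lab, of t t'] t t' 1 by simp
      next
        case 2
        have t': "t' \<in> points" using T_pt[OF g(2) 2(2)] by simp
        then have "lab = right_lab" "a = a2" using that 2(1) right_lab_le[OF t'] left_lab_gt[of t] t by auto
        then show ?thesis using lab_inj[OF lab, of t t'] t t' 2 by simp
      qed
    qed
    note TT = this
    have "mov (side lab \<phi>) = mov a"
    proof (intro set_eqI)
      fix z :: "nat \<times> nat" obtain s t where z: "z = (s, t)" by (cases z)
      show "z \<in> mov (side lab \<phi>) \<longleftrightarrow> z \<in> mov a"
        unfolding z mov_side[OF lab] using TT[of s t] mov_chord[OF a, of s t] by (auto simp: T_def)
    qed
    moreover have "dh (side lab \<phi>) = dh a"
    proof (intro set_eqI)
      fix P show "P \<in> dh (side lab \<phi>) \<longleftrightarrow> P \<in> dh a"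
      proof (cases "P \<in> pairs")
        case True
        then obtain c where c: "c \<in> points" "P = pair c" by (auto simp: pairs_def)
        have "pair c \<in> dh a \<longleftrightarrow> T a c c" using c mov_chord[OF a, of c c] by (auto simp: T_def)
        then show ?thesis using dh_side[OF lab st c(1)] TT[of c c] c by simp
      next
        case False
        then show ?thesis using dh_pairs[OF a] dh_side_pairs[OF lab st] by auto
      qed
    qed
    ultimately show ?thesis by (simp add: gen.expand)
  qed
  have "decode \<phi> = x" using sd by (simp add: decode_def x')
  then show ?thesis using st by blast
qed

section \<open>Arrows of the complex as steps\<close>

lemma switch_values:
  assumes st: "state \<chi>" and q: "\<chi> q \<noteq> 0" and p: "\<chi> p \<noteq> 0" and pq: "p < q" "q \<le> height (\<chi> p)"
  shows "switch \<chi> p q p = \<chi> q" "switch \<chi> p q q = \<chi> p" "s \<noteq> p \<Longrightarrow> s \<noteq> q \<Longrightarrow> s \<noteq> mate q \<Longrightarrow> switch \<chi> p q s = \<chi> s"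
    "p \<noteq> mate q" "q \<noteq> mate q"
  using state_moving_mate[OF st p _ q] state_mate_pt[OF st q] pq by (simp_all add: switch_def)

text \<open>The matched point of \<open>q\<close> carries at most constant strands, before and after.\<close>
lemma mov_side_switch:
  assumes lab: "is_side lab" and st: "state \<chi>" and q: "\<chi> q \<noteq> 0" and p: "\<chi> p \<noteq> 0" and pq: "p < q" "q \<le> height (\<chi> p)"
  shows "mov (side lab (switch \<chi> p q)) = {(s, t) \<in> mov (side lab \<chi>). s \<noteq> p \<and> s \<noteq> q} \<union>
      {(p, t) |t. t \<in> points \<and> \<chi> q = lab t} \<union> {(q, t) |t. q < t \<and> t \<in> points \<and> \<chi> p = lab t}"
proof (intro set_eqI)
  note v = switch_values[OF st q p pq]
  have st': "state (switch \<chi> p q)" by (rule state_switch[OF st q p pq])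
  fix z :: "nat \<times> nat"
  obtain s t where z: "z = (s, t)" by (cases z)
  have qh: "q \<le> height (\<chi> q)" using state_bounds[OF st q] by simp
  consider "s = p" | "s = q" | "s = mate q" | "s \<noteq> p" "s \<noteq> q" "s \<noteq> mate q" by blast
  then show "z \<in> mov (side lab (switch \<chi> p q)) \<longleftrightarrow> z \<in> {(s, t) \<in> mov (side lab \<chi>). s \<noteq> p \<and> s \<noteq> q} \<union>
      {(p, t) |t. t \<in> points \<and> \<chi> q = lab t} \<union> {(q, t) |t. q < t \<and> t \<in> points \<and> \<chi> p = lab t}"
  proof cases
    case 1
    then show ?thesis using v(1) pq(1) qh lab_facts(3)[OF lab, of t] unfolding z by (auto simp: mov_side[OF lab])
  next
    case 2
    then show ?thesis using v(2) pq(1) unfolding z by (auto simp: mov_side[OF lab])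
  next
    case 3
    have n: "switch \<chi> p q q \<noteq> 0" using v(2) p by simp
    have "\<not> (s < t \<and> t \<in> points \<and> \<chi> s = lab t)"
      using state_mate_constant[OF st q] lab_facts[OF lab, of t] 3 by auto
    moreover have "\<not> (s < t \<and> t \<in> points \<and> switch \<chi> p q s = lab t)"
      using state_mate_constant[OF st' n] lab_facts[OF lab, of t] 3 by auto
    ultimately show ?thesis using 3 v(4,5) unfolding z by (auto simp: mov_side[OF lab])
  next
    case 4
    then show ?thesis using v(3)[OF 4] unfolding z by (auto simp: mov_side[OF lab])
  qed
qed

lemma dh_side_switch:
  assumes lab: "is_side lab" and st: "state \<chi>" and q: "\<chi> q \<noteq> 0" and p: "\<chi> p \<noteq> 0" and pq: "p < q" "q \<le> height (\<chi> p)"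
  shows "dh (side lab (switch \<chi> p q)) = dh (side lab \<chi>) - {pair q} \<union> (if \<chi> p = lab q then {pair q} else {})"
proof (intro set_eqI)
  note v = switch_values[OF st q p pq]
  have st': "state (switch \<chi> p q)" by (rule state_switch[OF st q p pq])
  have qp: "q \<in> points" and pp: "p \<in> points" using state_points[OF st] p q by auto
  fix P
  show "P \<in> dh (side lab (switch \<chi> p q)) \<longleftrightarrow> P \<in> dh (side lab \<chi>) - {pair q} \<union> (if \<chi> p = lab q then {pair q} else {})"
  proof (cases "P \<in> pairs")
    case True
    then obtain c where c: "c \<in> points" "P = pair c" by (auto simp: pairs_def)
    have C: "pair c \<in> dh (side lab (switch \<chi> p q)) \<longleftrightarrow> switch \<chi> p q c = lab c" "pair c \<in> dh (side lab \<chi>) \<longleftrightarrow> \<chi> c = lab c"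
      using dh_side[OF lab st' c(1)] dh_side[OF lab st c(1)] by auto
    show ?thesis
    proof (cases "pair c = pair q")
      case True
      have "pair q \<in> dh (side lab (switch \<chi> p q)) \<longleftrightarrow> \<chi> p = lab q" using dh_side[OF lab st' qp] v(2) by simp
      then show ?thesis using True c by simp
    next
      case False
      then have n: "c \<noteq> q" "c \<noteq> mate q" using pair_mate[OF qp] by auto
      have qh: "q \<le> height (\<chi> q)" using state_bounds[OF st q] by simp
      have "switch \<chi> p q c = lab c \<longleftrightarrow> \<chi> c = lab c"
      proof (cases "c = p")
        case True
        then show ?thesis using v(1) pq qh lab_facts(3)[OF lab pp] by auto
      next
        case False
        then show ?thesis using v(3)[OF False n] by simp
      qed
      then show ?thesis using C c False by auto
    qed
  next
    case False
    then show ?thesis using dh_side_pairs[OF lab st] dh_side_pairs[OF lab st'] qp by (auto simp: pairs_def)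
  qed
qed

lemma side_switch_other:
  assumes lab: "is_side lab" and st: "state \<chi>" and q: "\<chi> q \<noteq> 0" and p: "\<chi> p \<noteq> 0" and pq: "p < q" "q \<le> height (\<chi> p)"
    and no: "\<And>t. t \<in> points \<Longrightarrow> \<chi> p \<noteq> lab t \<and> \<chi> q \<noteq> lab t"
  shows "side lab (switch \<chi> p q) = side lab \<chi>"
proof (rule gen.expand, intro conjI)
  have qp: "q \<in> points" using state_points[OF st q] .
  show "mov (side lab (switch \<chi> p q)) = mov (side lab \<chi>)"
  proof -
    have "{(p, t) |t. t \<in> points \<and> \<chi> q = lab t} = {}" "{(q, t) |t. q < t \<and> t \<in> points \<and> \<chi> p = lab t} = {}"
      using no by blast+
    moreover have "s \<noteq> p \<and> s \<noteq> q" if "(s, t) \<in> mov (side lab \<chi>)" for s t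
      using that no[of t] by (auto simp: mov_side[OF lab])
    ultimately show ?thesis unfolding mov_side_switch[OF lab st q p pq] by auto
  qed
  have "pair q \<notin> dh (side lab \<chi>)" using dh_side[OF lab st qp] no[OF qp] by simp
  then show "dh (side lab (switch \<chi> p q)) = dh (side lab \<chi>)"
    unfolding dh_side_switch[OF lab st q p pq] using no[OF qp] by simp
qed

text \<open>This covers uncrossings on the right and, read from the target of a step, also the crossings that
  steps create on the left.\<close>
lemma side_switch_same:
  assumes lab: "is_side lab" and st: "state \<chi>" and pq: "p < q"
    and t: "t \<in> points" "\<chi> p = lab t" and t': "t' \<in> points" "\<chi> q = lab t'" and c: "t' < t"
  shows "side lab (switch \<chi> p q) = uncrossed (side lab \<chi>) ((p, t), (q, t'))"
proof -
  note L = lab_facts[OF lab t(1)] and L' = lab_facts[OF lab t'(1)]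
  have p: "\<chi> p \<noteq> 0" and q: "\<chi> q \<noteq> 0" using L L' t t' by simp_all
  have qt: "q \<le> t'" using state_bounds[OF st q] L' t' by simp
  then have pq': "q \<le> height (\<chi> p)" using c L t by simp
  have qp: "q \<in> points" using state_points[OF st q] .
  have i: "x = t" if "x \<in> points" "\<chi> p = lab x" for x using lab_inj[OF lab that(1) t(1)] that(2) t(2) by simp
  have i': "x = t'" if "x \<in> points" "\<chi> q = lab x" for x using lab_inj[OF lab that(1) t'(1)] that(2) t'(2) by simp
  have m: "mov (side lab (switch \<chi> p q)) = mov (side lab \<chi>) - {(p, t), (q, t')} \<union> {(p, t'), (q, t)}"
    unfolding mov_side_switch[OF lab st q p pq pq']
  proof (intro set_eqI)
    fix z :: "nat \<times> nat" obtain x y where z: "z = (x, y)" by (cases z)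
    have a: "(p, y) \<in> mov (side lab \<chi>) \<Longrightarrow> y = t" "(q, y) \<in> mov (side lab \<chi>) \<Longrightarrow> y = t'"
      using i[of y] i'[of y] by (auto simp: mov_side[OF lab])
    show "z \<in> {(s, t) \<in> mov (side lab \<chi>). s \<noteq> p \<and> s \<noteq> q} \<union>
      {(p, t) |t. t \<in> points \<and> \<chi> q = lab t} \<union> {(q, t) |t. q < t \<and> t \<in> points \<and> \<chi> p = lab t} \<longleftrightarrow>
      z \<in> mov (side lab \<chi>) - {(p, t), (q, t')} \<union> {(p, t'), (q, t)}"
    proof (cases "x = p \<or> x = q")
      case False
      then show ?thesis unfolding z by auto
    next
      case True
      then show ?thesis unfolding z using pq qt c t t' i[of y] i'[of y] a by auto
    qed
  qed
  have "\<chi> p \<noteq> lab q" using i[OF qp] qt c by auto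
  moreover have "pair q \<in> dh (side lab \<chi>) \<longleftrightarrow> q = t'"
    using dh_side[OF lab st qp] i'[OF qp] t' by auto
  ultimately have "dh (side lab (switch \<chi> p q)) = dh (side lab \<chi>) - (if q = t' then {pair q} else {})"
    unfolding dh_side_switch[OF lab st q p pq pq'] by auto
  then show ?thesis using m by (simp add: gen.expand)
qed

text \<open>If the labels belong to different sides, each side sees one strand whose start is lowered: on the
  right along the step, on the left against it.\<close>
lemma side_switch_lower:
  assumes lab: "is_side lab" and st: "state \<chi>" and pq: "p < q" "q \<le> height (\<chi> p)" and p: "\<chi> p \<noteq> 0"
    and r: "r \<in> points" "\<chi> q = lab r" and no: "\<And>t. t \<in> points \<Longrightarrow> \<chi> p \<noteq> lab t"
  shows "side lab (switch \<chi> p q) = lowered (side lab \<chi>) p q r"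
proof -
  note L = lab_facts[OF lab r(1)]
  have q: "\<chi> q \<noteq> 0" using L r by simp
  have qp: "q \<in> points" using state_points[OF st q] .
  have i: "x = r" if "x \<in> points" "\<chi> q = lab x" for x using lab_inj[OF lab that(1) r(1)] that(2) r(2) by simp
  have m: "mov (side lab (switch \<chi> p q)) = mov (side lab \<chi>) - {(q, r)} \<union> {(p, r)}"
    unfolding mov_side_switch[OF lab st q p pq]
  proof (intro set_eqI)
    fix z :: "nat \<times> nat" obtain x y where z: "z = (x, y)" by (cases z)
    have a: "(p, y) \<notin> mov (side lab \<chi>)" "(q, y) \<in> mov (side lab \<chi>) \<Longrightarrow> y = r"
      using i[of y] no[of y] by (auto simp: mov_side[OF lab])
    show "z \<in> {(s, t) \<in> mov (side lab \<chi>). s \<noteq> p \<and> s \<noteq> q} \<union>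
      {(p, t) |t. t \<in> points \<and> \<chi> q = lab t} \<union> {(q, t) |t. q < t \<and> t \<in> points \<and> \<chi> p = lab t} \<longleftrightarrow>
      z \<in> mov (side lab \<chi>) - {(q, r)} \<union> {(p, r)}"
    proof (cases "x = p \<or> x = q")
      case False
      then show ?thesis unfolding z by auto
    next
      case True
      then show ?thesis unfolding z using pq r no[of y] i[of y] a by auto
    qed
  qed
  have "pair q \<in> dh (side lab \<chi>) \<longleftrightarrow> q = r"
    using dh_side[OF lab st qp] i[OF qp] r by auto
  then have "dh (side lab (switch \<chi> p q)) = dh (side lab \<chi>) - (if q = r then {pair q} else {})"
    unfolding dh_side_switch[OF lab st q p pq] using no[OF qp] by auto
  then show ?thesis using m by (simp add: lowered_def gen.expand)
qed

lemma switch_inj_edges: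
  assumes st: "state \<phi>" and e: "(p, q) \<in> edges \<phi>" "(p', q') \<in> edges \<phi>" and eq: "switch \<phi> p q = switch \<phi> p' q'"
  shows "(p, q) = (p', q')"
proof -
  note E = edgeD[OF e(1)] and E' = edgeD[OF e(2)]
  note v = switch_values[OF st E(2,3,1,5)] and v' = switch_values[OF st E'(2,3,1,5)]
  have qh: "q \<le> height (\<phi> q)" using state_bounds[OF st E(2)] by simp
  have st': "state (switch \<phi> p' q')" by (rule state_edge[OF st e(2)])
  have x: "switch \<phi> p' q' p = \<phi> q" using v(1) eq by simp
  consider "p = p'" | "p = q'" | "p = mate q'" | "p \<noteq> p'" "p \<noteq> q'" "p \<noteq> mate q'" by blast
  then show ?thesis
  proof cases
    case 1
    then have "\<phi> q = \<phi> q'" using x v'(1) by simp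
    then show ?thesis using state_inj[OF st E(2)] 1 by simp
  next
    case 2
    then show ?thesis using x v'(2) E(4) E'(4) by simp
  next
    case 3
    have "switch \<phi> p' q' q' \<noteq> 0" using v'(2) E'(3) by simp
    then have "height (\<phi> q) = p" using state_mate_constant[OF st', of q'] x 3 E(2) by auto
    then show ?thesis using qh E(1) by simp
  next
    case 4
    then show ?thesis using x v'(3)[OF 4] E(4) by simp
  qed
qed

lemma state_label_cases:
  assumes "state \<phi>" "\<phi> s \<noteq> 0"
  obtains t where "t \<in> points" "\<phi> s = right_lab t" "\<phi> s \<le> 4 * k" "t = height (\<phi> s)"
    | t where "t \<in> points" "\<phi> s = left_lab t" "4 * k < \<phi> s" "t = height (\<phi> s)"
  using label_cases[of "\<phi> s"] state_bounds[OF assms] assms(2) by metis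

lemma dh_mem_side:
  assumes "is_side lab" "state \<phi>" "(s, t) \<in> mov (side lab \<phi>) \<or> s = t \<and> s \<in> points \<and> pair s \<in> dh (side lab \<phi>)"
  shows "t \<in> points" "\<phi> s = lab t"
  using assms dh_side[OF assms(1,2)] by (auto simp: mov_side)

lemma mem_side_iff:
  assumes lab: "is_side lab" and st: "state \<phi>" and t: "t \<in> points" "\<phi> s = lab t"
  shows "(s, t) \<in> mov (side lab \<phi>) \<or> s = t \<and> s \<in> points \<and> pair s \<in> dh (side lab \<phi>)"
proof -
  have "s \<le> t" using state_bounds[OF st, of s] lab_facts[OF lab t(1)] t by simp
  then show ?thesis using t dh_side[OF lab st] by (cases "s = t") (auto simp: mov_side[OF lab])
qed

text \<open>The arrows on the left go from a term of the differential to the generator it comes from, so that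
  generator has to be recovered from the term.\<close>
lemma uncrossed_recover:
  assumes b: "b \<in> gens" "b' \<in> gens" and u: "l \<in> uncrossable b" "l \<in> uncrossable b'" and eq: "uncrossed b l = uncrossed b' l"
  shows "b = b'"
proof -
  obtain s t s' t' where l: "l = ((s, t), (s', t'))" by (metis prod.exhaust)
  have rec: "mov b = mov (uncrossed b l) - {(s, t'), (s', t)} \<union> {(s, t)} \<union> (if s' = t' then {} else {(s', t')}) \<and>
      dh b = dh (uncrossed b l) \<union> (if s' = t' then {pair s'} else {})"
    if b: "b \<in> gens" and u: "l \<in> uncrossable b" for b
  proof -
    note F = uncrossable_facts[OF b u[unfolded l]]
    have "(s, t') \<notin> mov b" using mov_start[OF b F(1), of s t'] F(3) by auto
    moreover have "(s', t) \<notin> mov b" using mov_end[OF b F(1), of s' t] F(2) by auto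
    moreover have "(s', t') \<in> mov b \<longleftrightarrow> s' \<noteq> t'" using F(9) mov_chord[OF b, of s' t'] by auto
    moreover have "s' = t' \<Longrightarrow> pair s' \<in> dh b" using F(9) mov_chord[OF b, of s' t'] by auto
    ultimately show ?thesis using F(1-3) by (auto simp: l)
  qed
  show ?thesis using rec[OF b(1) u(1)] rec[OF b(2) u(2)] eq by (simp add: gen.expand)
qed

text \<open>The same for the factor \<open>c\<close> of \<open>a(\<xi>) c\<close>.\<close>
lemma lowered_recover:
  assumes c: "c \<in> gens" "c' \<in> gens" and pq: "p < q" and l: "lowerable c p q r" "lowerable c' p q r" and eq: "lowered c p q r = lowered c' p q r"
  shows "c = c'"
proof -
  have rec: "mov c = mov (lowered c p q r) - {(p, r)} \<union> (if q = r then {} else {(q, r)}) \<and>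
      dh c = dh (lowered c p q r) \<union> (if q = r then {pair q} else {})"
    if c: "c \<in> gens" and l: "lowerable c p q r" for c
  proof -
    have qr: "(q, r) \<in> mov c \<or> q = r \<and> pair q \<in> dh c" using l by (simp add: lowerable_def)
    have "(p, r) \<notin> mov c"
      using qr mov_end[OF c, of p r q r] pq dh_mov[OF c, of "pair q" p r] pair_self[of r] by auto
    moreover have "(q, r) \<in> mov c \<longleftrightarrow> q \<noteq> r" using qr mov_chord[OF c, of q r] by auto
    moreover have "q = r \<Longrightarrow> pair q \<in> dh c" using qr mov_chord[OF c, of q r] by auto
    ultimately show ?thesis using pq by (auto simp: lowered_def)
  qed
  show ?thesis using rec[OF c(1) l(1)] rec[OF c(2) l(2)] eq by (simp add: gen.expand)
qed

text \<open>The two labels of a step can lie both on the right, both on the left, or the larger one on the left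
  and the smaller one on the right. These are the three kinds of arrows of the differential; for each
  of them, one lemma goes from steps to arrows and one goes back.\<close>
lemma edge_right:
  assumes st: "state \<phi>" and e: "(p, q) \<in> edges \<phi>" and u: "\<phi> p \<le> 4 * k"
  shows "((p, \<phi> p), (q, \<phi> q)) \<in> uncrossable (side right_lab \<phi>)"
    "decode (switch \<phi> p q) = (side left_lab \<phi>, uncrossed (side right_lab \<phi>) ((p, \<phi> p), (q, \<phi> q)))"
proof -
  note E = edgeD[OF e]
  have t: "\<phi> p \<in> points" "\<phi> q \<in> points" using E(2,3,4) u by (simp_all add: points_def)
  have r: "\<phi> p = right_lab (\<phi> p)" "\<phi> q = right_lab (\<phi> q)" by (simp_all add: right_lab_def)
  have qv: "q \<le> \<phi> q" using state_bounds[OF st E(2)] lab_facts(3)[OF is_side_right t(2)] by (simp add: right_lab_def)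
  have "\<not> (p < x \<and> x < q \<and> \<phi> q < y \<and> y < \<phi> p)" if "(x, y) \<in> mov (side right_lab \<phi>)" for x y
    using E(6)[of x] that by (auto simp: mov_side[OF is_side_right] right_lab_def)
  moreover have "(p, \<phi> p) \<in> mov (side right_lab \<phi>)"
    using E(1,4) qv t(1) r by (simp add: mov_side[OF is_side_right])
  ultimately show "((p, \<phi> p), (q, \<phi> q)) \<in> uncrossable (side right_lab \<phi>)"
    using mem_side_iff[OF is_side_right st t(2) r(2)] E(1,4) unfolding uncrossable_def by blast
  have "side left_lab (switch \<phi> p q) = side left_lab \<phi>"
    by (rule side_switch_other[OF is_side_left st E(2,3,1,5)]) (use left_lab_gt u E(4) in fastforce)
  moreover have "side right_lab (switch \<phi> p q) = uncrossed (side right_lab \<phi>) ((p, \<phi> p), (q, \<phi> q))"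
    by (rule side_switch_same[OF is_side_right st E(1) t(1) r(1) t(2) r(2) E(4)])
  ultimately show "decode (switch \<phi> p q) = (side left_lab \<phi>, uncrossed (side right_lab \<phi>) ((p, \<phi> p), (q, \<phi> q)))"
    by (simp add: decode_def)
qed

lemma uncrossable_right_edge:
  assumes st: "state \<phi>" and u: "((s, t), (s', t')) \<in> uncrossable (side right_lab \<phi>)"
  shows "(s, s') \<in> edges \<phi>" "\<phi> s = t" "\<phi> s' = t'" "\<phi> s \<le> 4 * k"
proof -
  note g = side_gens[OF is_side_right st]
  note F = uncrossable_facts[OF g u]
  show s: "\<phi> s = t" using F(1) by (simp add: mov_side[OF is_side_right] right_lab_def)
  show s': "\<phi> s' = t'" using dh_mem_side(2)[OF is_side_right st, of s' t'] F(7,9) by (auto simp: right_lab_def)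
  show le: "\<phi> s \<le> 4 * k" using s F(6) by (simp add: points_def)
  have free: "\<not> (s < x \<and> x < s' \<and> t' < y \<and> y < t)" if "(x, y) \<in> mov (side right_lab \<phi>)" for x y
    using u that by (auto simp: uncrossable_def)
  have "\<not> (\<phi> s' < \<phi> x \<and> \<phi> x < \<phi> s)" if x: "s < x" "x < s'" for x
  proof
    assume a: "\<phi> s' < \<phi> x \<and> \<phi> x < \<phi> s"
    then have "(x, \<phi> x) \<in> mov (side right_lab \<phi>)"
      using x s s' le F(4) by (simp add: mov_side[OF is_side_right] right_lab_def points_def)
    then show False using free x a s s' by blast
  qed
  moreover have "height (\<phi> s) = t" using s le by (simp add: height_def)
  ultimately show "(s, s') \<in> edges \<phi>" using F(2,3,4) s s' F(8) by (auto simp: edges_def points_def)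
qed

lemma edge_left:
  assumes st: "state \<phi>" and e: "(p, q) \<in> edges \<phi>" and u: "4 * k < \<phi> q"
  defines "b \<equiv> side left_lab (switch \<phi> p q)" and "l \<equiv> ((p, height (\<phi> q)), (q, height (\<phi> p)))"
  shows "l \<in> uncrossable b" "side left_lab \<phi> = uncrossed b l" "decode (switch \<phi> p q) = (b, side right_lab \<phi>)"
proof -
  note E = edgeD[OF e] and L = is_side_left
  define \<psi> where "\<psi> = switch \<phi> p q"
  define t where "t = height (\<phi> p)"
  define t' where "t' = height (\<phi> q)"
  have st': "state \<psi>" unfolding \<psi>_def by (rule state_edge[OF st e])
  note v = switch_values[OF st E(2,3,1,5), folded \<psi>_def]
  have tp: "t \<in> points" "\<phi> p = left_lab t"
    using state_label_cases[OF st E(3)] u E(4) right_lab_le unfolding t_def by (metis leD less_trans)+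
  have tq: "t' \<in> points" "\<phi> q = left_lab t'"
    using state_label_cases[OF st E(2)] u right_lab_le unfolding t'_def by (metis leD)+
  have c: "t < t'" using E(4) tp tq by (auto simp: left_lab_def)
  have tp': "\<psi> p = left_lab t'" and tq': "\<psi> q = left_lab t" using v tp tq by simp_all
  have "switch \<psi> p q = \<phi>" unfolding \<psi>_def by (rule switch_switch[OF st E(2,3,1,5)])
  then show "side left_lab \<phi> = uncrossed b l"
    using side_switch_same[OF L st' E(1) tq(1) tp' tp(1) tq' c] by (simp add: b_def l_def t_def t'_def \<psi>_def)
  have "\<not> (p < x \<and> x < q \<and> t < y \<and> y < t')" if m: "(x, y) \<in> mov b" for x y
  proof
    assume a: "p < x \<and> x < q \<and> t < y \<and> y < t'"
    have y: "x < y" "y \<in> points" "\<psi> x = left_lab y" using m by (simp_all add: b_def \<psi>_def[symmetric] mov_side[OF L])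
    have "x \<noteq> mate q"
      using state_mate_constant[OF st', of q] v(2) E(3) y lab_facts[OF L y(2)] by auto
    then have "\<phi> x = left_lab y" using v(3)[of x] a y by simp
    then have "\<phi> q < \<phi> x" "\<phi> x < \<phi> p" using a tp tq y(2) by (auto simp: left_lab_def points_def)
    then show False using E(6)[of x] a by simp
  qed
  moreover have "(p, t') \<in> mov b" using tp' tq(1) c E(5) E(1) by (simp add: b_def \<psi>_def[symmetric] mov_side[OF L] t_def)
  moreover have "(q, t) \<in> mov b \<or> q = t \<and> q \<in> points \<and> pair q \<in> dh b"
    using mem_side_iff[OF L st' tp(1) tq'] by (simp add: b_def \<psi>_def)
  ultimately show "l \<in> uncrossable b" using E(1) c by (auto simp: uncrossable_def l_def t_def t'_def)
  have "side right_lab (switch \<phi> p q) = side right_lab \<phi>"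
    by (rule side_switch_other[OF is_side_right st E(2,3,1,5)]) (use right_lab_le u E(4) in fastforce)
  then show "decode (switch \<phi> p q) = (b, side right_lab \<phi>)" by (simp add: decode_def b_def)
qed

lemma uncrossable_left_edge:
  assumes st: "state \<phi>" and b: "b \<in> gens" and u: "((s, t), (s', t')) \<in> uncrossable b"
    and eq: "side left_lab \<phi> = uncrossed b ((s, t), (s', t'))"
  shows "(s, s') \<in> edges \<phi>" "4 * k < \<phi> s'" "b = side left_lab (switch \<phi> s s')"
proof -
  note F = uncrossable_facts[OF b u] and L = is_side_left
  have m: "mov (side left_lab \<phi>) = mov b - {(s, t), (s', t')} \<union> {(s, t'), (s', t)}" by (simp add: eq)
  have "(s, t') \<in> mov (side left_lab \<phi>)" "(s', t) \<in> mov (side left_lab \<phi>)" unfolding m by simp_all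
  then have s: "\<phi> s = left_lab t'" "\<phi> s' = left_lab t" by (simp_all add: mov_side[OF L])
  show u': "4 * k < \<phi> s'" using s left_lab_gt[OF F(6)] by simp
  have "\<not> (\<phi> s' < \<phi> x \<and> \<phi> x < \<phi> s)" if x: "s < x" "x < s'" for x
  proof
    assume a: "\<phi> s' < \<phi> x \<and> \<phi> x < \<phi> s"
    have xz: "\<phi> x \<noteq> 0" using a by simp
    obtain y where y: "y \<in> points" "\<phi> x = left_lab y"
      using state_label_cases[OF st xz] u' a by (metis leD less_trans)
    have yt: "t' < y" "y < t" using a s y(2) by (auto simp: left_lab_def)
    have "(x, y) \<in> mov (side left_lab \<phi>)" using y yt x F(4) by (simp add: mov_side[OF L])
    then have "(x, y) \<in> mov b" using m x by auto
    then show False using u x yt by (auto simp: uncrossable_def)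
  qed
  then show e: "(s, s') \<in> edges \<phi>"
    using F(2,3,4) s u' lab_facts(3)[OF L F(8)] F(6) by (auto simp: edges_def left_lab_def points_def)
  note EL = edge_left[OF st e u']
  have h: "height (\<phi> s') = t" "height (\<phi> s) = t'" using s lab_facts(3)[OF L F(8)] lab_facts(3)[OF L F(6)] by simp_all
  have g: "side left_lab (switch \<phi> s s') \<in> gens" by (rule side_gens[OF L state_edge[OF st e]])
  show "b = side left_lab (switch \<phi> s s')"
    by (rule uncrossed_recover[OF b g u]) (use EL h eq in simp_all)
qed

lemma edge_chord:
  assumes st: "state \<phi>" and e: "(p, q) \<in> edges \<phi>" and u: "\<phi> q \<le> 4 * k" "4 * k < \<phi> p"
  defines "c \<equiv> side left_lab (switch \<phi> p q)"
  shows "(p, q) \<in> chords" "lowerable c p q (height (\<phi> p))" "side left_lab \<phi> = lowered c p q (height (\<phi> p))"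
    "lowerable (side right_lab \<phi>) p q (\<phi> q)" "decode (switch \<phi> p q) = (c, lowered (side right_lab \<phi>) p q (\<phi> q))"
proof -
  note E = edgeD[OF e] and L = is_side_left and R = is_side_right
  define \<psi> where "\<psi> = switch \<phi> p q"
  define r where "r = height (\<phi> p)"
  define t where "t = \<phi> q"
  have st': "state \<psi>" unfolding \<psi>_def by (rule state_edge[OF st e])
  note v = switch_values[OF st E(2,3,1,5), folded \<psi>_def]
  have rp: "r \<in> points" "\<phi> p = left_lab r"
    using state_label_cases[OF st E(3)] u(2) unfolding r_def by (metis leD)+
  have tq: "t \<in> points" "\<phi> q = right_lab t" using u(1) E(2) by (simp_all add: t_def points_def right_lab_def)
  have pp: "p \<in> points" "q \<in> points" using state_points[OF st] E(2,3) by simp_all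
  show "(p, q) \<in> chords" using pp E(1) by (simp add: chords_def)
  have nl: "\<phi> q \<noteq> left_lab x" "\<phi> p \<noteq> right_lab x" if "x \<in> points" for x
    using left_lab_gt[OF that] right_lab_le[OF that] u by auto
  have mp: "\<phi> (mate p) = 0" using state_mate[OF st E(3)] E(1,5) by auto
  have qm: "q \<noteq> mate p" using E(2) mp by auto
  have mpq: "mate p \<noteq> mate q" "mate p \<noteq> p" using mate_points pp E(1) by (metis nat_neq_iff)+
  have mp': "\<psi> (mate p) = 0" using v(3)[of "mate p"] mp mpq qm by simp
  have qr: "q \<le> r" using E(5) by (simp add: r_def)
  have "switch \<psi> p q = \<phi>" unfolding \<psi>_def by (rule switch_switch[OF st E(2,3,1,5)])
  moreover have "q \<le> height (\<psi> p)" "\<psi> p \<noteq> 0" using v state_bounds[OF st E(2)] E(2) by simp_all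
  moreover have "\<psi> q = left_lab r" "\<And>x. x \<in> points \<Longrightarrow> \<psi> p \<noteq> left_lab x" using v rp nl by simp_all
  ultimately show "side left_lab \<phi> = lowered c p q (height (\<phi> p))"
    using side_switch_lower[OF L st' E(1) _ _ rp(1)] unfolding c_def \<psi>_def[symmetric] r_def[symmetric] by metis
  have "side right_lab (switch \<phi> p q) = lowered (side right_lab \<phi>) p q t"
    by (rule side_switch_lower[OF R st E(1,5,3) tq]) (use nl in simp)
  then show "decode (switch \<phi> p q) = (c, lowered (side right_lab \<phi>) p q (\<phi> q))" by (simp add: decode_def c_def t_def)
  have "pair p \<notin> left_idem (side right_lab \<phi>)"
    unfolding left_idem_side[OF R st pp(1)] using nl(2) mp lab_facts(1)[OF R] by auto
  moreover have "\<not> (p < x \<and> x < q \<and> \<phi> q < y)" if "(x, y) \<in> mov (side right_lab \<phi>)" for x y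
    using E(6)[of x] that u by (auto simp: mov_side[OF R] right_lab_def points_def)
  ultimately show "lowerable (side right_lab \<phi>) p q (\<phi> q)"
    using mem_side_iff[OF R st tq] by (auto simp: lowerable_def t_def)
  have "pair p \<notin> left_idem (side left_lab \<psi>)"
    unfolding left_idem_side[OF L st' pp(1)] using nl(1) v(1) mp' lab_facts(1)[OF L] by auto
  moreover have "\<not> (p < x \<and> x < q \<and> r < y)" if m: "(x, y) \<in> mov (side left_lab \<psi>)" for x y
  proof
    assume a: "p < x \<and> x < q \<and> r < y"
    have y: "x < y" "y \<in> points" "\<psi> x = left_lab y" using m by (simp_all add: mov_side[OF L])
    have "x \<noteq> mate q"
      using state_mate_constant[OF st', of q] v(2) E(3) y lab_facts[OF L y(2)] by auto
    then have "\<phi> x = left_lab y" using v(3)[of x] a y by simp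
    then have "\<phi> q < \<phi> x" "\<phi> x < \<phi> p" using a rp y(2) u left_lab_gt[OF y(2)] by (auto simp: left_lab_def points_def)
    then show False using E(6)[of x] a by simp
  qed
  moreover have "\<psi> q = left_lab r" using v rp by simp
  ultimately show "lowerable c p q (height (\<phi> p))"
    using mem_side_iff[OF L st' rp(1)] by (auto simp: lowerable_def c_def \<psi>_def[symmetric] r_def[symmetric])
qed

lemma chord_edge:
  assumes st: "state \<phi>" and pq: "(p, q) \<in> chords" and c: "c \<in> gens" and lc: "lowerable c p q r"
    and eq: "side left_lab \<phi> = lowered c p q r" and lt: "lowerable (side right_lab \<phi>) p q t"
  shows "(p, q) \<in> edges \<phi>" "\<phi> q \<le> 4 * k" "4 * k < \<phi> p" "\<phi> q = t" "height (\<phi> p) = r" "c = side left_lab (switch \<phi> p q)"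
proof -
  note L = is_side_left and R = is_side_right
  have pq': "p \<in> points" "q \<in> points" "p < q" using pq by (auto simp: chords_def)
  have m: "mov (side left_lab \<phi>) = mov c - {(q, r)} \<union> {(p, r)}" by (simp add: eq lowered_def)
  then have "(p, r) \<in> mov (side left_lab \<phi>)" by simp
  then have r: "p < r" "r \<in> points" "\<phi> p = left_lab r" by (simp_all add: mov_side[OF L])
  have qr: "q \<le> r" using lc mov_chord[OF c, of q r] by (auto simp: lowerable_def)
  have t: "t \<in> points" "\<phi> q = right_lab t"
    using dh_mem_side[OF R st, of q t] lt pq' by (auto simp: lowerable_def)
  show qt: "\<phi> q = t" using t by (simp add: right_lab_def)
  show q4: "\<phi> q \<le> 4 * k" using t right_lab_le by simp
  show p4: "4 * k < \<phi> p" using r left_lab_gt by simp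
  show h: "height (\<phi> p) = r" using r lab_facts(3)[OF L r(2)] by simp
  have "q \<le> t" using state_bounds[OF st, of q] lab_facts[OF R t(1)] t by simp
  have "\<not> (\<phi> q < \<phi> x \<and> \<phi> x < \<phi> p)" if x: "p < x" "x < q" for x
  proof
    assume a: "\<phi> q < \<phi> x \<and> \<phi> x < \<phi> p"
    have xz: "\<phi> x \<noteq> 0" using a by simp
    show False
    proof (rule state_label_cases[OF st xz])
      fix y assume y: "y \<in> points" "\<phi> x = right_lab y"
      then have "t < y" using a qt by (simp add: right_lab_def)
      then have "(x, y) \<in> mov (side right_lab \<phi>)" using y x \<open>q \<le> t\<close> by (simp add: mov_side[OF R])
      then show False using lt x \<open>t < y\<close> by (auto simp: lowerable_def)
    next
      fix y assume y: "y \<in> points" "\<phi> x = left_lab y"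
      then have "r < y" using a r by (auto simp: left_lab_def)
      then have "(x, y) \<in> mov (side left_lab \<phi>)" using y x qr by (simp add: mov_side[OF L])
      then have "(x, y) \<in> mov c" using m x by auto
      then show False using lc x \<open>r < y\<close> by (auto simp: lowerable_def)
    qed
  qed
  then show e: "(p, q) \<in> edges \<phi>" using pq'(3) q4 p4 h qr t lab_facts(1)[OF R t(1)] by (auto simp: edges_def)
  note EC = edge_chord[OF st e q4 p4]
  have g: "side left_lab (switch \<phi> p q) \<in> gens" by (rule side_gens[OF L state_edge[OF st e]])
  show "c = side left_lab (switch \<phi> p q)"
    by (rule lowered_recover[OF c g pq'(3) lc]) (use EC h eq in simp_all)
qed

section \<open>The differential and the multiplicities on states\<close>

lemma decode_switch_inj:
  assumes "state \<phi>" "(p, q) \<in> edges \<phi>" "(p', q') \<in> edges \<phi>" "decode (switch \<phi> p q) = decode (switch \<phi> p' q')"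
  shows "(p, q) = (p', q')"
  using switch_inj_edges[OF assms(1-3)] decode_inj[OF state_edge[OF assms(1,2)] state_edge[OF assms(1,3)] assms(4)] by simp

definition to_gens :: "(nat \<Rightarrow> nat) f2span \<Rightarrow> (gen \<times> gen) f2span" where
  "to_gens = lin (\<lambda>\<phi>. basis (decode \<phi>))"

lemma sum_right_edges:
  assumes st: "state \<phi>"
  shows "(\<Sum>b | b \<in> gens \<and> occurs_in b (strands_diff (emb (side right_lab \<phi>))). basis (side left_lab \<phi>, b)) =
    (\<Sum>(p, q)\<in>{(p, q) \<in> edges \<phi>. \<phi> p \<le> 4 * k}. basis (decode (switch \<phi> p q)))"
proof -
  let ?E = "{(p, q) \<in> edges \<phi>. \<phi> p \<le> 4 * k}"
  let ?a = "side right_lab \<phi>"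
  let ?h = "\<lambda>(p, q). snd (decode (switch \<phi> p q))"
  note g = side_gens[OF is_side_right st]
  have eq: "decode (switch \<phi> p q) = (side left_lab \<phi>, ?h (p, q))" if "(p, q) \<in> ?E" for p q
    using edge_right(2)[OF st, of p q] that by simp
  have "{b. b \<in> gens \<and> occurs_in b (strands_diff (emb ?a))} = ?h ` ?E"
  proof (intro equalityI subsetI)
    fix b assume "b \<in> {b. b \<in> gens \<and> occurs_in b (strands_diff (emb ?a))}"
    then obtain l where l: "l \<in> uncrossable ?a" "b = uncrossed ?a l" using occurs_in_diff[OF g] by blast
    obtain s t s' t' where ll: "l = ((s, t), (s', t'))" by (metis prod.exhaust)
    note U = uncrossable_right_edge[OF st l(1)[unfolded ll]]
    have "b = ?h (s, s')" using edge_right(2)[OF st U(1,4)] U(2,3) l(2) ll by simp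
    then show "b \<in> ?h ` ?E" using U(1,4) by blast
  next
    fix b assume "b \<in> ?h ` ?E"
    then obtain p q where pq: "(p, q) \<in> edges \<phi>" "\<phi> p \<le> 4 * k" "b = snd (decode (switch \<phi> p q))" by auto
    note R = edge_right[OF st pq(1,2)]
    have "b = uncrossed ?a ((p, \<phi> p), (q, \<phi> q))" using R(2) pq(3) by simp
    then show "b \<in> {b. b \<in> gens \<and> occurs_in b (strands_diff (emb ?a))}"
      using R(1) occurs_in_diff[OF g] uncrossed_gens[OF g R(1)] by blast
  qed
  moreover have "inj_on ?h ?E"
  proof (rule inj_onI)
    fix x y assume xy: "x \<in> ?E" "y \<in> ?E" "?h x = ?h y"
    obtain p q p' q' where x: "x = (p, q)" "y = (p', q')" by (metis prod.exhaust)
    have "decode (switch \<phi> p q) = decode (switch \<phi> p' q')" using eq[of p q] eq[of p' q'] xy x by simp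
    then show "x = y" using decode_switch_inj[OF st, of p q p' q'] xy x by simp
  qed
  ultimately show ?thesis
    by (simp only: sum.reindex o_def) (rule sum.cong[OF refl], use eq in \<open>auto split: prod.splits\<close>)
qed

lemma sum_left_edges:
  assumes st: "state \<phi>"
  shows "(\<Sum>b | b \<in> gens \<and> occurs_in (side left_lab \<phi>) (strands_diff (emb b)). basis (b, side right_lab \<phi>)) =
    (\<Sum>(p, q)\<in>{(p, q) \<in> edges \<phi>. 4 * k < \<phi> q}. basis (decode (switch \<phi> p q)))"
proof -
  let ?E = "{(p, q) \<in> edges \<phi>. 4 * k < \<phi> q}"
  let ?a = "side left_lab \<phi>"
  let ?h = "\<lambda>(p, q). fst (decode (switch \<phi> p q))"
  have eq: "decode (switch \<phi> p q) = (?h (p, q), side right_lab \<phi>)" if "(p, q) \<in> ?E" for p q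
    using edge_left(3)[OF st, of p q] that by simp
  have "{b. b \<in> gens \<and> occurs_in ?a (strands_diff (emb b))} = ?h ` ?E"
  proof (intro equalityI subsetI)
    fix b assume "b \<in> {b. b \<in> gens \<and> occurs_in ?a (strands_diff (emb b))}"
    then obtain l where b: "b \<in> gens" and l: "l \<in> uncrossable b" "?a = uncrossed b l" using occurs_in_diff by blast
    obtain s t s' t' where ll: "l = ((s, t), (s', t'))" by (metis prod.exhaust)
    note U = uncrossable_left_edge[OF st b l[unfolded ll]]
    have "b = ?h (s, s')" using U(3) by (simp add: decode_def)
    then show "b \<in> ?h ` ?E" using U(1,2) by blast
  next
    fix b assume "b \<in> ?h ` ?E"
    then obtain p q where pq: "(p, q) \<in> edges \<phi>" "4 * k < \<phi> q" "b = fst (decode (switch \<phi> p q))" by auto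
    note R = edge_left[OF st pq(1,2)]
    have b: "b = side left_lab (switch \<phi> p q)" using pq(3) by (simp add: decode_def)
    have "b \<in> gens" unfolding b by (rule side_gens[OF is_side_left state_edge[OF st pq(1)]])
    then show "b \<in> {b. b \<in> gens \<and> occurs_in ?a (strands_diff (emb b))}"
      using R(1,2) occurs_in_diff unfolding b by blast
  qed
  moreover have "inj_on ?h ?E"
  proof (rule inj_onI)
    fix x y assume xy: "x \<in> ?E" "y \<in> ?E" "?h x = ?h y"
    obtain p q p' q' where x: "x = (p, q)" "y = (p', q')" by (metis prod.exhaust)
    have "decode (switch \<phi> p q) = decode (switch \<phi> p' q')" using eq[of p q] eq[of p' q'] xy x by simp
    then show "x = y" using decode_switch_inj[OF st, of p q p' q'] xy x by simp
  qed
  ultimately show ?thesis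
    by (simp only: sum.reindex o_def) (rule sum.cong[OF refl], use eq in \<open>auto split: prod.splits\<close>)
qed

lemma sum_chord_edges:
  assumes st: "state \<phi>"
  shows "(\<Sum>(\<xi>, c, b) | \<xi> \<in> chords \<and> (c, b) \<in> M_gens \<and>
          strands_mult (chord_elt \<xi>) (emb c) = emb (side left_lab \<phi>) \<and>
          strands_mult (chord_elt \<xi>) (emb (side right_lab \<phi>)) = emb b. basis (c, b)) =
    (\<Sum>(p, q)\<in>{(p, q) \<in> edges \<phi>. \<phi> q \<le> 4 * k \<and> 4 * k < \<phi> p}. basis (decode (switch \<phi> p q)))"
proof -
  let ?E = "{(p, q) \<in> edges \<phi>. \<phi> q \<le> 4 * k \<and> 4 * k < \<phi> p}"
  let ?a1 = "side left_lab \<phi>" and ?a2 = "side right_lab \<phi>"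
  let ?h = "\<lambda>(p, q). ((p, q), decode (switch \<phi> p q))"
  note g1 = side_gens[OF is_side_left st] and g2 = side_gens[OF is_side_right st]
  have "{(\<xi>, c, b). \<xi> \<in> chords \<and> (c, b) \<in> M_gens \<and> strands_mult (chord_elt \<xi>) (emb c) = emb ?a1 \<and>
      strands_mult (chord_elt \<xi>) (emb ?a2) = emb b} = ?h ` ?E"
  proof (intro equalityI subsetI)
    fix z assume "z \<in> {(\<xi>, c, b). \<xi> \<in> chords \<and> (c, b) \<in> M_gens \<and> strands_mult (chord_elt \<xi>) (emb c) = emb ?a1 \<and>
      strands_mult (chord_elt \<xi>) (emb ?a2) = emb b}"
    then obtain p q c b where z: "z = ((p, q), c, b)" and pq: "(p, q) \<in> chords" and cb: "(c, b) \<in> M_gens"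
      and m: "strands_mult (chord_elt (p, q)) (emb c) = emb ?a1" "strands_mult (chord_elt (p, q)) (emb ?a2) = emb b" by auto
    have cb': "c \<in> gens" "b \<in> gens" using cb by (auto simp: M_gens_def)
    obtain r where r: "lowerable c p q r" "?a1 = lowered c p q r" using m(1) strands_mult_chord_eq_iff[OF cb'(1) g1 pq] by blast
    obtain t where t: "lowerable ?a2 p q t" "b = lowered ?a2 p q t" using m(2) strands_mult_chord_eq_iff[OF g2 cb'(2) pq] by blast
    note C = chord_edge[OF st pq cb'(1) r t(1)]
    have "decode (switch \<phi> p q) = (c, b)" using edge_chord(5)[OF st C(1-3)] C(4,6) t(2) by simp
    then show "z \<in> ?h ` ?E" using C(1-3) z by (intro image_eqI[of _ _ "(p, q)"]) auto
  next
    fix z assume "z \<in> ?h ` ?E"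
    then obtain p q where pq: "(p, q) \<in> edges \<phi>" "\<phi> q \<le> 4 * k" "4 * k < \<phi> p" and z: "z = ((p, q), decode (switch \<phi> p q))" by auto
    note C = edge_chord[OF st pq]
    have M: "decode (switch \<phi> p q) \<in> M_gens" by (rule decode_M_gens[OF state_edge[OF st pq(1)]])
    define c where "c = side left_lab (switch \<phi> p q)"
    define b where "b = lowered ?a2 p q (\<phi> q)"
    have decode: "decode (switch \<phi> p q) = (c, b)" using C(5) by (simp add: c_def b_def)
    have cb: "c \<in> gens" "b \<in> gens" using M decode by (auto simp: M_gens_def)
    have "strands_mult (chord_elt (p, q)) (emb c) = emb ?a1"
      using strands_mult_chord_eq_iff[OF cb(1) g1 C(1)] C(2,3) by (auto simp: c_def)
    moreover have "strands_mult (chord_elt (p, q)) (emb ?a2) = emb b"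
      using strands_mult_chord_eq_iff[OF g2 cb(2) C(1)] C(4) by (auto simp: b_def)
    ultimately show "z \<in> {(\<xi>, c, b). \<xi> \<in> chords \<and> (c, b) \<in> M_gens \<and> strands_mult (chord_elt \<xi>) (emb c) = emb ?a1 \<and>
      strands_mult (chord_elt \<xi>) (emb ?a2) = emb b}" using C(1) M unfolding z decode by simp
  qed
  moreover have "inj_on ?h ?E" by (rule inj_onI) (auto split: prod.splits)
  ultimately show ?thesis
    by (simp only: sum.reindex o_def) (rule sum.cong[OF refl], auto split: prod.splits)
qed

theorem d_gen_decode:
  assumes st: "state \<phi>"
  shows "d_gen (decode \<phi>) = to_gens (boundary \<phi>)"
proof -
  let ?F = "\<lambda>(p, q). basis (decode (switch \<phi> p q))"
  let ?E1 = "{(p, q) \<in> edges \<phi>. \<phi> p \<le> 4 * k}"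
  let ?E2 = "{(p, q) \<in> edges \<phi>. 4 * k < \<phi> q}"
  let ?E3 = "{(p, q) \<in> edges \<phi>. \<phi> q \<le> 4 * k \<and> 4 * k < \<phi> p}"
  have fin: "finite ?E1" "finite ?E2" "finite ?E3"
    by (rule finite_subset[OF _ finite_edges[OF st]]; auto)+
  have un: "edges \<phi> = ?E1 \<union> ?E2 \<union> ?E3" by auto
  have dj: "?E1 \<inter> ?E2 = {}" "(?E1 \<union> ?E2) \<inter> ?E3 = {}"
    using edgeD(4)[of _ _ \<phi>] by (auto, fastforce)
  have "to_gens (boundary \<phi>) = sum ?F (edges \<phi>)"
    unfolding to_gens_def boundary_def lin_sum by (simp add: case_prod_beta)
  also have "\<dots> = sum ?F ?E1 + sum ?F ?E2 + sum ?F ?E3"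
    by (subst un) (simp add: sum.union_disjoint fin dj)
  finally show ?thesis
    unfolding decode_def d_gen.simps sum_right_edges[OF st] sum_left_edges[OF st] sum_chord_edges[OF st]
    by (simp add: decode_def)
qed

lemma multiplicity_decode:
  assumes st: "state \<phi>"
  shows "multiplicity (decode \<phi>) c = card (cover \<phi> c)"
proof -
  note L = is_side_left and R = is_side_right
  have im: "card (covering (side lab \<phi>) c) = card {s \<in> cover \<phi> c. \<exists>t\<in>points. \<phi> s = lab t}" if lab: "is_side lab" for lab
  proof -
    have "inj_on fst (covering (side lab \<phi>) c)"
      using lab_inj[OF lab] by (auto simp: inj_on_def covering_def mov_side[OF lab])
    moreover have "fst ` covering (side lab \<phi>) c = {s \<in> cover \<phi> c. \<exists>t\<in>points. \<phi> s = lab t}"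
    proof (intro equalityI subsetI)
      fix s assume "s \<in> fst ` covering (side lab \<phi>) c"
      then show "s \<in> {s \<in> cover \<phi> c. \<exists>t\<in>points. \<phi> s = lab t}"
        using lab_facts(3)[OF lab] by (auto simp: covering_def cover_def mov_side[OF lab])
    next
      fix s assume "s \<in> {s \<in> cover \<phi> c. \<exists>t\<in>points. \<phi> s = lab t}"
      then obtain t where "s \<le> c" "c < height (\<phi> s)" "t \<in> points" "\<phi> s = lab t" by (auto simp: cover_def)
      then show "s \<in> fst ` covering (side lab \<phi>) c"
        using lab_facts(3)[OF lab, of t] by (intro image_eqI[of _ _ "(s, t)"]) (auto simp: covering_def mov_side[OF lab])
    qed
    ultimately show ?thesis by (metis card_image)
  qed
  have un: "cover \<phi> c = {s \<in> cover \<phi> c. \<exists>t\<in>points. \<phi> s = left_lab t} \<union> {s \<in> cover \<phi> c. \<exists>t\<in>points. \<phi> s = right_lab t}"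
  proof -
    have "(\<exists>t\<in>points. \<phi> s = left_lab t) \<or> (\<exists>t\<in>points. \<phi> s = right_lab t)" if "s \<in> cover \<phi> c" for s
    proof -
      have "\<phi> s \<noteq> 0" using that height_0 unfolding cover_def by (metis mem_Collect_eq not_less_zero)
      then show ?thesis using state_label_cases[OF st] by metis
    qed
    then show ?thesis by auto
  qed
  have "{s \<in> cover \<phi> c. \<exists>t\<in>points. \<phi> s = left_lab t} \<inter> {s \<in> cover \<phi> c. \<exists>t\<in>points. \<phi> s = right_lab t} = {}"
    using left_lab_gt right_lab_le by fastforce
  then have "card (cover \<phi> c) = card {s \<in> cover \<phi> c. \<exists>t\<in>points. \<phi> s = left_lab t} + card {s \<in> cover \<phi> c. \<exists>t\<in>points. \<phi> s = right_lab t}"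
    by (subst un) (rule card_Un_disjoint, auto simp: finite_cover)
  then show ?thesis by (simp add: decode_def im[OF L] im[OF R])
qed

text \<open>The double horizontals are determined by the right idempotent and the moving strands, which is how
  \<open>set_mov\<close> works.\<close>
lemma dh_from_right_idem:
  assumes a: "a \<in> gens"
  shows "dh a = {P \<in> right_idem a. \<forall>(s, t)\<in>mov a. t \<notin> P}"
  using dh_mov[OF a] pair_self by (auto simp: right_idem_def)

lemma right_idem_side:
  assumes lab: "is_side lab" and st: "state \<psi>"
  shows "right_idem (side lab \<psi>) = {pair t |t. t \<in> points \<and> (\<exists>s. \<psi> s = lab t)}"
proof (intro equalityI subsetI)
  fix P assume "P \<in> right_idem (side lab \<psi>)"
  then show "P \<in> {pair t |t. t \<in> points \<and> (\<exists>s. \<psi> s = lab t)}"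
    by (auto simp: right_idem_def side_def)
next
  fix P assume "P \<in> {pair t |t. t \<in> points \<and> (\<exists>s. \<psi> s = lab t)}"
  then obtain s t where t: "P = pair t" "t \<in> points" "\<psi> s = lab t" by blast
  then consider "(s, t) \<in> mov (side lab \<psi>)" | "s = t" "pair s \<in> dh (side lab \<psi>)"
    using mem_side_iff[OF lab st t(2,3)] by blast
  then show "P \<in> right_idem (side lab \<psi>)"
  proof cases
    case 1
    then show ?thesis unfolding right_idem_def t(1) by (intro UnI2 image_eqI[of _ _ "(s, t)"]) simp_all
  next
    case 2
    then show ?thesis unfolding right_idem_def t(1) by simp
  qed
qed

lemma set_mov_side:
  assumes "is_side lab" "state \<psi>" "right_idem a = right_idem (side lab \<psi>)" "V = mov (side lab \<psi>)"
  shows "set_mov a V = side lab \<psi>"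
  using dh_from_right_idem[OF side_gens[OF assms(1,2)]] assms(3,4) by (simp add: set_mov_def gen.expand)

lemma right_idem_switch:
  assumes lab: "is_side lab" and st: "state \<chi>" and q: "\<chi> q \<noteq> 0" and p: "\<chi> p \<noteq> 0" and pq: "p < q" "q \<le> height (\<chi> p)"
  shows "right_idem (side lab (switch \<chi> p q)) = right_idem (side lab \<chi>)"
proof -
  have half: "right_idem (side lab \<chi>) \<subseteq> right_idem (side lab (switch \<chi> p q))"
    if st: "state \<chi>" and q: "\<chi> q \<noteq> 0" and p: "\<chi> p \<noteq> 0" and pq: "p < q" "q \<le> height (\<chi> p)" for \<chi>
  proof
    note v = switch_values[OF st q p pq]
    have st': "state (switch \<chi> p q)" by (rule state_switch[OF st q p pq])
    fix P assume "P \<in> right_idem (side lab \<chi>)"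
    then obtain s t where t: "P = pair t" "t \<in> points" "\<chi> s = lab t" unfolding right_idem_side[OF lab st] by blast
    have "\<exists>s' t'. t' \<in> points \<and> pair t' = pair t \<and> switch \<chi> p q s' = lab t'"
    proof -
      consider "s = p" | "s = q" | "s = mate q" | "s \<noteq> p" "s \<noteq> q" "s \<noteq> mate q" by blast
      then show ?thesis
      proof cases
        case 1
        then show ?thesis using v(2) t by (intro exI[of _ q] exI[of _ t]) simp
      next
        case 2
        then show ?thesis using v(1) t by (intro exI[of _ p] exI[of _ t]) simp
      next
        case 3
        have qp: "q \<in> points" by (rule state_points[OF st q])
        have "t = mate q" using state_mate_constant[OF st q] t 3 lab_facts[OF lab t(2)] by auto
        moreover have "\<chi> q = lab q" using side_mate_dh[OF lab st qp] t 3 calculation by simp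
        ultimately show ?thesis using v(1) qp pair_mate[OF qp] by (intro exI[of _ p] exI[of _ q]) simp
      next
        case 4
        then show ?thesis using v(3) t by (intro exI[of _ s] exI[of _ t]) simp
      qed
    qed
    then show "P \<in> right_idem (side lab (switch \<chi> p q))" unfolding right_idem_side[OF lab st'] t(1) mem_Collect_eq by metis
  qed
  note v = switch_values[OF st q p pq]
  have "q \<le> height (switch \<chi> p q p)" using v(1) state_bounds[OF st q] by simp
  then have "right_idem (side lab (switch \<chi> p q)) \<subseteq> right_idem (side lab \<chi>)"
    using half[OF state_switch[OF st q p pq]] v(1,2) p q pq switch_switch[OF st q p pq] by simp
  then show ?thesis using half[OF st q p pq] by blast
qed

lemma set_mov_switch:
  assumes "is_side lab" "state \<chi>" "\<chi> q \<noteq> 0" "\<chi> p \<noteq> 0" "p < q" "q \<le> height (\<chi> p)"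
    and "V = mov (side lab (switch \<chi> p q))"
  shows "set_mov (side lab \<chi>) V = side lab (switch \<chi> p q)"
  using set_mov_side[OF assms(1) state_switch[OF assms(2-6)] _ assms(7)] right_idem_switch[OF assms(1-6)] by simp

section \<open>The key segment\<close>

text \<open>The surgered circle is a single cycle of arcs. Cut open at arc \<open>4k\<close>, which contains the basepoint, it
  is a line, and the order of the segments is the order along this line.\<close>
definition steps_to_top :: "nat \<Rightarrow> nat" where
  "steps_to_top i = (LEAST n. (surgery_next k mate ^^ n) i = 4 * k)"

lemma surgery_next_points: "i \<in> points \<Longrightarrow> surgery_next k mate i \<in> points"
  using mate_points[of 1] mate_points[of "i + 1"] by (auto simp: surgery_next_def points_def)

lemma surgery_next_inj: "i \<in> points \<Longrightarrow> j \<in> points \<Longrightarrow> surgery_next k mate i = surgery_next k mate j \<Longrightarrow> i = j"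
proof -
  assume i: "i \<in> points" and j: "j \<in> points" and eq: "surgery_next k mate i = surgery_next k mate j"
  define u where "u x = (if x = 4 * k then 1 else x + 1)" for x :: nat
  have "u i \<in> points" "u j \<in> points" using i j by (auto simp: u_def points_def)
  moreover have "mate (u i) = mate (u j)" using eq by (simp add: surgery_next_def u_def)
  ultimately have "u i = u j" using mate_points by metis
  then show "i = j" using i j by (cases "i = 4 * k"; cases "j = 4 * k") (simp_all add: u_def points_def)
qed

lemma surgery_next_funpow_inj:
  "i \<in> points \<Longrightarrow> j \<in> points \<Longrightarrow> (surgery_next k mate ^^ n) i = (surgery_next k mate ^^ n) j \<Longrightarrow> i = j"
proof (induction n arbitrary: i j)
  case (Suc n)
  have "surgery_next k mate i = surgery_next k mate j"
    by (rule Suc.IH) (use Suc.prems surgery_next_points in \<open>simp_all add: funpow_swap1\<close>)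
  then show ?case using surgery_next_inj Suc.prems by blast
qed simp

lemma steps_to_top:
  assumes i: "i \<in> points"
  shows "(surgery_next k mate ^^ steps_to_top i) i = 4 * k"
proof -
  have "4 * k \<in> points" using i by (auto simp: points_def)
  then have "\<exists>n. (surgery_next k mate ^^ n) i = 4 * k" using single_circle[of i "4 * k"] i by (simp add: points_def)
  then show ?thesis unfolding steps_to_top_def by (rule LeastI_ex)
qed

lemma steps_to_top_next:
  assumes i: "i \<in> segments"
  shows "steps_to_top i = Suc (steps_to_top (surgery_next k mate i))"
proof -
  have ip: "i \<in> points" and ne: "i \<noteq> 4 * k" using i by (auto simp: segments_def points_def)
  have n0: "(surgery_next k mate ^^ 0) i \<noteq> 4 * k" using ne by simp
  show ?thesis
    unfolding steps_to_top_def using Least_Suc[where P = "\<lambda>n. (surgery_next k mate ^^ n) i = 4 * k", OF steps_to_top[OF ip] n0]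
    by (simp add: funpow_swap1)
qed

lemma steps_to_top_inj: "i \<in> points \<Longrightarrow> j \<in> points \<Longrightarrow> steps_to_top i = steps_to_top j \<Longrightarrow> i = j"
  using steps_to_top surgery_next_funpow_inj by metis

lemma predecessor: "{(q, r). r \<in> segments \<and> q = mate (r + 1) \<and> q \<noteq> 4 * k} =
    {(q, r). r \<in> segments \<and> q = surgery_next k mate r \<and> q \<in> segments}"
proof -
  have "mate (r + 1) = surgery_next k mate r" "mate (r + 1) \<noteq> 4 * k \<longleftrightarrow> surgery_next k mate r \<in> segments" if "r \<in> segments" for r
    using that mate_points[of "r + 1"] by (auto simp: surgery_next_def segments_def points_def)
  then have "r \<in> segments \<and> q = mate (r + 1) \<and> q \<noteq> 4 * k \<longleftrightarrow> r \<in> segments \<and> q = surgery_next k mate r \<and> q \<in> segments" for q r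
    by metis
  then show ?thesis by (simp only:)
qed

lemma less_Z_iff:
  assumes "p \<in> segments" "p' \<in> segments"
  shows "less_Z p p' \<longleftrightarrow> steps_to_top p < steps_to_top p'"
proof
  define r where "r = {(q, r). r \<in> segments \<and> q = surgery_next k mate r \<and> q \<in> segments}"
  assume "less_Z p p'"
  then have "(p, p') \<in> r\<^sup>+" by (simp only: less_Z_def predecessor r_def)
  then show "steps_to_top p < steps_to_top p'"
  proof (induction rule: trancl_induct)
    case (base y)
    then show ?case using steps_to_top_next by (auto simp: r_def)
  next
    case (step y z)
    then have "steps_to_top z = Suc (steps_to_top y)" using steps_to_top_next by (auto simp: r_def)
    then show ?case using step.IH by simp
  qed
next
  define r where "r = {(q, r). r \<in> segments \<and> q = surgery_next k mate r \<and> q \<in> segments}"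
  assume less: "steps_to_top p < steps_to_top p'"
  have "(p, x) \<in> r\<^sup>+" if "x \<in> segments" "steps_to_top x = steps_to_top p + Suc n" for n x
    using that
  proof (induction n arbitrary: x)
    case 0
    have xp: "x \<in> points" "p \<in> points" using 0 assms by (auto simp: segments_def points_def)
    have "steps_to_top (surgery_next k mate x) = steps_to_top p" using steps_to_top_next[OF 0(1)] 0(2) by simp
    then have "surgery_next k mate x = p" using steps_to_top_inj[OF surgery_next_points[OF xp(1)] xp(2)] by simp
    then show ?case using 0 assms(1) by (auto simp: r_def)
  next
    case (Suc n)
    have xp: "x \<in> points" using Suc.prems by (auto simp: segments_def points_def)
    let ?y = "surgery_next k mate x"
    have s: "steps_to_top ?y = steps_to_top p + Suc n" using steps_to_top_next[OF Suc.prems(1)] Suc.prems(2) by simp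
    have "?y \<noteq> 4 * k"
    proof
      assume "?y = 4 * k"
      then have "steps_to_top ?y = 0" unfolding steps_to_top_def by (intro Least_eq_0) simp
      then show False using s by simp
    qed
    then have y: "?y \<in> segments" using surgery_next_points[OF xp] by (auto simp: segments_def points_def)
    have "(?y, x) \<in> r" using y Suc.prems(1) by (simp add: r_def)
    then show ?case using Suc.IH[OF y s] by (rule trancl_into_trancl[rotated])
  qed
  from this[OF assms(2), of "steps_to_top p' - steps_to_top p - 1"] less
  show "less_Z p p'" by (simp add: less_Z_def predecessor[simplified] r_def)
qed

text \<open>The segment just above the point matched to the upper end of the key segment precedes it in the
  order. This is why its multiplicity is not one, which makes the upper end of the key segment a pivot.\<close>
lemma key_exists:
  assumes ex: "\<exists>p\<in>segments. m p = 1"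
  defines "key \<equiv> THE p. p \<in> segments \<and> m p = 1 \<and> (\<forall>p'\<in>segments. m p' = 1 \<and> p' \<noteq> p \<longrightarrow> less_Z p p')"
  shows "key \<in> segments" "m key = (1::nat)" "mate (key + 1) \<in> segments \<Longrightarrow> m (mate (key + 1)) \<noteq> 1"
proof -
  let ?P = "\<lambda>p. p \<in> segments \<and> m p = 1 \<and> (\<forall>p'\<in>segments. m p' = 1 \<and> p' \<noteq> p \<longrightarrow> less_Z p p')"
  obtain p where p: "p \<in> segments \<and> m p = 1" "\<And>p'. p' \<in> segments \<and> m p' = 1 \<Longrightarrow> steps_to_top p \<le> steps_to_top p'"
    using ex_has_least_nat[of "\<lambda>p. p \<in> segments \<and> m p = 1" _ steps_to_top] ex by metis
  have sp: "x \<in> points" if "x \<in> segments" for x using that by (auto simp: segments_def points_def)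
  have "?P p"
  proof (intro conjI ballI impI)
    fix p' assume p': "p' \<in> segments" "m p' = 1 \<and> p' \<noteq> p"
    then have "steps_to_top p \<noteq> steps_to_top p'" using steps_to_top_inj sp p(1) by metis
    then show "less_Z p p'" using p p' less_Z_iff[of p p'] by (simp add: le_neq_implies_less)
  qed (use p in simp_all)
  moreover have "x = p" if "?P x" for x
  proof (rule ccontr)
    assume "x \<noteq> p"
    then have "less_Z x p" "less_Z p x" using that \<open>?P p\<close> by auto
    then show False using less_Z_iff that p(1) by auto
  qed
  ultimately have key: "key = p" unfolding key_def by (rule the_equality)
  show "key \<in> segments" "m key = 1" using p key by auto
  show "m (mate (key + 1)) \<noteq> 1" if q: "mate (key + 1) \<in> segments"
  proof
    assume a: "m (mate (key + 1)) = 1"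
    have "surgery_next k mate p = mate (key + 1)" using key p(1) by (auto simp: surgery_next_def segments_def)
    then have "steps_to_top p = Suc (steps_to_top (mate (key + 1)))" using steps_to_top_next[of p] p(1) by simp
    then show False using p(2)[of "mate (key + 1)"] q a by simp
  qed
qed

section \<open>The correction term and the main terms\<close>

text \<open>Two strands change sides, and all ends keep their heights. A clash of labels would involve a double
  horizontal at \<open>e\<close> and at the matched point, where the two moving strands end already.\<close>
lemma exchange_state:
  assumes st: "state \<phi>" and e: "e \<in> points" and w: "w < e" "\<phi> w = e" and r: "r \<noteq> mate e" "\<phi> r = 8 * k + 1 - mate e"
  shows "state (\<phi>(r := mate e, w := 8 * k + 1 - e))"
proof -
  define q where "q = mate e"
  define \<psi> where "\<psi> = \<phi>(r := q, w := 8 * k + 1 - e)"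
  have e': "1 \<le> e" "e \<le> 4 * k" using e by (auto simp: points_def)
  have q: "1 \<le> q" "q \<le> 4 * k" "q \<noteq> e" "mate q = e" using mate_pt[OF e'] by (simp_all add: q_def)
  have rl: "\<phi> r = 8 * k + 1 - q" using r by (simp add: q_def)
  have wr: "w \<noteq> r" using w rl q e' by auto
  have v: "\<psi> r = q" "\<psi> w = 8 * k + 1 - e" "\<And>s. s \<noteq> r \<Longrightarrow> s \<noteq> w \<Longrightarrow> \<psi> s = \<phi> s" using wr by (simp_all add: \<psi>_def)
  have wz: "\<phi> w \<noteq> 0" and rz: "\<phi> r \<noteq> 0" using w rl e' q by auto
  have he: "height e = e" "height q = q" using e' q by (simp_all add: height_def)
  have hl: "height (8 * k + 1 - e) = e" "height (8 * k + 1 - q) = q" "mate_label (8 * k + 1 - e) = 8 * k + 1 - q"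
    "mate_label (8 * k + 1 - q) = 8 * k + 1 - e"
    using left_label[OF e'] left_label[OF q(1,2)] q(4) by (simp_all add: q_def)
  have ml: "mate_label e = q" "mate_label q = e" using e' q by (simp_all add: mate_label_def q_def)
  have rq: "r \<noteq> q" using r by (simp add: q_def)
  have mw: "\<phi> (mate w) = 0" using state_mate[OF st wz] w he by simp
  have mr: "\<phi> (mate r) = 0" using state_mate[OF st rz] rl hl rq by simp
  have hts: "height (\<psi> s) = height (\<phi> s)" for s
    using v(1,2) v(3)[of s] w rl he hl by (cases "s = r"; cases "s = w") auto
  have nz: "\<psi> s \<noteq> 0 \<longleftrightarrow> \<phi> s \<noteq> 0" for s
    using v(1,2) v(3)[of s] wz rz q e' by (cases "s = r"; cases "s = w") auto
  have nl: "\<phi> s \<noteq> 8 * k + 1 - e" for s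
  proof
    assume a: "\<phi> s = 8 * k + 1 - e"
    then have sz: "\<phi> s \<noteq> 0" using e' by simp
    have "\<phi> r = mate_label (\<phi> s)" using a rl hl by simp
    then have "s = e" using state_end[OF st sz] a hl by simp
    then have "\<phi> q = 8 * k + 1 - q" using state_mate[OF st sz] a hl by (simp add: q_def)
    then show False using state_inj[OF st rz, of q] rl rq by simp
  qed
  have nq: "\<phi> s \<noteq> q" for s
  proof
    assume a: "\<phi> s = q"
    then have sz: "\<phi> s \<noteq> 0" using q by simp
    have "\<phi> w = mate_label (\<phi> s)" using a w ml by simp
    then have "s = q" using state_end[OF st sz] a he by simp
    then have "\<phi> e = e" using state_mate[OF st sz] a he ml q(4) by simp
    then show False using state_inj[OF st wz, of e] w by simp
  qed
  have inj: "s = w" if "\<phi> s = e" for s using state_inj[OF st wz, of s] w that by simp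
  have inj': "s = r" if "\<phi> s = 8 * k + 1 - q" for s using state_inj[OF st rz, of s] rl that by simp
  have ne: "8 * k + 1 - e \<noteq> q" "8 * k + 1 - q \<noteq> e" "8 * k + 1 - e \<noteq> 8 * k + 1 - q"
    "8 * k + 1 - e \<noteq> e" "8 * k + 1 - q \<noteq> q" using e' q by linarith+
  show ?thesis unfolding q_def[symmetric] \<psi>_def[symmetric] state_def
  proof (intro conjI allI impI ballI)
    fix s assume s: "\<psi> s \<noteq> 0"
    then have sz: "\<phi> s \<noteq> 0" using nz by simp
    show "1 \<le> s" "s \<le> height (\<psi> s)" using state_bounds[OF st sz] hts[of s] by simp_all
    show "\<psi> s \<le> 8 * k" using v(1,2) v(3)[of s] state_bounds[OF st sz] e' q by (cases "s = r"; cases "s = w") auto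
    show "s = s'" if "\<psi> s = \<psi> s'" for s'
    proof -
      consider "s = r" | "s = w" | "s \<noteq> r" "s \<noteq> w" by blast
      then show ?thesis
      proof cases
        case 1
        then have "\<psi> s' = q" using that v by simp
        then show ?thesis using v(2) v(3)[of s'] nq[of s'] ne(1) 1 by metis
      next
        case 2
        then have "\<psi> s' = 8 * k + 1 - e" using that v by simp
        then show ?thesis using v(1) v(3)[of s'] nl[of s'] ne(1) 2 by metis
      next
        case 3
        then have "\<psi> s' = \<phi> s" using that v by simp
        then show ?thesis using v(1,2) v(3)[of s'] nl[of s] nq[of s] state_inj[OF st sz, of s']
          by (cases "s' = r"; cases "s' = w") auto
      qed
    qed
    show "\<psi> (mate s) = (if height (\<psi> s) = s then mate_label (\<psi> s) else 0)"
    proof -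
      have mm: "mate (mate s) = s" using state_mate_pt[OF st sz] by simp
      consider "s = r" | "s = w" | "s \<noteq> r" "s \<noteq> w" by blast
      then show ?thesis
      proof cases
        case 1
        then have "\<psi> (mate s) = 0" using nz[of "mate s"] mr by simp
        then show ?thesis using hts[of s] 1 rl hl rq by simp
      next
        case 2
        then have "\<psi> (mate s) = 0" using nz[of "mate s"] mw by simp
        then show ?thesis using hts[of s] 2 w he by simp
      next
        case 3
        have "mate s \<noteq> r" "mate s \<noteq> w" using mr mw mm sz by auto
        then show ?thesis using v(3) 3 state_mate[OF st sz] by simp
      qed
    qed
    show "s = height (\<psi> s)" if m: "\<psi> s' = mate_label (\<psi> s)" for s'
    proof -
      consider "s = r" | "s = w" | "s \<noteq> r" "s \<noteq> w" by blast
      then show ?thesis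
      proof cases
        case 1
        then have "\<psi> s' = e" using m v ml by simp
        then show ?thesis using v(1,2) v(3)[of s'] inj[of s'] q(3) ne(4) by metis
      next
        case 2
        then have "\<psi> s' = 8 * k + 1 - q" using m v hl by simp
        then show ?thesis using v(1,2) v(3)[of s'] inj'[of s'] ne(3,5) by metis
      next
        case 3
        then have m': "\<psi> s' = mate_label (\<phi> s)" using m v by simp
        have ll: "mate_label (mate_label (\<phi> s)) = \<phi> s" using state_label[OF st sz] by simp
        have "s' \<noteq> r" using m' ll v(1) ml inj[of s] 3 by auto
        moreover have "s' \<noteq> w" using m' ll v(2) hl inj'[of s] 3 by auto
        ultimately show ?thesis using state_end[OF st sz] m' v(3) 3 by simp
      qed
    qed
  next
    fix s assume "s \<in> points"
    then show "\<psi> s \<noteq> 0 \<or> \<psi> (mate s) \<noteq> 0" using nz state_start[OF st, of s] by (auto simp: points_def)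
  qed
qed

lemma left_lab_eq: "t \<in> points \<Longrightarrow> t' \<in> points \<Longrightarrow> left_lab t = left_lab t' \<longleftrightarrow> t = t'"
  using lab_inj[OF is_side_left] by blast

lemma right_lab_eq: "right_lab t = right_lab t' \<longleftrightarrow> t = t'"
  by (simp add: right_lab_def)

lemma left_right_lab: "t \<in> points \<Longrightarrow> t' \<in> points \<Longrightarrow> left_lab t \<noteq> right_lab t'"
  using left_lab_gt[of t] right_lab_le[of t'] by simp

lemma right_left_lab: "t \<in> points \<Longrightarrow> t' \<in> points \<Longrightarrow> right_lab t' \<noteq> left_lab t"
  using left_right_lab by metis

lemma left_idem_start:
  assumes lab: "is_side lab" and st: "state \<phi>" and e: "\<phi> e \<noteq> 0"
  shows "pair e \<in> left_idem (side lab \<phi>) \<longleftrightarrow> (\<exists>t\<in>points. \<phi> e = lab t)"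
proof -
  have ep: "e \<in> points" by (rule state_points[OF st e])
  have "\<phi> e = lab e" if "t \<in> points" "\<phi> (mate e) = lab t" for t
  proof -
    have "\<phi> (mate e) \<noteq> 0" using lab_facts(1)[OF lab that(1)] that(2) by simp
    then have "height (\<phi> (mate e)) = mate e" using state_mate_constant[OF st e] by simp
    then have "t = mate e" using lab_facts(3)[OF lab that(1)] that(2) by simp
    then show ?thesis using side_mate_dh[OF lab st ep] that(2) by simp
  qed
  then show ?thesis unfolding left_idem_side[OF lab st ep] using ep by blast
qed

lemma right_idem_exchange:
  assumes lab: "is_side lab" and st: "state \<phi>" and e: "e \<in> points" and w: "w < e" "\<phi> w = e" and r: "r \<noteq> mate e" "\<phi> r = 8 * k + 1 - mate e"
    and which: "lab = left_lab \<or> lab = right_lab"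
  shows "right_idem (side lab (\<phi>(r := mate e, w := 8 * k + 1 - e))) = right_idem (side lab \<phi>)"
proof -
  define \<psi> where "\<psi> = \<phi>(r := mate e, w := 8 * k + 1 - e)"
  have st': "state \<psi>" unfolding \<psi>_def by (rule exchange_state[OF st e w r])
  note me = mate_points[OF e]
  have wr: "w \<noteq> r" using w(2) r(2) e me by (auto simp: points_def)
  have v: "\<psi> r = right_lab (mate e)" "\<psi> w = left_lab e" "\<And>s. s \<noteq> r \<Longrightarrow> s \<noteq> w \<Longrightarrow> \<psi> s = \<phi> s"
    "\<phi> r = left_lab (mate e)" "\<phi> w = right_lab e"
    using wr w r by (simp_all add: \<psi>_def right_lab_def left_lab_def)
  have "(\<exists>t\<in>points. P = pair t \<and> (\<exists>s. \<psi> s = lab t)) \<longleftrightarrow> (\<exists>t\<in>points. P = pair t \<and> (\<exists>s. \<phi> s = lab t))" for P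
  proof
    assume "\<exists>t\<in>points. P = pair t \<and> (\<exists>s. \<psi> s = lab t)"
    then obtain t s where t: "t \<in> points" "P = pair t" "\<psi> s = lab t" by blast
    consider "s = r" | "s = w" | "s \<noteq> r" "s \<noteq> w" by blast
    then show "\<exists>t\<in>points. P = pair t \<and> (\<exists>s. \<phi> s = lab t)"
    proof cases
      case 1
      then have "lab = right_lab \<and> t = mate e" using t v(1) which left_right_lab[OF t(1), of "mate e"] me by (auto simp: right_lab_eq)
      then show ?thesis using v(5) e t(2) pair_mate[OF e] by metis
    next
      case 2
      then have "lab = left_lab \<and> t = e" using t v(2) which left_right_lab[OF e t(1)] left_lab_eq[OF e t(1)] by auto
      then show ?thesis using v(4) me t(2) pair_mate[OF e] by metis
    next
      case 3
      then show ?thesis using v(3) t by metis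
    qed
  next
    assume "\<exists>t\<in>points. P = pair t \<and> (\<exists>s. \<phi> s = lab t)"
    then obtain t s where t: "t \<in> points" "P = pair t" "\<phi> s = lab t" by blast
    consider "s = r" | "s = w" | "s \<noteq> r" "s \<noteq> w" by blast
    then show "\<exists>t\<in>points. P = pair t \<and> (\<exists>s. \<psi> s = lab t)"
    proof cases
      case 1
      have mp: "mate e \<in> points" using me by simp
      have "lab = left_lab \<and> t = mate e" using 1 t v(4) which left_right_lab[OF mp t(1)] left_lab_eq[OF mp t(1)] by auto
      then show ?thesis using v(2) e t(2) pair_mate[OF e] by metis
    next
      case 2
      then have "lab = right_lab \<and> t = e" using t v(5) which left_right_lab[OF t(1) e] by (auto simp: right_lab_eq)
      then show ?thesis using v(1) me t(2) pair_mate[OF e] by metis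
    next
      case 3
      then show ?thesis using v(3) t by metis
    qed
  qed
  then show ?thesis unfolding \<psi>_def[symmetric] right_idem_side[OF lab st] right_idem_side[OF lab st']
    by (intro set_eqI) (simp only: mem_Collect_eq Bex_def, metis)
qed

lemma exchange_decode:
  assumes st: "state \<phi>" and e: "e \<in> points" and w: "w < e" "\<phi> w = e" and r: "r \<noteq> mate e" "\<phi> r = 8 * k + 1 - mate e"
  shows "exchange (side left_lab \<phi>) (side right_lab \<phi>) (r, mate e) (w, e) = decode (\<phi>(r := mate e, w := 8 * k + 1 - e))"
proof -
  define \<psi> where "\<psi> = \<phi>(r := mate e, w := 8 * k + 1 - e)"
  note L = is_side_left and R = is_side_right
  have st': "state \<psi>" unfolding \<psi>_def by (rule exchange_state[OF st e w r])
  note me = mate_points[OF e]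
  have mp: "mate e \<in> points" using me by simp
  have wr: "w \<noteq> r" using w(2) r(2) e me by (auto simp: points_def)
  have v: "\<psi> r = right_lab (mate e)" "\<psi> w = left_lab e" "\<And>s. s \<noteq> r \<Longrightarrow> s \<noteq> w \<Longrightarrow> \<psi> s = \<phi> s"
    "\<phi> r = left_lab (mate e)" "\<phi> w = right_lab e"
    using wr w r by (simp_all add: \<psi>_def right_lab_def left_lab_def)
  have rm: "r < mate e"
    using state_bounds[OF st, of r] r(1) v(4) lab_facts[OF L mp] by (metis le_neq_implies_less)
  have m1: "mov (side left_lab \<psi>) = mov (side left_lab \<phi>) - {(r, mate e)} \<union> {(w, e)}"
  proof (intro set_eqI)
    fix z :: "nat \<times> nat" obtain x y where z: "z = (x, y)" by (cases z)
    show "z \<in> mov (side left_lab \<psi>) \<longleftrightarrow> z \<in> mov (side left_lab \<phi>) - {(r, mate e)} \<union> {(w, e)}"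
      unfolding z using v(1,2,4,5) v(3)[of x] w(1) wr e mp left_lab_eq[OF e, of y] left_lab_eq[OF mp, of y]
        left_right_lab[of y "mate e"] left_right_lab[of y e]
      by (cases "x = r"; cases "x = w") (auto simp: mov_side[OF L] dest: sym)
  qed
  have m2: "mov (side right_lab \<psi>) = mov (side right_lab \<phi>) - {(w, e)} \<union> {(r, mate e)}"
  proof (intro set_eqI)
    fix z :: "nat \<times> nat" obtain x y where z: "z = (x, y)" by (cases z)
    show "z \<in> mov (side right_lab \<psi>) \<longleftrightarrow> z \<in> mov (side right_lab \<phi>) - {(w, e)} \<union> {(r, mate e)}"
      unfolding z using v(1,2,4,5) v(3)[of x] w(1) wr e mp rm right_lab_eq[of e y] right_lab_eq[of "mate e" y]
        left_right_lab[of e y] left_right_lab[of "mate e" y]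
      by (cases "x = r"; cases "x = w") (auto simp: mov_side[OF R] dest: sym)
  qed
  have i: "right_idem (side lab \<phi>) = right_idem (side lab \<psi>)" if "lab = left_lab \<or> lab = right_lab" for lab
    using right_idem_exchange[OF _ st e w r that] that L R by (auto simp: \<psi>_def)
  show ?thesis
    unfolding exchange_def decode_def \<psi>_def[symmetric]
    using set_mov_side[OF L st' i m1[symmetric]] set_mov_side[OF R st' i m2[symmetric]] by simp
qed

context
  fixes \<phi> e w assumes piv: "pivot e \<phi>" and w_def: "w = under e \<phi>"
begin

lemma piv_facts: "state \<phi>" "e \<in> points" "w < e" "e \<le> height (\<phi> w)" "\<phi> w \<noteq> 0" "\<phi> e \<noteq> 0" "\<phi> w \<noteq> \<phi> e"
proof -
  show st: "state \<phi>" and "e \<in> points" using piv by (auto simp: pivot_def points_def)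
  show u: "w < e" "e \<le> height (\<phi> w)" unfolding w_def by (rule under_unique(1,2)[OF piv])+
  show wz: "\<phi> w \<noteq> 0" and "\<phi> e \<noteq> 0" using under_nz[OF piv] pivot_start[OF piv] by (simp_all add: w_def)
  show "\<phi> w \<noteq> \<phi> e" using state_inj[OF st wz, of e] u by auto
qed

lemma covering_side:
  assumes lab: "is_side lab"
  shows "covering (side lab \<phi>) (e - 1) = {(w, t) |t. t \<in> points \<and> \<phi> w = lab t}"
proof (intro set_eqI)
  have e1: "1 \<le> e" using piv by (simp add: pivot_def)
  fix z :: "nat \<times> nat" obtain s t where z: "z = (s, t)" by (cases z)
  have "s < t \<and> t \<in> points \<and> \<phi> s = lab t \<and> s \<le> e - 1 \<and> e - 1 < t \<longleftrightarrow> s = w \<and> t \<in> points \<and> \<phi> w = lab t"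
  proof
    assume a: "s < t \<and> t \<in> points \<and> \<phi> s = lab t \<and> s \<le> e - 1 \<and> e - 1 < t"
    then have "s < e" "e \<le> height (\<phi> s)" using e1 lab_facts(3)[OF lab, of t] by auto
    then have "w = s" using under_unique(3)[OF piv] w_def by simp
    then show "s = w \<and> t \<in> points \<and> \<phi> w = lab t" using a by simp
  next
    assume a: "s = w \<and> t \<in> points \<and> \<phi> w = lab t"
    then have "e \<le> t" using piv_facts(4) lab_facts(3)[OF lab, of t] by simp
    then show "s < t \<and> t \<in> points \<and> \<phi> s = lab t \<and> s \<le> e - 1 \<and> e - 1 < t" using a piv_facts(3) e1 by auto
  qed
  then show "z \<in> covering (side lab \<phi>) (e - 1) \<longleftrightarrow> z \<in> {(w, t) |t. t \<in> points \<and> \<phi> w = lab t}"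
    unfolding z covering_def by (auto simp: mov_side[OF lab])
qed

lemma over_under: "is_side lab \<Longrightarrow> (a, b) \<in> mov (side lab \<phi>) \<Longrightarrow> a < e \<Longrightarrow> e \<le> b \<Longrightarrow> a = w"
  using under_unique(3)[OF piv, of a] lab_facts(3)[of lab b] by (auto simp: mov_side w_def)

lemma set_mov_main:
  assumes "is_side lab" "V = mov (side lab (switch \<phi> w e))"
  shows "set_mov (side lab \<phi>) V = side lab (switch \<phi> w e)"
  by (rule set_mov_switch[OF assms(1) piv_facts(1,6,5,3,4) assms(2)])

lemma mov_main: "is_side lab \<Longrightarrow> mov (side lab (switch \<phi> w e)) = {(s, t) \<in> mov (side lab \<phi>). s \<noteq> w \<and> s \<noteq> e} \<union>
      {(w, t) |t. t \<in> points \<and> \<phi> e = lab t} \<union> {(e, t) |t. e < t \<and> t \<in> points \<and> \<phi> w = lab t}"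
  by (rule mov_side_switch[OF _ piv_facts(1,6,5,3,4)])

lemma to_gens_homotopy: "to_gens (homotopy_at e \<phi>) =
    (if \<phi> w < \<phi> e then basis (decode (switch \<phi> w e)) +
       (if \<phi> w = e then \<Sum>r | r \<noteq> mate e \<and> \<phi> r = 8 * k + 1 - mate e. basis (decode (\<phi>(r := mate e, w := 8 * k + 1 - e))) else 0)
     else 0)"
  by (simp add: to_gens_def homotopy_at_def Let_def w_def[symmetric] lin_add lin_sum)

text \<open>For uncrossed labels the strands at the pivot are both on the left, both on the right, or the strand
  over the pivot is on the right and the other one on the left. The sets of strands are written as in
  the definition of \<open>H\<close>, with constant strands left out.\<close>
lemma main_LL:
  assumes b: "b \<in> points" "\<phi> w = left_lab b" and j: "j \<in> points" "\<phi> e = left_lab j" and lt: "\<phi> w < \<phi> e"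
    and V: "V = mov (side left_lab \<phi>) - {(e, j), (w, b)} \<union> {(e, b), (w, j)}"
  shows "(set_mov (side left_lab \<phi>) V, side right_lab \<phi>) = decode (switch \<phi> w e)"
proof -
  note L = is_side_left
  have ej: "e \<le> j" using state_bounds[OF piv_facts(1,6)] lab_facts(3)[OF L j(1)] j(2) by simp
  have jb: "j < b" using lt b j by (auto simp: left_lab_def)
  have "V = mov (side left_lab (switch \<phi> w e))"
  proof (intro set_eqI)
    fix z :: "nat \<times> nat" obtain x y where z: "z = (x, y)" by (cases z)
    show "z \<in> V \<longleftrightarrow> z \<in> mov (side left_lab (switch \<phi> w e))"
      unfolding z V mov_main[OF L] using b j ej jb piv_facts(3) left_lab_eq[OF b(1), of y] left_lab_eq[OF j(1), of y]
      by (cases "x = w"; cases "x = e") (auto simp: mov_side[OF L])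
  qed
  moreover have "side right_lab (switch \<phi> w e) = side right_lab \<phi>"
    by (rule side_switch_other[OF is_side_right piv_facts(1,6,5,3,4)]) (use b j left_right_lab in metis)
  ultimately show ?thesis using set_mov_main[OF L] by (simp add: decode_def)
qed

lemma main_RR:
  assumes b: "b \<in> points" "\<phi> w = right_lab b" and j: "j \<in> points" "\<phi> e = right_lab j" and lt: "\<phi> w < \<phi> e"
    and V: "V = mov (side right_lab \<phi>) - {(w, b), (e, j)} \<union> {(w, j)} \<union> (if e = b then {} else {(e, b)})"
  shows "(side left_lab \<phi>, set_mov (side right_lab \<phi>) V) = decode (switch \<phi> w e)"
proof -
  note R = is_side_right
  have eb: "e \<le> b" using piv_facts(4) lab_facts(3)[OF R b(1)] b(2) by simp
  have bj: "b < j" using lt b j by (auto simp: right_lab_def)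
  have "V = mov (side right_lab (switch \<phi> w e))"
  proof (intro set_eqI)
    fix z :: "nat \<times> nat" obtain x y where z: "z = (x, y)" by (cases z)
    show "z \<in> V \<longleftrightarrow> z \<in> mov (side right_lab (switch \<phi> w e))"
      unfolding z V mov_main[OF R] using b j eb bj piv_facts(3) right_lab_eq[of b y] right_lab_eq[of j y]
      by (cases "x = w"; cases "x = e") (auto simp: mov_side[OF R])
  qed
  moreover have "side left_lab (switch \<phi> w e) = side left_lab \<phi>"
    by (rule side_switch_other[OF is_side_left piv_facts(1,6,5,3,4)]) (use b j left_right_lab in metis)
  ultimately show ?thesis using set_mov_main[OF R] by (simp add: decode_def)
qed

lemma main_RL:
  assumes b: "b \<in> points" "\<phi> w = right_lab b" and j: "j \<in> points" "\<phi> e = left_lab j"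
    and V: "V1 = mov (side left_lab \<phi>) - {(e, j)} \<union> {(w, j)}"
      "V2 = mov (side right_lab \<phi>) - {(w, b)} \<union> (if b = e then {} else {(e, b)})"
  shows "(set_mov (side left_lab \<phi>) V1, set_mov (side right_lab \<phi>) V2) = decode (switch \<phi> w e)" "\<phi> w < \<phi> e"
proof -
  note L = is_side_left and R = is_side_right
  show "\<phi> w < \<phi> e" using b j left_lab_gt[OF j(1)] right_lab_le[OF b(1)] by simp
  have eb: "e \<le> b" using piv_facts(4) lab_facts(3)[OF R b(1)] b(2) by simp
  have ej: "e \<le> j" using state_bounds[OF piv_facts(1,6)] lab_facts(3)[OF L j(1)] j(2) by simp
  have "V1 = mov (side left_lab (switch \<phi> w e))"
  proof (intro set_eqI)
    fix z :: "nat \<times> nat" obtain x y where z: "z = (x, y)" by (cases z)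
    show "z \<in> V1 \<longleftrightarrow> z \<in> mov (side left_lab (switch \<phi> w e))"
      unfolding z V mov_main[OF L] using b j ej piv_facts(3) left_lab_eq[OF j(1), of y] left_right_lab[of y b]
      by (cases "x = w"; cases "x = e") (auto simp: mov_side[OF L])
  qed
  moreover have "V2 = mov (side right_lab (switch \<phi> w e))"
  proof (intro set_eqI)
    fix z :: "nat \<times> nat" obtain x y where z: "z = (x, y)" by (cases z)
    show "z \<in> V2 \<longleftrightarrow> z \<in> mov (side right_lab (switch \<phi> w e))"
      unfolding z V mov_main[OF R] using b j eb piv_facts(3) right_lab_eq[of b y] left_right_lab[of j y]
      by (cases "x = w"; cases "x = e") (auto simp: mov_side[OF R])
  qed
  ultimately show "(set_mov (side left_lab \<phi>) V1, set_mov (side right_lab \<phi>) V2) = decode (switch \<phi> w e)"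
    using set_mov_main[OF L] set_mov_main[OF R] by (simp add: decode_def)
qed

end

section \<open>The homotopy on states and the homotopy identity\<close>

text \<open>With multiplicities at most one, the strand over the pivot ends at \<open>e\<close> unless the strand at \<open>e\<close> is
  constant. This leaves eight positions of the two strands; the four rules of \<open>H\<close> are the uncrossed ones.\<close>
lemma H_one_decode:
  assumes piv: "pivot e \<phi>" and one: "card (cover \<phi> e) \<le> 1" and key: "key_segment (decode \<phi>) = e - 1"
  shows "H_one (decode \<phi>) = to_gens (homotopy_at e \<phi>)"
proof -
  define w where "w = under e \<phi>"
  note L = is_side_left and R = is_side_right
  note F = piv_facts[OF piv w_def] and st = piv_facts(1)[OF piv w_def]
  define A1 where "A1 = side left_lab \<phi>"
  define A2 where "A2 = side right_lab \<phi>"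
  define q where "q = mate e"
  have q: "q \<in> points" "q \<noteq> e" using mate_points[OF F(2)] by (simp_all add: q_def)
  have ek: "e - 1 + 1 = e" using F(2) by (auto simp: points_def)
  have d12: "decode \<phi> = (A1, A2)" by (simp add: decode_def A1_def A2_def)
  define X1 where "X1 = (\<Sum>(a, b) | (a, b) \<in> mov A1 \<and> a < e \<and> e < b.
           basis (set_mov A1 (mov A1 - {(a, b)} \<union> {(a, e), (e, b)}), A2))"
  define X2 where "X2 = (\<Sum>(i, j) | (i, e) \<in> mov A2 \<and> (e, j) \<in> mov A2.
           basis (A1, set_mov A2 (mov A2 - {(i, e), (e, j)} \<union> {(i, j)})) +
           (\<Sum>r | (r, q) \<in> mov A1. basis (exchange A1 A2 (r, q) (i, e))))"
  define X3 where "X3 = (\<Sum>(i, j) | (i, j) \<in> covering A2 (e - 1).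
           basis (set_mov A1 (mov A1 \<union> {(i, e)}), set_mov A2 (mov A2 - {(i, j)} \<union> (if j = e then {} else {(e, j)}))))"
  define X4 where "X4 = (\<Sum>(i, j) | (i, e) \<in> mov A2 \<and> (e, j) \<in> mov A1.
           basis (set_mov A1 (mov A1 - {(e, j)} \<union> {(i, j)}), set_mov A2 (mov A2 - {(i, e)})) +
           (\<Sum>r | (r, q) \<in> mov A1 \<and> r \<noteq> e. basis (exchange A1 A2 (r, q) (i, e))) +
           (if j = q then basis (exchange A1 A2 (e, q) (i, e)) else 0))"
  have H: "H_one (decode \<phi>) =
     (if covering A1 (e - 1) \<noteq> {} \<and> pair e \<in> dh A1 then X1
      else if covering A2 (e - 1) \<noteq> {} \<and> pair e \<in> left_idem A2 - dh A2 then X2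
      else if covering A2 (e - 1) \<noteq> {} \<and> pair e \<in> dh A1 then X3
      else if covering A2 (e - 1) \<noteq> {} \<and> pair e \<in> left_idem A1 - dh A1 then X4 else 0)"
    using key unfolding d12 by (simp only: H_one.simps Let_def ek X1_def X2_def X3_def X4_def q_def)
  have cov: "covering A1 (e - 1) = {(w, t) |t. t \<in> points \<and> \<phi> w = left_lab t}"
    "covering A2 (e - 1) = {(w, t) |t. t \<in> points \<and> \<phi> w = right_lab t}"
    using covering_side[OF piv w_def L] covering_side[OF piv w_def R] by (simp_all add: A1_def A2_def)
  have dhe: "pair e \<in> dh A1 \<longleftrightarrow> \<phi> e = left_lab e" "pair e \<in> dh A2 \<longleftrightarrow> \<phi> e = right_lab e"
    using dh_side[OF L st F(2)] dh_side[OF R st F(2)] by (simp_all add: A1_def A2_def)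
  have lie: "pair e \<in> left_idem A1 \<longleftrightarrow> (\<exists>t\<in>points. \<phi> e = left_lab t)" "pair e \<in> left_idem A2 \<longleftrightarrow> (\<exists>t\<in>points. \<phi> e = right_lab t)"
    using left_idem_start[OF L st F(6)] left_idem_start[OF R st F(6)] by (simp_all add: A1_def A2_def)
  note mv = mov_side[OF L, of _ _ \<phi>, folded A1_def] mov_side[OF R, of _ _ \<phi>, folded A2_def]
  have both: "height (\<phi> w) \<le> e \<or> height (\<phi> e) \<le> e"
  proof (rule ccontr)
    assume "\<not> ?thesis"
    then have "{w, e} \<subseteq> cover \<phi> e" using F(3) by (auto simp: cover_def)
    then have "card {w, e} \<le> card (cover \<phi> e)" by (rule card_mono[OF finite_cover])
    then show False using one F(3) by simp
  qed
  define Rs where "Rs = {r. r \<noteq> q \<and> \<phi> r = 8 * k + 1 - q}"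
  have Rs: "{r. (r, q) \<in> mov A1} = Rs"
  proof -
    have "r < q \<longleftrightarrow> r \<noteq> q" if "\<phi> r = left_lab q" for r
      using state_bounds[OF st, of r] that lab_facts[OF L q(1)] by auto
    then show ?thesis using q(1) by (auto simp: Rs_def mv left_lab_def)
  qed
  have finRs: "finite Rs"
    by (rule finite_subset[of _ points]) (use state_points[OF st] q in \<open>auto simp: Rs_def points_def\<close>)
  have ex: "exchange A1 A2 (r, q) (w, e) = decode (\<phi>(r := q, w := 8 * k + 1 - e))" if "r \<in> Rs" "\<phi> w = e" for r
    using exchange_decode[OF st F(2,3) that(2), of r] that(1) by (simp add: Rs_def A1_def A2_def q_def)
  have homotopy_at: "to_gens (homotopy_at e \<phi>) =
    (if \<phi> w < \<phi> e then basis (decode (switch \<phi> w e)) +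
       (if \<phi> w = e then \<Sum>r\<in>Rs. basis (decode (\<phi>(r := q, w := 8 * k + 1 - e))) else 0) else 0)"
    unfolding to_gens_homotopy[OF piv w_def] Rs_def q_def by simp
  have we: "(e, e) \<notin> mov A1" "(e, e) \<notin> mov A2" by (simp_all add: mv)
  show ?thesis
  proof (rule state_label_cases[OF st F(5)])
    fix b assume b: "b \<in> points" "\<phi> w = left_lab b" "4 * k < \<phi> w" "b = height (\<phi> w)"
    have nR: "covering A2 (e - 1) = {}" using b(1,2) left_right_lab unfolding cov by fastforce
    have nL: "covering A1 (e - 1) \<noteq> {}" using b(1,2) unfolding cov by blast
    have ne: "\<phi> w \<noteq> e" using b(3) F(2) by (auto simp: points_def)
    show ?thesis
    proof (cases "\<phi> e = left_lab e")
      case True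
      have eb: "e < b" using F(4,7) b True by (metis le_neq_implies_less)
      then have lt: "\<phi> w < \<phi> e" using eb unfolding b(2) True left_lab_def using b(1) F(2) unfolding points_def by auto
      have I: "{(a, b). (a, b) \<in> mov A1 \<and> a < e \<and> e < b} = {(w, b)}"
      proof (intro equalityI subsetI)
        fix z assume "z \<in> {(a, b). (a, b) \<in> mov A1 \<and> a < e \<and> e < b}"
        then obtain x y where z: "z = (x, y)" "(x, y) \<in> mov A1" "x < e" "e < y" by auto
        then have "x = w" using over_under[OF piv w_def L, of x y] by (simp add: A1_def)
        then show "z \<in> {(w, b)}" using z b(1,2) left_lab_eq[of b y] by (simp add: mv)
      qed (use b(1,2) eb F(3) in \<open>auto simp: mv\<close>)
      have V: "mov A1 - {(w, b)} \<union> {(w, e), (e, b)} = mov A1 - {(e, e), (w, b)} \<union> {(e, b), (w, e)}"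
        using we by auto
      have "X1 = basis (decode (switch \<phi> w e))"
        unfolding X1_def I using main_LL[OF piv w_def b(1,2) F(2) True lt V[unfolded A1_def]] by (simp add: A1_def A2_def)
      then show ?thesis using H nL dhe True lt ne homotopy_at by simp
    next
      case False
      have "\<not> \<phi> w < \<phi> e"
      proof
        assume lt: "\<phi> w < \<phi> e"
        show False
        proof (rule state_label_cases[OF st F(6)])
          fix j assume "\<phi> e \<le> 4 * k" then show False using lt b(3) by simp
        next
          fix j assume j: "j \<in> points" "\<phi> e = left_lab j" "j = height (\<phi> e)"
          have "e \<le> j" using state_bounds[OF st F(6)] j(3) by simp
          then have "e < j" using False j by (metis le_neq_implies_less)
          moreover have "j < b" using lt unfolding j(2) b(2) left_lab_def by linarith
          ultimately show False using both j(3) b(4) by simp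
        qed
      qed
      then show ?thesis using H nR dhe False homotopy_at by simp
    qed
  next
    fix b assume b: "b \<in> points" "\<phi> w = right_lab b" "\<phi> w \<le> 4 * k" "b = height (\<phi> w)"
    have nL: "covering A1 (e - 1) = {}" using b(1,2) right_left_lab unfolding cov by fastforce
    have nR: "covering A2 (e - 1) \<noteq> {}" using b(1,2) unfolding cov by blast
    have wb: "\<phi> w = b" using b(2) by (simp add: right_lab_def)
    have eb: "e \<le> b" using F(4) b(4) by simp
    have bm: "(w, b) \<in> mov A2" using b(1,2) eb F(3) by (simp add: mv)
    have uw: "i = w" if "(i, e) \<in> mov A2" for i
    proof -
      have "i < e" using that by (simp add: mv)
      then show ?thesis using over_under[OF piv w_def R, of i e] that by (simp add: A2_def)
    qed
    show ?thesis
    proof (rule state_label_cases[OF st F(6)])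
      fix j assume j: "j \<in> points" "\<phi> e = left_lab j" "4 * k < \<phi> e" "j = height (\<phi> e)"
      have lt: "\<phi> w < \<phi> e" using b(3) j(3) by simp
      have n2: "pair e \<notin> left_idem A2" unfolding lie using j left_right_lab by metis
      have ej: "e \<le> j" using state_bounds[OF st F(6)] j(4) by simp
      show ?thesis
      proof (cases "j = e")
        case True
        have "X3 = basis (decode (switch \<phi> w e))"
        proof -
          have I: "{(i, j). (i, j) \<in> covering A2 (e - 1)} = {(w, b)}"
            unfolding cov using b(1,2) by (auto simp: right_lab_eq)
          have V: "mov A1 \<union> {(w, e)} = mov A1 - {(e, j)} \<union> {(w, j)}" using we True by auto
          show ?thesis unfolding X3_def I
            using main_RL(1)[OF piv w_def b(1,2) j(1,2) V[unfolded A1_def] refl] by (simp add: A1_def A2_def)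
        qed
        moreover have "Rs = {}" if "\<phi> w = e"
        proof -
          have "\<phi> q = left_lab q" using side_mate_dh[OF L st F(2)] j(2) True by (simp add: q_def)
          then have "r = q" if "\<phi> r = 8 * k + 1 - q" for r
            using state_inj[OF st, of q r] that lab_facts(1)[OF L q(1)] by (simp add: left_lab_def)
          then show ?thesis by (auto simp: Rs_def)
        qed
        ultimately show ?thesis using H nL nR n2 dhe j(2) True lt homotopy_at by simp
      next
        case False
        then have be: "b = e" using both ej eb b(4) j(4) by auto
        have nd: "\<phi> e \<noteq> left_lab e" using False j(2) left_lab_eq[OF j(1) F(2)] by simp
        have jm: "(e, j) \<in> mov A1" using j(1,2) ej False by (simp add: mv)
        have I: "{(i, j). (i, e) \<in> mov A2 \<and> (e, j) \<in> mov A1} = {(w, j)}"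
        proof (intro equalityI subsetI)
          fix z assume "z \<in> {(i, j). (i, e) \<in> mov A2 \<and> (e, j) \<in> mov A1}"
          then obtain x y where z: "z = (x, y)" "(x, e) \<in> mov A2" "(e, y) \<in> mov A1" by auto
          then show "z \<in> {(w, j)}" using uw[of x] j(1,2) left_lab_eq[of j y] by (simp add: mv)
        qed (use bm be jm in auto)
        have V: "mov A2 - {(w, e)} = mov A2 - {(w, b)} \<union> (if b = e then {} else {(e, b)})" using be by simp
        have m: "(set_mov A1 (mov A1 - {(e, j)} \<union> {(w, j)}), set_mov A2 (mov A2 - {(w, e)})) = decode (switch \<phi> w e)"
          using main_RL(1)[OF piv w_def b(1,2) j(1,2) refl V[unfolded A2_def]] by (simp add: A1_def A2_def)
        have wE: "\<phi> w = e" using wb be by simp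
        have eR: "e \<in> Rs \<longleftrightarrow> j = q"
          using j(1,2) q left_lab_eq[OF j(1) q(1)] by (auto simp: Rs_def left_lab_def)
        have s1: "{r. (r, q) \<in> mov A1 \<and> r \<noteq> e} = Rs - {e}" using Rs by blast
        have "(\<Sum>r | (r, q) \<in> mov A1 \<and> r \<noteq> e. basis (exchange A1 A2 (r, q) (w, e))) +
            (if j = q then basis (exchange A1 A2 (e, q) (w, e)) else 0) = (\<Sum>r\<in>Rs. basis (exchange A1 A2 (r, q) (w, e)))"
        proof (cases "j = q")
          case True
          then have "e \<in> Rs" using eR by simp
          then have "(\<Sum>r\<in>Rs. basis (exchange A1 A2 (r, q) (w, e))) =
              basis (exchange A1 A2 (e, q) (w, e)) + (\<Sum>r\<in>Rs - {e}. basis (exchange A1 A2 (r, q) (w, e)))"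
            by (rule sum.remove[OF finRs])
          then show ?thesis unfolding s1 using True by (simp add: add.commute)
        next
          case False
          then have "Rs - {e} = Rs" using eR by simp
          then show ?thesis unfolding s1 using False by simp
        qed
        also have "\<dots> = (\<Sum>r\<in>Rs. basis (decode (\<phi>(r := q, w := 8 * k + 1 - e))))"
          by (rule sum.cong[OF refl]) (simp only: ex[OF _ wE])
        finally have "X4 = basis (decode (switch \<phi> w e)) + (\<Sum>r\<in>Rs. basis (decode (\<phi>(r := q, w := 8 * k + 1 - e))))"
          unfolding X4_def I using m by (simp add: add.assoc)
        moreover have "pair e \<in> left_idem A1" unfolding lie using j(1,2) by blast
        ultimately show ?thesis using H nL nR n2 dhe nd lt wE homotopy_at by simp
      qed
    next
      fix j assume j: "j \<in> points" "\<phi> e = right_lab j" "\<phi> e \<le> 4 * k" "j = height (\<phi> e)"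
      have n1: "pair e \<notin> left_idem A1" unfolding lie using j right_left_lab by metis
      then have n1': "pair e \<notin> dh A1" by (auto simp: left_idem_def)
      have i2: "pair e \<in> left_idem A2" unfolding lie using j(1,2) by blast
      have ej: "e \<le> j" using state_bounds[OF st F(6)] j(4) by simp
      have eJ: "\<phi> e = j" using j(2) by (simp add: right_lab_def)
      show ?thesis
      proof (cases "j = e")
        case True
        then have "\<not> \<phi> w < \<phi> e" using wb eb eJ by simp
        then show ?thesis using H nL n1 n1' dhe j(2) True homotopy_at by simp
      next
        case False
        then have be: "b = e" using both ej eb b(4) j(4) by auto
        have wE: "\<phi> w = e" using wb be by simp
        have lt: "\<phi> w < \<phi> e" using wE eJ ej False by simp
        have nd: "\<phi> e \<noteq> right_lab e" using False j(2) by (simp add: right_lab_eq)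
        have jm: "(e, j) \<in> mov A2" using j(1,2) ej False by (simp add: mv)
        have I: "{(i, j). (i, e) \<in> mov A2 \<and> (e, j) \<in> mov A2} = {(w, j)}"
        proof (intro equalityI subsetI)
          fix z assume "z \<in> {(i, j). (i, e) \<in> mov A2 \<and> (e, j) \<in> mov A2}"
          then obtain x y where z: "z = (x, y)" "(x, e) \<in> mov A2" "(e, y) \<in> mov A2" by auto
          then show "z \<in> {(w, j)}" using uw[of x] j(1,2) right_lab_eq[of j y] by (simp add: mv)
        qed (use bm be jm in auto)
        have V: "mov A2 - {(w, e), (e, j)} \<union> {(w, j)} = mov A2 - {(w, b), (e, j)} \<union> {(w, j)} \<union> (if e = b then {} else {(e, b)})"
          using be by simp
        have m: "(A1, set_mov A2 (mov A2 - {(w, e), (e, j)} \<union> {(w, j)})) = decode (switch \<phi> w e)"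
          using main_RR[OF piv w_def b(1,2) j(1,2) lt V[unfolded A2_def]] by (simp add: A1_def A2_def)
        have "(\<Sum>r\<in>Rs. basis (exchange A1 A2 (r, q) (w, e))) = (\<Sum>r\<in>Rs. basis (decode (\<phi>(r := q, w := 8 * k + 1 - e))))"
          by (rule sum.cong[OF refl]) (simp only: ex[OF _ wE])
        then have "X2 = basis (decode (switch \<phi> w e)) + (\<Sum>r\<in>Rs. basis (decode (\<phi>(r := q, w := 8 * k + 1 - e))))"
          unfolding X2_def I Rs using m by simp
        then show ?thesis using H nL nR i2 dhe nd lt wE homotopy_at by simp
      qed
    qed
  qed
qed

text \<open>Both strands go on above \<open>e\<close>, so no double horizontal is created and there is no correction term.\<close>
lemma H_many_decode:
  assumes piv: "pivot e \<phi>" and two: "2 \<le> card (cover \<phi> e)"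
    and least: "(LEAST i. i \<in> segments \<and> 1 < multiplicity (decode \<phi>) i) = e"
  shows "H_many (decode \<phi>) = to_gens (homotopy_at e \<phi>)"
proof -
  define w where "w = under e \<phi>"
  note L = is_side_left and R = is_side_right
  note F = piv_facts[OF piv w_def] and st = piv_facts(1)[OF piv w_def]
  define A1 where "A1 = side left_lab \<phi>"
  define A2 where "A2 = side right_lab \<phi>"
  have d12: "decode \<phi> = (A1, A2)" by (simp add: decode_def A1_def A2_def)
  define Y1 where "Y1 = (\<Sum>(t, j, s) | (e, t) \<in> mov A1 \<and> (j, s) \<in> mov A1 \<and> j < e \<and> e \<le> s \<and> t < s.
         basis (set_mov A1 (mov A1 - {(e, t), (j, s)} \<union> {(e, s), (j, t)}), A2))"
  define Y2 where "Y2 = (\<Sum>(t, j, s) | (e, t) \<in> mov A2 \<and> (j, s) \<in> mov A2 \<and> j < e \<and> e \<le> s \<and> \<not> t < s.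
         basis (A1, set_mov A2 (mov A2 - {(e, t), (j, s)} \<union> {(e, s), (j, t)})))"
  define Y3 where "Y3 = (\<Sum>(t, j, s) | (e, t) \<in> mov A1 \<and> (j, s) \<in> mov A2 \<and> j < e \<and> e \<le> s.
         basis (set_mov A1 (mov A1 - {(e, t)} \<union> {(j, t)}), set_mov A2 (mov A2 - {(j, s)} \<union> {(e, s)})))"
  have H: "H_many (decode \<phi>) = Y1 + Y2 + Y3"
    using least unfolding d12 by (simp only: H_many.simps Let_def Y1_def Y2_def Y3_def)
  note mv = mov_side[OF L, of _ _ \<phi>, folded A1_def] mov_side[OF R, of _ _ \<phi>, folded A2_def]
  have "cover \<phi> e \<subseteq> {w, e}"
  proof
    fix s assume "s \<in> cover \<phi> e"
    then have "s = e \<or> s < e \<and> e \<le> height (\<phi> s)" by (auto simp: cover_def)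
    then show "s \<in> {w, e}" using under_unique(3)[OF piv, of s] by (auto simp: w_def)
  qed
  then have "cover \<phi> e = {w, e}" using two F(3)
    by (intro card_seteq) (simp_all)
  then have hh: "e < height (\<phi> w)" "e < height (\<phi> e)" by (auto simp: cover_def)
  have ne: "\<phi> w \<noteq> e"
  proof
    assume "\<phi> w = e"
    then have "height (\<phi> w) = e" using F(2) by (simp add: height_def points_def)
    then show False using hh by simp
  qed
  have homotopy_at: "to_gens (homotopy_at e \<phi>) = (if \<phi> w < \<phi> e then basis (decode (switch \<phi> w e)) else 0)"
    unfolding to_gens_homotopy[OF piv w_def] using ne by simp
  have jw: "j = w" if "(j, s) \<in> mov A1 \<or> (j, s) \<in> mov A2" "j < e" "e \<le> s" for j s
    using that over_under[OF piv w_def L, of j s] over_under[OF piv w_def R, of j s] by (auto simp: A1_def A2_def)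
  show ?thesis
  proof (rule state_label_cases[OF st F(5)])
    fix b assume b: "b \<in> points" "\<phi> w = left_lab b" "b = height (\<phi> w)" "4 * k < \<phi> w"
    have hb: "e < b" using hh(1) b(3) by simp
    have nw: "(w, s) \<notin> mov A2" for s using b(1,2) left_right_lab[OF b(1), of s] by (auto simp: mv)
    have ws: "(w, s) \<in> mov A1 \<longleftrightarrow> s = b" for s using b(1,2) left_lab_eq[OF b(1), of s] hb F(3) by (auto simp: mv)
    have e2: "{(t, j, s). (e, t) \<in> mov A2 \<and> (j, s) \<in> mov A2 \<and> j < e \<and> e \<le> s \<and> \<not> t < s} = {}"
      "{(t, j, s). (e, t) \<in> mov A1 \<and> (j, s) \<in> mov A2 \<and> j < e \<and> e \<le> s} = {}" using jw nw by blast+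
    have Y23: "Y2 = 0" "Y3 = 0" unfolding Y2_def Y3_def e2 by simp_all
    show ?thesis
    proof (rule state_label_cases[OF st F(6)])
      fix j assume j: "j \<in> points" "\<phi> e = left_lab j" "j = height (\<phi> e)"
      have hj: "e < j" using hh(2) j(3) by simp
      have es: "(e, t) \<in> mov A1 \<longleftrightarrow> t = j" for t using j(1,2) left_lab_eq[OF j(1), of t] hj by (auto simp: mv)
      have lt: "\<phi> w < \<phi> e \<longleftrightarrow> j < b" unfolding b(2) j(2) left_lab_def using b(1) j(1) unfolding points_def by auto
      have I: "{(t, j, s). (e, t) \<in> mov A1 \<and> (j, s) \<in> mov A1 \<and> j < e \<and> e \<le> s \<and> t < s} = (if j < b then {(j, w, b)} else {})"
      proof (intro equalityI subsetI)
        fix z assume "z \<in> {(t, j, s). (e, t) \<in> mov A1 \<and> (j, s) \<in> mov A1 \<and> j < e \<and> e \<le> s \<and> t < s}"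
        then obtain t x s where z: "z = (t, x, s)" "(e, t) \<in> mov A1" "(x, s) \<in> mov A1" "x < e" "e \<le> s" "t < s" by auto
        have "x = w" using jw z by blast
        then show "z \<in> (if j < b then {(j, w, b)} else {})" using z es ws by simp
      next
        fix z assume "z \<in> (if j < b then {(j, w, b)} else {})"
        then show "z \<in> {(t, j, s). (e, t) \<in> mov A1 \<and> (j, s) \<in> mov A1 \<and> j < e \<and> e \<le> s \<and> t < s}"
          using es ws F(3) hb by (simp split: if_splits)
      qed
      have "Y1 = (if \<phi> w < \<phi> e then basis (decode (switch \<phi> w e)) else 0)"
        unfolding Y1_def I lt using main_LL[OF piv w_def b(1,2) j(1,2) _ refl] lt by (simp add: A1_def A2_def)
      then show ?thesis using H homotopy_at Y23 by simp
    next
      fix j assume j: "j \<in> points" "\<phi> e = right_lab j" "\<phi> e \<le> 4 * k"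
      have "(e, t) \<notin> mov A1" for t using j(1,2) right_left_lab[of t j] by (auto simp: mv)
      then have I: "{(t, j, s). (e, t) \<in> mov A1 \<and> (j, s) \<in> mov A1 \<and> j < e \<and> e \<le> s \<and> t < s} = {}" by blast
      have "Y1 = 0" unfolding Y1_def I by simp
      then show ?thesis using H homotopy_at Y23 b(4) j(3) by simp
    qed
  next
    fix b assume b: "b \<in> points" "\<phi> w = right_lab b" "b = height (\<phi> w)" "\<phi> w \<le> 4 * k"
    have hb: "e < b" using hh(1) b(3) by simp
    have nw: "(w, s) \<notin> mov A1" for s using b(1,2) right_left_lab[of s b] by (auto simp: mv)
    have ws: "(w, s) \<in> mov A2 \<longleftrightarrow> s = b" for s using b(1,2) right_lab_eq[of b s] hb F(3) by (auto simp: mv)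
    have e1: "{(t, j, s). (e, t) \<in> mov A1 \<and> (j, s) \<in> mov A1 \<and> j < e \<and> e \<le> s \<and> t < s} = {}" using jw nw by blast
    have Y1: "Y1 = 0" unfolding Y1_def e1 by simp
    show ?thesis
    proof (rule state_label_cases[OF st F(6)])
      fix j assume j: "j \<in> points" "\<phi> e = left_lab j" "4 * k < \<phi> e" "j = height (\<phi> e)"
      have hj: "e < j" using hh(2) j(4) by simp
      have es: "(e, t) \<in> mov A1 \<longleftrightarrow> t = j" for t using j(1,2) left_lab_eq[OF j(1), of t] hj by (auto simp: mv)
      have en: "(e, t) \<notin> mov A2" for t using j(1,2) left_right_lab[of j t] by (auto simp: mv)
      have e2: "{(t, j, s). (e, t) \<in> mov A2 \<and> (j, s) \<in> mov A2 \<and> j < e \<and> e \<le> s \<and> \<not> t < s} = {}" using en by blast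
      have Y2: "Y2 = 0" unfolding Y2_def e2 by simp
      have I: "{(t, j, s). (e, t) \<in> mov A1 \<and> (j, s) \<in> mov A2 \<and> j < e \<and> e \<le> s} = {(j, w, b)}"
      proof (intro equalityI subsetI)
        fix z assume "z \<in> {(t, j, s). (e, t) \<in> mov A1 \<and> (j, s) \<in> mov A2 \<and> j < e \<and> e \<le> s}"
        then obtain t x s where z: "z = (t, x, s)" "(e, t) \<in> mov A1" "(x, s) \<in> mov A2" "x < e" "e \<le> s" by auto
        have "x = w" using jw z by blast
        then show "z \<in> {(j, w, b)}" using z es ws by simp
      qed (use es ws F(3) hb in simp)
      have "b \<noteq> e" using hb by simp
      then have V: "mov A2 - {(w, b)} \<union> {(e, b)} = mov A2 - {(w, b)} \<union> (if b = e then {} else {(e, b)})" by simp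
      have "Y3 = basis (decode (switch \<phi> w e))"
        unfolding Y3_def I using main_RL(1)[OF piv w_def b(1,2) j(1,2) refl V[unfolded A2_def]] by (simp add: A1_def A2_def)
      then show ?thesis using H homotopy_at Y1 Y2 b(4) j(3) by simp
    next
      fix j assume j: "j \<in> points" "\<phi> e = right_lab j" "\<phi> e \<le> 4 * k" "j = height (\<phi> e)"
      have hj: "e < j" using hh(2) j(4) by simp
      have en: "(e, t) \<notin> mov A1" for t using j(1,2) right_left_lab[of t j] by (auto simp: mv)
      have es: "(e, t) \<in> mov A2 \<longleftrightarrow> t = j" for t using j(1,2) right_lab_eq[of j t] hj by (auto simp: mv)
      have e3: "{(t, j, s). (e, t) \<in> mov A1 \<and> (j, s) \<in> mov A2 \<and> j < e \<and> e \<le> s} = {}" using en by blast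
      have Y3: "Y3 = 0" unfolding Y3_def e3 by simp
      have lt: "\<phi> w < \<phi> e \<longleftrightarrow> \<not> j < b" using F(7) unfolding b(2) j(2) right_lab_def by auto
      have I: "{(t, j, s). (e, t) \<in> mov A2 \<and> (j, s) \<in> mov A2 \<and> j < e \<and> e \<le> s \<and> \<not> t < s} = (if \<not> j < b then {(j, w, b)} else {})"
      proof (intro equalityI subsetI)
        fix z assume "z \<in> {(t, j, s). (e, t) \<in> mov A2 \<and> (j, s) \<in> mov A2 \<and> j < e \<and> e \<le> s \<and> \<not> t < s}"
        then obtain t x s where z: "z = (t, x, s)" "(e, t) \<in> mov A2" "(x, s) \<in> mov A2" "x < e" "e \<le> s" "\<not> t < s" by auto
        have "x = w" using jw z by blast
        then show "z \<in> (if \<not> j < b then {(j, w, b)} else {})" using z es ws by simp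
      next
        fix z assume "z \<in> (if \<not> j < b then {(j, w, b)} else {})"
        then show "z \<in> {(t, j, s). (e, t) \<in> mov A2 \<and> (j, s) \<in> mov A2 \<and> j < e \<and> e \<le> s \<and> \<not> t < s}"
          using es ws F(3) hb by (simp split: if_splits)
      qed
      have "e \<noteq> b" using hb by simp
      then have V: "mov A2 - {(e, j), (w, b)} \<union> {(e, b), (w, j)} =
          mov A2 - {(w, b), (e, j)} \<union> {(w, j)} \<union> (if e = b then {} else {(e, b)})" by auto
      have "Y2 = (if \<phi> w < \<phi> e then basis (decode (switch \<phi> w e)) else 0)"
        unfolding Y2_def I lt using main_RR[OF piv w_def b(1,2) j(1,2) _ V[unfolded A2_def]] lt by (simp add: A1_def A2_def)
      then show ?thesis using H homotopy_at Y1 Y3 by simp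
    qed
  qed
qed

text \<open>A function of the multiplicities alone, and hence constant along steps, so that one homotopy
  \<open>homotopy_at e\<close> serves a state and its whole boundary.\<close>
definition pivot_point :: "(nat \<Rightarrow> nat) \<Rightarrow> nat" where
  "pivot_point m = (if \<forall>p\<in>segments. m p \<le> 1
     then (THE p. p \<in> segments \<and> m p = 1 \<and> (\<forall>p'\<in>segments. m p' = 1 \<and> p' \<noteq> p \<longrightarrow> less_Z p p')) + 1
     else (LEAST i. i \<in> segments \<and> 1 < m i))"

lemma idempotent_gen_decode:
  assumes st: "state \<phi>"
  shows "idempotent_gen (decode \<phi>) \<longleftrightarrow> (\<forall>c\<in>segments. card (cover \<phi> c) = 0)"
proof
  assume i: "idempotent_gen (decode \<phi>)"
  have "covering (side left_lab \<phi>) c = {}" "covering (side right_lab \<phi>) c = {}" for c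
    using i by (auto simp: decode_def idempotent_def covering_def)
  then have "multiplicity (decode \<phi>) c = 0" for c by (simp add: decode_def)
  then show "\<forall>c\<in>segments. card (cover \<phi> c) = 0" using multiplicity_decode[OF st] by simp
next
  assume z: "\<forall>c\<in>segments. card (cover \<phi> c) = 0"
  have "mov (side lab \<phi>) = {}" if lab: "is_side lab" for lab
  proof (rule ccontr)
    assume "mov (side lab \<phi>) \<noteq> {}"
    then obtain s t where "(s, t) \<in> mov (side lab \<phi>)" by auto
    then have m: "s < t" "t \<in> points" "\<phi> s = lab t" by (simp_all add: mov_side[OF lab])
    have s: "s \<in> points" using moving_mate_free(1)[OF lab st m] .
    have "s \<in> cover \<phi> s" using m lab_facts(3)[OF lab m(2)] by (simp add: cover_def)
    then have "card (cover \<phi> s) \<noteq> 0" using finite_cover by auto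
    moreover have "s \<in> segments" using s m by (auto simp: points_def segments_def)
    ultimately show False using z by metis
  qed
  then show "idempotent_gen (decode \<phi>)" using is_side_left is_side_right by (simp add: decode_def idempotent_def)
qed

lemma pivot_point_pivot:
  assumes st: "state \<phi>" and ni: "\<not> idempotent_gen (decode \<phi>)"
  defines "e \<equiv> pivot_point (\<lambda>c. card (cover \<phi> c))"
  shows "pivot e \<phi>"
    and "\<forall>p\<in>segments. card (cover \<phi> p) \<le> 1 \<Longrightarrow> card (cover \<phi> e) \<le> 1 \<and> key_segment (decode \<phi>) = e - 1"
    and "\<not> (\<forall>p\<in>segments. card (cover \<phi> p) \<le> 1) \<Longrightarrow>
      2 \<le> card (cover \<phi> e) \<and> (LEAST i. i \<in> segments \<and> 1 < multiplicity (decode \<phi>) i) = e"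
proof -
  let ?m = "\<lambda>c. card (cover \<phi> c)"
  have m: "multiplicity (decode \<phi>) = ?m" using multiplicity_decode[OF st] by blast
  have top: "cover \<phi> c = {}" if "4 * k \<le> c" for c
  proof -
    have "s \<notin> cover \<phi> c" for s using height_le[of "\<phi> s"] that by (simp add: cover_def)
    then show ?thesis by blast
  qed
  have bot: "cover \<phi> 0 = {}"
  proof -
    have "\<phi> 0 = 0" using state_bounds[OF st, of 0] by auto
    then have "s \<notin> cover \<phi> 0" for s by (cases "s = 0") (simp_all add: cover_def)
    then show ?thesis by blast
  qed
  have both: "pivot e \<phi> \<and> ?m e \<le> 1 \<and> key_segment (decode \<phi>) = e - 1" if one: "\<forall>p\<in>segments. ?m p \<le> 1"
  proof -
    obtain p where "p \<in> segments" "?m p \<noteq> 0" using ni idempotent_gen_decode[OF st] by blast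
    then have ex: "\<exists>p\<in>segments. ?m p = 1" using one by (metis le_neq_implies_less less_one)
    define key where "key = (THE p. p \<in> segments \<and> ?m p = 1 \<and> (\<forall>p'\<in>segments. ?m p' = 1 \<and> p' \<noteq> p \<longrightarrow> less_Z p p'))"
    note K = key_exists[OF ex, folded key_def]
    have e: "e = key + 1" using one by (simp add: e_def pivot_point_def key_def)
    have ks: "key_segment (decode \<phi>) = key" unfolding key_segment_def m key_def ..
    have kp: "1 \<le> key" "key + 1 \<le> 4 * k" using K(1) by (auto simp: segments_def)
    have "cover \<phi> (mate e) = {}"
    proof (cases "mate e \<in> segments")
      case True
      then have "?m (mate e) = 0" using K(3) one e by (metis le_neq_implies_less less_one)
      then show ?thesis using finite_cover by simp
    next
      case False
      then have "4 * k \<le> mate e" using mate_pt[of e] kp e by (auto simp: segments_def)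
      then show ?thesis by (rule top)
    qed
    moreover have "?m e \<le> 1"
    proof (cases "e \<in> segments")
      case False
      then have "4 * k \<le> e" using kp e by (auto simp: segments_def)
      then show ?thesis using top by simp
    qed (use one in blast)
    ultimately show ?thesis using st K(2) kp e ks by (simp add: pivot_def)
  qed
  have many: "pivot e \<phi> \<and> 2 \<le> ?m e \<and> (LEAST i. i \<in> segments \<and> 1 < multiplicity (decode \<phi>) i) = e"
    if two: "\<not> (\<forall>p\<in>segments. ?m p \<le> 1)"
  proof -
    have ed: "e = (LEAST i. i \<in> segments \<and> 1 < ?m i)" using two by (auto simp: e_def pivot_point_def)
    obtain p where "p \<in> segments \<and> 1 < ?m p" using two by (auto simp: not_le)
    then have e: "e \<in> segments \<and> 1 < ?m e" unfolding ed by (rule LeastI)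
    then have e1: "1 \<le> e" "e \<le> 4 * k" by (auto simp: segments_def)
    have "cover \<phi> e \<subseteq> insert e (cover \<phi> (e - 1))"
      unfolding cover_def by auto
    then have "?m e \<le> card (insert e (cover \<phi> (e - 1)))" by (intro card_mono) (simp_all add: finite_cover)
    then have "?m e \<le> Suc (?m (e - 1))" by (simp add: card_insert_if finite_cover split: if_splits)
    moreover have "?m (e - 1) \<le> 1"
    proof (cases "e = 1")
      case True
      then show ?thesis using bot by simp
    next
      case False
      then have "e - 1 \<in> segments" using e by (auto simp: segments_def)
      moreover have "\<not> (e - 1 \<in> segments \<and> 1 < ?m (e - 1))"
        using not_less_Least[of "e - 1" "\<lambda>i. i \<in> segments \<and> 1 < ?m i"] ed e1 by auto
      ultimately show ?thesis by simp
    qed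
    ultimately have "?m (e - 1) = 1" using e by simp
    then show ?thesis using st e e1 ed m by (simp add: pivot_def)
  qed
  show "pivot e \<phi>" using both many by blast
  show "\<forall>p\<in>segments. ?m p \<le> 1 \<Longrightarrow> ?m e \<le> 1 \<and> key_segment (decode \<phi>) = e - 1" using both by blast
  show "\<not> (\<forall>p\<in>segments. ?m p \<le> 1) \<Longrightarrow> 2 \<le> ?m e \<and> (LEAST i. i \<in> segments \<and> 1 < multiplicity (decode \<phi>) i) = e"
    using many by blast
qed

lemma H_gen_decode:
  assumes st: "state \<phi>" and ni: "\<not> idempotent_gen (decode \<phi>)"
  shows "H_gen (decode \<phi>) = to_gens (homotopy_at (pivot_point (\<lambda>c. card (cover \<phi> c))) \<phi>)"
proof (cases "\<forall>p\<in>segments. card (cover \<phi> p) \<le> 1")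
  case True
  then show ?thesis
    using H_one_decode pivot_point_pivot(1)[OF st ni] pivot_point_pivot(2)[OF st ni] ni
    by (simp add: H_gen_def multiplicity_decode[OF st])
next
  case False
  then have "H_gen (decode \<phi>) = H_many (decode \<phi>)"
    using ni by (auto simp: H_gen_def multiplicity_decode[OF st])
  then show ?thesis
    using H_many_decode[OF pivot_point_pivot(1)[OF st ni]] pivot_point_pivot(3)[OF st ni False] by metis
qed

lemma keys_boundary:
  assumes st: "state \<phi>" and \<psi>: "\<psi> \<in> Poly_Mapping.keys (boundary \<phi>)"
  shows "state \<psi>" "card (cover \<psi> c) = card (cover \<phi> c)"
proof -
  have "Poly_Mapping.keys (boundary \<phi>) \<subseteq> (\<Union>(p, q)\<in>edges \<phi>. {switch \<phi> p q})"
    unfolding boundary_def using Poly_Mapping.keys_sum[of "\<lambda>(p, q). basis (switch \<phi> p q)" "edges \<phi>"] by (auto simp: case_prod_beta)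
  then obtain p q where e: "(p, q) \<in> edges \<phi>" "\<psi> = switch \<phi> p q" using \<psi> by auto
  show "state \<psi>" unfolding e(2) by (rule state_edge[OF st e(1)])
  show "card (cover \<psi> c) = card (cover \<phi> c)" unfolding e(2) using edgeD[OF e(1)] by (intro card_cover_switch[OF st])
qed

lemma keys_homotopy:
  assumes piv: "pivot e \<phi>" and \<psi>: "\<psi> \<in> Poly_Mapping.keys (homotopy_at e \<phi>)"
  shows "state \<psi>"
proof -
  define w where "w = under e \<phi>"
  note F = piv_facts[OF piv w_def]
  define Rs where "Rs = {r. r \<noteq> mate e \<and> \<phi> r = 8 * k + 1 - mate e}"
  have "Poly_Mapping.keys (\<Sum>r\<in>Rs. basis (\<phi>(r := mate e, w := 8 * k + 1 - e))) \<subseteq>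
      (\<Union>r\<in>Rs. {\<phi>(r := mate e, w := 8 * k + 1 - e)})"
    using Poly_Mapping.keys_sum[of "\<lambda>r. basis (\<phi>(r := mate e, w := 8 * k + 1 - e))" Rs] by simp
  moreover have "\<psi> \<in> Poly_Mapping.keys (basis (switch \<phi> w e) +
      (if \<phi> w = e then \<Sum>r\<in>Rs. basis (\<phi>(r := mate e, w := 8 * k + 1 - e)) else 0))"
    using \<psi> by (simp add: homotopy_at_def Let_def w_def[symmetric] Rs_def split: if_splits)
  ultimately have "\<psi> = switch \<phi> w e \<or> (\<phi> w = e \<and> (\<exists>r\<in>Rs. \<psi> = \<phi>(r := mate e, w := 8 * k + 1 - e)))"
    using Poly_Mapping.keys_add[of "basis (switch \<phi> w e)" "if \<phi> w = e then \<Sum>r\<in>Rs. basis (\<phi>(r := mate e, w := 8 * k + 1 - e)) else 0"]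
    by (auto split: if_splits)
  then show "state \<psi>"
    using state_switch[OF F(1,6,5,3,4)] exchange_state[OF F(1,2,3)] by (auto simp: Rs_def)
qed

lemma lin_to_gens: "lin G (to_gens x) = lin (\<lambda>\<phi>. G (decode \<phi>)) x"
  by (simp add: to_gens_def lin_lin)

lemma to_gens_lin: "lin (\<lambda>\<phi>. to_gens (G \<phi>)) x = to_gens (lin G x)"
  by (simp add: to_gens_def lin_lin)

lemma keys_to_gens:
  assumes "\<And>\<phi>. \<phi> \<in> Poly_Mapping.keys x \<Longrightarrow> state \<phi>"
  shows "Poly_Mapping.keys (to_gens x) \<subseteq> M_gens"
  using keys_lin[of "\<lambda>\<phi>. basis (decode \<phi>)" x] assms decode_M_gens unfolding to_gens_def by fastforce

text \<open>Without moving strands there are no steps, and both sides vanish. Otherwise the defect at the common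
  pivot is zero.\<close>
lemma homotopy_gen:
  assumes y: "y \<in> M_gens"
  shows "lin d_gen (H_gen y) + lin H_gen (d_gen y) = basis y + (if idempotent_gen y then basis y else 0)"
    "Poly_Mapping.keys (d_gen y) \<subseteq> M_gens" "Poly_Mapping.keys (H_gen y) \<subseteq> M_gens"
proof -
  obtain \<phi> where st: "state \<phi>" and y': "y = decode \<phi>" using decode_surj[OF y] by blast
  have dy: "d_gen y = to_gens (boundary \<phi>)" unfolding y' by (rule d_gen_decode[OF st])
  show "Poly_Mapping.keys (d_gen y) \<subseteq> M_gens" unfolding dy by (rule keys_to_gens[OF keys_boundary(1)[OF st]])
  show "Poly_Mapping.keys (H_gen y) \<subseteq> M_gens"
  proof (cases "idempotent_gen y")
    case True
    then show ?thesis by (simp add: H_gen_def)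
  next
    case False
    then have ni: "\<not> idempotent_gen (decode \<phi>)" by (simp add: y')
    show ?thesis unfolding y' H_gen_decode[OF st ni]
      by (rule keys_to_gens[OF keys_homotopy[OF pivot_point_pivot(1)[OF st ni]]])
  qed
  show "lin d_gen (H_gen y) + lin H_gen (d_gen y) = basis y + (if idempotent_gen y then basis y else 0)"
  proof (cases "idempotent_gen y")
    case True
    have z: "card (cover \<phi> c) = 0" if "c \<in> segments" for c
      using True idempotent_gen_decode[OF st] that by (simp add: y')
    have "edges \<phi> = {}"
    proof (rule ccontr)
      assume "edges \<phi> \<noteq> {}"
      then obtain p q where e: "(p, q) \<in> edges \<phi>" by auto
      note E = edgeD[OF e]
      have "p \<in> cover \<phi> p" using E(1,5) by (simp add: cover_def)
      moreover have "p \<in> segments" using state_bounds[OF st E(3)] state_bounds[OF st E(2)] E(1) by (simp add: segments_def)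
      ultimately show False using z[of p] finite_cover by auto
    qed
    then have "d_gen y = 0" unfolding dy by (simp add: boundary_def to_gens_def)
    then show ?thesis using True by (simp add: H_gen_def)
  next
    case False
    then have ni: "\<not> idempotent_gen (decode \<phi>)" by (simp add: y')
    define e where "e = pivot_point (\<lambda>c. card (cover \<phi> c))"
    have piv: "pivot e \<phi>" unfolding e_def by (rule pivot_point_pivot(1)[OF st ni])
    have "lin d_gen (H_gen y) = lin (\<lambda>\<psi>. d_gen (decode \<psi>)) (homotopy_at e \<phi>)"
      unfolding y' H_gen_decode[OF st ni] e_def by (rule lin_to_gens)
    also have "\<dots> = lin (\<lambda>\<psi>. to_gens (boundary \<psi>)) (homotopy_at e \<phi>)"
      by (rule lin_cong) (rule d_gen_decode[OF keys_homotopy[OF piv]])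
    also have "\<dots> = to_gens (lin boundary (homotopy_at e \<phi>))" by (rule to_gens_lin)
    finally have 1: "lin d_gen (H_gen y) = to_gens (lin boundary (homotopy_at e \<phi>))" .
    have "lin H_gen (d_gen y) = lin (\<lambda>\<psi>. H_gen (decode \<psi>)) (boundary \<phi>)" unfolding dy by (rule lin_to_gens)
    also have "\<dots> = lin (\<lambda>\<psi>. to_gens (homotopy_at e \<psi>)) (boundary \<phi>)"
    proof (rule lin_cong)
      fix \<psi> assume k: "\<psi> \<in> Poly_Mapping.keys (boundary \<phi>)"
      have st': "state \<psi>" and c: "\<And>c. card (cover \<psi> c) = card (cover \<phi> c)" using keys_boundary[OF st k] by auto
      have "\<not> idempotent_gen (decode \<psi>)" using ni idempotent_gen_decode[OF st] idempotent_gen_decode[OF st'] c by simp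
      then show "H_gen (decode \<psi>) = to_gens (homotopy_at e \<psi>)" using H_gen_decode[OF st'] c by (simp add: e_def)
    qed
    also have "\<dots> = to_gens (lin (homotopy_at e) (boundary \<phi>))" by (rule to_gens_lin)
    finally have 2: "lin H_gen (d_gen y) = to_gens (lin (homotopy_at e) (boundary \<phi>))" .
    have "lin boundary (homotopy_at e \<phi>) + lin (homotopy_at e) (boundary \<phi>) = basis \<phi>"
      using defect_zero[OF piv] unfolding defect_def f2_add_eq_0_iff .
    then have "to_gens (lin boundary (homotopy_at e \<phi>)) + to_gens (lin (homotopy_at e) (boundary \<phi>)) = basis y"
      unfolding to_gens_def lin_add[symmetric] y' by simp
    then show ?thesis using 1 2 False by simp
  qed
qed

lemma homotopy:
  assumes x: "x \<in> M"
  shows "(d \<circ> H) x + (H \<circ> d) x = x + (f \<circ> g) x"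
proof -
  have kx: "Poly_Mapping.keys x \<subseteq> M_gens" using x by (simp add: M_def)
  let ?G = "\<lambda>y. if idempotent_gen y then basis y else 0"
  have Hx: "H x = lin H_gen x" and dx: "d x = lin d_gen x" and gx: "g x = lin ?G x"
    using x by (simp_all add: H_def d_def g_def)
  have "lin H_gen x \<in> M" using keys_lin[of H_gen x] homotopy_gen(3) kx unfolding M_def by blast
  then have dH: "d (H x) = lin (\<lambda>y. lin d_gen (H_gen y)) x" by (simp add: d_def Hx lin_lin)
  have "lin d_gen x \<in> M" using keys_lin[of d_gen x] homotopy_gen(2) kx unfolding M_def by blast
  then have Hd: "H (d x) = lin (\<lambda>y. lin H_gen (d_gen y)) x" by (simp add: H_def dx lin_lin)
  have "Poly_Mapping.keys (?G y) \<subseteq> {y \<in> M_gens. idempotent_gen y}" if "y \<in> M_gens" for y using that by simp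
  then have "lin ?G x \<in> N" using keys_lin[of ?G x] kx unfolding N_def by blast
  then have fg: "f (g x) = lin ?G x" by (simp add: f_def gx)
  have "d (H x) + H (d x) = lin (\<lambda>y. lin d_gen (H_gen y) + lin H_gen (d_gen y)) x"
    by (simp add: dH Hd lin_plus_map)
  also have "\<dots> = lin (\<lambda>y. basis y + ?G y) x"
    by (rule lin_cong) (rule homotopy_gen(1), use kx in blast)
  also have "\<dots> = x + f (g x)" by (simp add: lin_plus_map lin_basis_id fg)
  finally show ?thesis by simp
qed

end

theorem mainTheorem4:
  fixes k :: nat and mate :: "nat \<Rightarrow> nat"
  assumes "pmc k mate"
  shows "\<forall>x \<in> pmc.M k mate.
    (pmc.d k mate \<circ> pmc.H k mate) x + (pmc.H k mate \<circ> pmc.d k mate) x =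
    x + (pmc.f k mate \<circ> pmc.g k mate) x"
  using pmc.homotopy[OF assms] by blast

end
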